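(* Let $I$ be a homogeneous ideal of $R=k[x_1,\ldots,x_n]$ such that $A=R/I$ is a (nonzero) standard graded Artinian $k$-algebra. If $A$ has the weak Lefschetz property, then: (1) $\beta_{n-1,n-1+d}(\mathrm{gin}(I))=0$ if $d\le r_1(A)$, and $\beta_{n-1,n-1+d}(\mathrm{gin}(I))=H(A,d-1)-H(A,d)$ if $d>r_1(A)$. (2) For any $0\le i\le n-1$ and $d\ge r_1(A)+2$, $$\beta_{i,i+d}(\mathrm{gin}(I))=\binom{n-1}{i}\bigl(H(A,d-1)-H(A,d)\bigr).$$
   Context: $k$ is a field of characteristic $0$, $R=k[x_1,\ldots,x_n]$ with the standard grading. $\mathrm{gin}(I)$ denotes the generic initial ideal of $I$ with respect to the reverse lexicographic order (with $x_1>\cdots>x_n$): $\mathrm{gin}(I)=\mathrm{in}(gI)$ for $g$ in a nonempty Zariski open subset of $GL_n(k)$. $H(A,d)=\dim_k A_d$ is the Hilbert function. For a homogeneous ideal $K$, $\beta_{q,i}(K)=\dim_k\mathrm{Tor}^R_q(K,k)_i$. Weak Lefschetz property of $A=R/I$: there is a linear form $L\in R$ such that $\times L:A_d\to A_{d+1}$ has maximal rank (is injective or surjective) for each $d\ge 0$. First reduction number: $r_1(A)=\min\{t \mid (R/(I+(L)))_{t+1}=0\}$, where $L$ is a general linear form of $R$. *)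

theory Defs
  imports
    "HOL-Analysis.Determinants"
    "HOL-Library.Poly_Mapping"
    "HOL-Library.Function_Algebras"
begin

section \<open>Polynomials, ideals, homogeneous components\<close>

text \<open>
  The ring \<open>R = k[x\<^sub>1, \<dots>, x\<^sub>n]\<close> is \<open>('n, 'k) mpoly\<close>, with variables indexed by a finite linearly
  ordered type \<open>'n\<close> having \<open>n\<close> elements. The smallest index is \<open>x\<^sub>1\<close>, the largest one is \<open>x\<^sub>n\<close>.
\<close>

type_synonym ('n, 'k) mpoly = "('n \<Rightarrow>\<^sub>0 nat) \<Rightarrow>\<^sub>0 'k"

definition Const :: "'k \<Rightarrow> ('n, 'k::field) mpoly" where
  "Const c = Poly_Mapping.single 0 c"

definition Var :: "'n \<Rightarrow> ('n, 'k::field) mpoly" where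
  "Var i = Poly_Mapping.single (Poly_Mapping.single i 1) 1"

definition const_coeff :: "('n, 'k::field) mpoly \<Rightarrow> 'k" where
  "const_coeff p = Poly_Mapping.lookup p 0"

definition mdeg :: "('n::finite \<Rightarrow>\<^sub>0 nat) \<Rightarrow> nat" where
  "mdeg m = (\<Sum>i\<in>UNIV. Poly_Mapping.lookup m i)"

definition homogeneous :: "nat \<Rightarrow> ('n::finite, 'k::field) mpoly \<Rightarrow> bool" where
  "homogeneous d p \<longleftrightarrow> (\<forall>m\<in>Poly_Mapping.keys p. mdeg m = d)"

definition hom_comp :: "nat \<Rightarrow> ('n::finite, 'k::field) mpoly set" where
  "hom_comp d = {p. homogeneous d p}"

definition pscale :: "'k \<Rightarrow> ('n, 'k::field) mpoly \<Rightarrow> ('n, 'k) mpoly" where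
  "pscale c p = Const c * p"

definition fscale :: "'k::field \<Rightarrow> (nat \<Rightarrow> 'k) \<Rightarrow> nat \<Rightarrow> 'k" where
  "fscale c v = (\<lambda>j. c * v j)"

global_interpretation pol_mod: module "(*) :: ('n, 'k::field) mpoly \<Rightarrow> _ \<Rightarrow> _"
  by unfold_locales (simp_all add: algebra_simps)

lemma vector_space_pscale: "vector_space (pscale :: 'k::field \<Rightarrow> ('n, 'k) mpoly \<Rightarrow> _)"
proof
  fix a b :: 'k and p q :: "('n, 'k) mpoly"
  show "pscale a (p + q) = pscale a p + pscale a q"
    by (simp add: pscale_def algebra_simps)
  show "pscale (a + b) p = pscale a p + pscale b p"
    by (simp add: pscale_def Const_def single_add algebra_simps)
  show "pscale a (pscale b p) = pscale (a * b) p"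
    by (simp add: pscale_def Const_def mult_single flip: mult.assoc)
  show "pscale 1 p = p"
    by (simp add: pscale_def Const_def)
qed

lemma vector_space_fscale: "vector_space (fscale :: 'k::field \<Rightarrow> _)"
  by unfold_locales (simp_all add: fscale_def fun_eq_iff algebra_simps)

abbreviation is_ideal :: "('n, 'k::field) mpoly set \<Rightarrow> bool" where
  "is_ideal \<equiv> pol_mod.subspace"

abbreviation ideal_gen :: "('n, 'k::field) mpoly set \<Rightarrow> ('n, 'k) mpoly set" where
  "ideal_gen \<equiv> pol_mod.span"

definition homogeneous_ideal :: "('n::finite, 'k::field) mpoly set \<Rightarrow> bool" where
  "homogeneous_ideal I \<longleftrightarrow> (\<exists>S. (\<forall>p\<in>S. \<exists>d. homogeneous d p) \<and> I = ideal_gen S)"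

text \<open>Descending chain condition for ideals of \<open>R/I\<close>, i.e. for ideals of \<open>R\<close> containing \<open>I\<close>.\<close>

definition artinian_quotient :: "('n, 'k::field) mpoly set \<Rightarrow> bool" where
  "artinian_quotient I \<longleftrightarrow>
     (\<forall>J :: nat \<Rightarrow> ('n, 'k) mpoly set.
        (\<forall>i. is_ideal (J i) \<and> I \<subseteq> J i) \<and> decseq J \<longrightarrow> (\<exists>N. \<forall>i\<ge>N. J i = J N))"

section \<open>Dimension of quotient spaces, Hilbert function\<close>

text \<open>
  Residue classes in \<open>V/W\<close> are handled through representatives: \<open>quotient_basis s V W B\<close> says that
  the elements of \<open>B\<close> represent, without repetition, a basis of \<open>V/W\<close>. As for the library's
  dimension, the value of \<open>quotient_dim\<close> in the infinite-dimensional case is \<open>0\<close>.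
\<close>

definition quotient_basis ::
    "('k::field \<Rightarrow> 'v \<Rightarrow> 'v::ab_group_add) \<Rightarrow> 'v set \<Rightarrow> 'v set \<Rightarrow> 'v set \<Rightarrow> bool" where
  "quotient_basis s V W B \<longleftrightarrow>
     B \<subseteq> V \<and> \<not> module.dependent s B \<and> module.span s B \<inter> W = {0} \<and>
     (\<forall>v\<in>V. \<exists>b\<in>module.span s B. v - b \<in> W)"

definition quotient_dim ::
    "('k::field \<Rightarrow> 'v \<Rightarrow> 'v::ab_group_add) \<Rightarrow> 'v set \<Rightarrow> 'v set \<Rightarrow> nat" where
  "quotient_dim s V W = card (SOME B. quotient_basis s V W B)"

text \<open>\<open>hilb I d = dim\<^sub>k (R/I)\<^sub>d = dim\<^sub>k R\<^sub>d / (I \<inter> R\<^sub>d)\<close>\<close>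

definition hilb :: "('n::finite, 'k::field) mpoly set \<Rightarrow> nat \<Rightarrow> nat" where
  "hilb I d = quotient_dim pscale (hom_comp d) (I \<inter> hom_comp d)"

section \<open>Weak Lefschetz property\<close>

text \<open>Injectivity and surjectivity of \<open>\<times>L : (R/I)\<^sub>d \<rightarrow> (R/I)\<^sub>d\<^sub>+\<^sub>1\<close> for a linear form \<open>L\<close>.\<close>

definition mult_injective ::
    "('n::finite, 'k::field) mpoly set \<Rightarrow> ('n, 'k) mpoly \<Rightarrow> nat \<Rightarrow> bool" where
  "mult_injective I L d \<longleftrightarrow> (\<forall>p\<in>hom_comp d. L * p \<in> I \<longrightarrow> p \<in> I)"

definition mult_surjective ::
    "('n::finite, 'k::field) mpoly set \<Rightarrow> ('n, 'k) mpoly \<Rightarrow> nat \<Rightarrow> bool" where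
  "mult_surjective I L d \<longleftrightarrow> (\<forall>q\<in>hom_comp (Suc d). \<exists>p\<in>hom_comp d. q - L * p \<in> I)"

definition weak_lefschetz :: "('n::finite, 'k::field) mpoly set \<Rightarrow> bool" where
  "weak_lefschetz I \<longleftrightarrow>
     (\<exists>L\<in>hom_comp 1. \<forall>d. mult_injective I L d \<or> mult_surjective I L d)"

section \<open>Zariski open sets and general linear forms\<close>

text \<open>Evaluation of \<open>p\<close>, with \<open>h\<close> applied to the coefficients and \<open>a i\<close> substituted for \<open>x\<^sub>i\<close>.\<close>

definition mp_eval :: "('k::field \<Rightarrow> 'r::comm_ring_1) \<Rightarrow> ('n \<Rightarrow> 'r) \<Rightarrow> ('n, 'k) mpoly \<Rightarrow> 'r" where
  "mp_eval h a p =
     (\<Sum>m\<in>Poly_Mapping.keys p.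
        h (Poly_Mapping.lookup p m) * (\<Prod>i\<in>Poly_Mapping.keys m. a i ^ Poly_Mapping.lookup m i))"

definition zariski_open :: "('i \<Rightarrow> 'k::field) set \<Rightarrow> bool" where
  "zariski_open U \<longleftrightarrow>
     (\<exists>S :: ('i, 'k) mpoly set. U = {a. \<exists>p\<in>S. mp_eval (\<lambda>c. c) a p \<noteq> 0})"

definition linear_form :: "('n::finite \<Rightarrow> 'k::field) \<Rightarrow> ('n, 'k) mpoly" where
  "linear_form c = (\<Sum>i\<in>UNIV. Const (c i) * Var i)"

text \<open>
  \<open>reduction_number_wrt I L\<close> is \<open>min {t. (R/(I + (L)))\<^sub>t\<^sub>+\<^sub>1 = 0}\<close>, and \<open>reduction_number I\<close> is the
  common value of this for all \<open>L\<close> in some nonempty Zariski open set of linear forms. Such a value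
  is unique since \<open>k\<close> is infinite, so that any two nonempty open sets meet.
\<close>

definition reduction_number_wrt ::
    "('n::finite, 'k::field) mpoly set \<Rightarrow> ('n, 'k) mpoly \<Rightarrow> nat" where
  "reduction_number_wrt I L = (LEAST t. hom_comp (t + 1) \<subseteq> ideal_gen (I \<union> {L}))"

definition reduction_number :: "('n::finite, 'k::field_char_0) mpoly set \<Rightarrow> nat" where
  "reduction_number I =
     (THE r. \<exists>U. zariski_open U \<and> U \<noteq> {} \<and>
        (\<forall>c\<in>U. reduction_number_wrt I (linear_form c) = r))"

section \<open>Generic initial ideals\<close>

text \<open>Degree reverse lexicographic order with \<open>x\<^sub>1 > \<dots> > x\<^sub>n\<close>.\<close>

definition revlex_less :: "('n::{finite,linorder} \<Rightarrow>\<^sub>0 nat) \<Rightarrow> ('n \<Rightarrow>\<^sub>0 nat) \<Rightarrow> bool" where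
  "revlex_less m m' \<longleftrightarrow>
     mdeg m < mdeg m' \<or>
     mdeg m = mdeg m' \<and> (\<exists>i. Poly_Mapping.lookup m i > Poly_Mapping.lookup m' i \<and>
       (\<forall>j>i. Poly_Mapping.lookup m j = Poly_Mapping.lookup m' j))"

definition init_monom :: "('n::{finite,linorder}, 'k::field) mpoly \<Rightarrow> ('n \<Rightarrow>\<^sub>0 nat)" where
  "init_monom p =
     (THE m. m \<in> Poly_Mapping.keys p \<and>
        (\<forall>m'\<in>Poly_Mapping.keys p. m' \<noteq> m \<longrightarrow> revlex_less m' m))"

definition init_ideal ::
    "('n::{finite,linorder}, 'k::field) mpoly set \<Rightarrow> ('n, 'k) mpoly set" where
  "init_ideal I = ideal_gen {Poly_Mapping.single (init_monom p) 1 | p. p \<in> I \<and> p \<noteq> 0}"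

text \<open>The action of \<open>g\<close> on \<open>R\<close> by the linear substitution \<open>x\<^sub>j \<mapsto> \<Sum>\<^sub>i g\<^sub>i\<^sub>j x\<^sub>i\<close>.\<close>

definition coord_change :: "'k::field^'n^'n \<Rightarrow> ('n::finite, 'k) mpoly \<Rightarrow> ('n, 'k) mpoly" where
  "coord_change g = mp_eval Const (\<lambda>j. \<Sum>i\<in>UNIV. Const (g $ i $ j) * Var i)"

text \<open>Open subsets of \<open>GL\<^sub>n(k)\<close>, in the topology induced from the affine space of matrices.\<close>

definition GL_open :: "('k::field^'n^'n) set \<Rightarrow> bool" where
  "GL_open U \<longleftrightarrow>
     (\<exists>V. zariski_open V \<and> U = {g. invertible g \<and> (\<lambda>(i, j). g $ i $ j) \<in> V})"

definition gin ::
    "('n::{finite,linorder}, 'k::field_char_0) mpoly set \<Rightarrow> ('n, 'k) mpoly set" where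
  "gin I = (THE J. \<exists>U. GL_open U \<and> U \<noteq> {} \<and> (\<forall>g\<in>U. init_ideal (coord_change g ` I) = J))"

section \<open>Graded free resolutions and graded Betti numbers\<close>

text \<open>
  Data for a complex \<open>\<dots> \<rightarrow> F\<^sub>2 \<rightarrow> F\<^sub>1 \<rightarrow> F\<^sub>0 \<rightarrow> K\<close> with \<open>F\<^sub>q = \<Oplus>\<^sub>j\<^sub><\<^sub>r R(-a\<^sub>j)\<close>, where
  \<open>r = rank F q\<close> and \<open>a\<^sub>j = twist F q j\<close>. The generators of \<open>F\<^sub>0\<close> are sent to the elements \<open>aug F j\<close>,
  and \<open>diff F q\<close> is the matrix of \<open>F\<^sub>q\<^sub>+\<^sub>1 \<rightarrow> F\<^sub>q\<close>. Elements of \<open>R\<^sup>r\<close> are the functions on \<open>nat\<close> that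
  vanish outside \<open>{..<r}\<close>.
\<close>

record 'r free_complex =
  rank :: "nat \<Rightarrow> nat"
  twist :: "nat \<Rightarrow> nat \<Rightarrow> nat"
  aug :: "nat \<Rightarrow> 'r"
  diff :: "nat \<Rightarrow> nat \<Rightarrow> nat \<Rightarrow> 'r"

definition free_mod :: "nat \<Rightarrow> (nat \<Rightarrow> ('n, 'k::field) mpoly) set" where
  "free_mod r = {v. \<forall>j\<ge>r. v j = 0}"

definition aug_map ::
    "('n, 'k::field) mpoly free_complex \<Rightarrow> (nat \<Rightarrow> ('n, 'k) mpoly) \<Rightarrow> ('n, 'k) mpoly" where
  "aug_map F v = (\<Sum>j<rank F 0. aug F j * v j)"

definition diff_map ::
    "('n, 'k::field) mpoly free_complex \<Rightarrow> nat \<Rightarrow> (nat \<Rightarrow> ('n, 'k) mpoly) \<Rightarrow> nat \<Rightarrow> ('n, 'k) mpoly" where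
  "diff_map F q v =
     (\<lambda>l. if l < rank F q then \<Sum>j<rank F (Suc q). diff F q l j * v j else 0)"

text \<open>The last three conjuncts state exactness of \<open>\<dots> \<rightarrow> F\<^sub>1 \<rightarrow> F\<^sub>0 \<rightarrow> K \<rightarrow> 0\<close>.\<close>

definition graded_free_resolution ::
    "('n::finite, 'k::field) mpoly set \<Rightarrow> ('n, 'k) mpoly free_complex \<Rightarrow> bool" where
  "graded_free_resolution K F \<longleftrightarrow>
     (\<forall>j<rank F 0. homogeneous (twist F 0 j) (aug F j)) \<and>
     (\<forall>q. \<forall>l<rank F q. \<forall>j<rank F (Suc q). \<forall>m\<in>Poly_Mapping.keys (diff F q l j).
        mdeg m + twist F q l = twist F (Suc q) j) \<and>
     aug_map F ` free_mod (rank F 0) = K \<and>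
     {v \<in> free_mod (rank F 0). aug_map F v = 0} = diff_map F 0 ` free_mod (rank F 1) \<and>
     (\<forall>q. {v \<in> free_mod (rank F (Suc q)). diff_map F q v = 0} =
        diff_map F (Suc q) ` free_mod (rank F (Suc (Suc q))))"

text \<open>
  The complex \<open>F \<otimes>\<^sub>R k\<close>, where \<open>k = R/(x\<^sub>1, \<dots>, x\<^sub>n)\<close>: the space \<open>F\<^sub>q \<otimes> k\<close> has a basis indexed by
  \<open>{..<rank F q}\<close>, its degree \<open>i\<close> part is spanned by the basis elements of twist \<open>i\<close>, and the
  entries of the differentials are the residues modulo \<open>(x\<^sub>1, \<dots>, x\<^sub>n)\<close>, i.e. the constant
  coefficients, of the entries of \<open>diff F\<close>.
\<close>

definition tensor_k :: "('n, 'k::field) mpoly free_complex \<Rightarrow> nat \<Rightarrow> nat \<Rightarrow> (nat \<Rightarrow> 'k) set" where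
  "tensor_k F q i = {v. \<forall>j. v j \<noteq> 0 \<longrightarrow> j < rank F q \<and> twist F q j = i}"

definition diff_k :: "('n, 'k::field) mpoly free_complex \<Rightarrow> nat \<Rightarrow> (nat \<Rightarrow> 'k) \<Rightarrow> nat \<Rightarrow> 'k" where
  "diff_k F q v =
     (\<lambda>l. if l < rank F q then \<Sum>j<rank F (Suc q). const_coeff (diff F q l j) * v j else 0)"

fun cycles_k :: "('n, 'k::field) mpoly free_complex \<Rightarrow> nat \<Rightarrow> nat \<Rightarrow> (nat \<Rightarrow> 'k) set" where
  "cycles_k F 0 i = tensor_k F 0 i"
| "cycles_k F (Suc q) i = {v \<in> tensor_k F (Suc q) i. diff_k F q v = 0}"

definition boundaries_k :: "('n, 'k::field) mpoly free_complex \<Rightarrow> nat \<Rightarrow> nat \<Rightarrow> (nat \<Rightarrow> 'k) set" where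
  "boundaries_k F q i = diff_k F q ` tensor_k F (Suc q) i"

text \<open>
  \<open>betti K q i = dim\<^sub>k Tor\<^sub>q(K, k)\<^sub>i = dim\<^sub>k H\<^sub>q(F \<otimes> k)\<^sub>i\<close> for a graded free resolution \<open>F\<close> of \<open>K\<close>. As
  usual for derived functors, a resolution is chosen, and the result does not depend on the choice.
\<close>

definition betti :: "('n::finite, 'k::field) mpoly set \<Rightarrow> nat \<Rightarrow> nat \<Rightarrow> nat" where
  "betti K q i =
     (let F = (SOME F. graded_free_resolution K F)
      in quotient_dim fscale (cycles_k F q i) (boundaries_k F q i))"

end

(*
  Choose g in GL_n such that the leading monomials of gI are as many as possible in every upper set of
  monomials of every degree. This is a nonempty open condition, as linear independence is open, and such g
  all give the same set S of leading monomials, so gin(I) is the monomial ideal spanned by S. If S did not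
  satisfy the exchange property (x_n m in S implies x_j m in S), then substituting x_n + x_j for x_n in a
  torus translate of gI close to its limit in(gI) would give more leading monomials in an upper set; this
  uses characteristic 0.

  For a stable monomial ideal J, the Koszul homology of R/J with respect to x_1, ..., x_n has in the
  relevant degrees a basis e_n e_T v, where v runs over the monomials killed by x_n in R/J. On the other
  hand, Tor computed from any graded free resolution agrees with Koszul homology by dimension shifting
  along the syzygy modules; the same shift bounds the degrees of the generators of the syzygies, so that a
  resolution by modules of finite rank exists.

  In the reverse lexicographic order, x_n has the same kernel and cokernel dimensions on R/gI and on
  R/in(gI), and the cokernels are the smallest ones possible among all linear forms. So x_n inherits the
  weak Lefschetz property and computes the reduction number; hence its kernel in degree d - 1 vanishes for
  d <= r_1(A), and has dimension H(A,d-1) - H(A,d) for d > r_1(A).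
*)

theory Submission
  imports Defs "HOL-Computational_Algebra.Polynomial"
begin

section \<open>Dimensions of quotient spaces\<close>

text \<open>The two ranges of the theorem have one cause: a Koszul cycle can be moved into the part
  containing e_n if all monomials of degree d - 1 without x_n lie in S. This holds for d \<ge>
  r_1(A) + 2, and for i = n - 1 it is automatic, since an index set with n elements contains n. The
  binomial coefficient counts the sets T. Only x_n is ever exchanged, so stability is proved for the
  last variable alone. In (x_n + x_j)^a the coefficient of x_n^(a-1) x_j is a, which must not vanish
  in k; this is where characteristic 0 enters, besides making k infinite. The given Lefschetz form L
  need not be generic; some other h carries it to x_n. Kernel and cokernel dimensions of x_n differ
  by a value of the Hilbert function alone, so the smallest cokernel means the smallest kernel, and
  injectivity for h yields injectivity for g. \<open>gin\<close>, \<open>reduction_number\<close>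
  and \<open>betti\<close> are defined by description or choice. The first two require that nonempty
  open sets meet, which is checked on a line, with polynomials in one variable; the third requires
  that some resolution of finite ranks exists.\<close>

lemma homogeneous_system:
  fixes M :: "'i \<Rightarrow> 'b \<Rightarrow> 'k::field"
  assumes "finite B" "finite A" "card B < card A"
  shows "\<exists>c. (\<exists>i\<in>A. c i \<noteq> 0) \<and> (\<forall>b\<in>B. (\<Sum>i\<in>A. c i * M i b) = 0)"
  using assms
proof (induction B arbitrary: A M rule: finite_induct)
  case empty
  then obtain a where "a \<in> A" by (metis card.empty equals0I less_irrefl)
  then show ?case by (intro exI[of _ "\<lambda>_. 1"]) auto
next
  case (insert b B)
  show ?case
  proof (cases "\<forall>i\<in>A. M i b = 0")
    case True
    have "card B < card A" using insert by simp
    from insert.IH[OF insert.prems(1) this, of M] obtain c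
      where c: "\<exists>i\<in>A. c i \<noteq> 0" "\<forall>b\<in>B. (\<Sum>i\<in>A. c i * M i b) = 0" by blast
    then show ?thesis using True by (intro exI[of _ c]) auto
  next
    case False
    then obtain j where j: "j \<in> A" "M j b \<noteq> 0" by blast
    have fin: "finite (A - {j})" and cd: "card B < card (A - {j})"
      using insert j by auto
    from insert.IH[OF fin cd, of "\<lambda>i b'. M i b' - M i b / M j b * M j b'"] obtain c
      where c: "\<exists>i\<in>A-{j}. c i \<noteq> 0"
        "\<And>b'. b' \<in> B \<Longrightarrow> (\<Sum>i\<in>A-{j}. c i * (M i b' - M i b / M j b * M j b')) = 0" by blast
    \<comment> \<open>Equation \<open>b\<close> is solved for the unknown at the pivot
      \<open>j\<close>; the induction hypothesis was applied to the system from which this unknown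
      had been eliminated.\<close>
    define d where "d = (\<lambda>i. if i = j then - (\<Sum>i\<in>A-{j}. c i * M i b) / M j b else c i)"
    have sm: "(\<Sum>i\<in>A. d i * M i b') = (\<Sum>i\<in>A-{j}. c i * (M i b' - M i b / M j b * M j b'))" for b'
    proof -
      have "(\<Sum>i\<in>A. d i * M i b') = d j * M j b' + (\<Sum>i\<in>A-{j}. d i * M i b')"
        using j insert.prems by (subst sum.remove[of A j]) auto
      also have "(\<Sum>i\<in>A-{j}. d i * M i b') = (\<Sum>i\<in>A-{j}. c i * M i b')"
        by (rule sum.cong) (auto simp: d_def)
      also have "d j * M j b' = - (\<Sum>i\<in>A-{j}. c i * (M i b / M j b * M j b'))"
        by (simp add: d_def sum_distrib_left sum_distrib_right sum_divide_distrib sum_negf algebra_simps)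
      finally show ?thesis by (simp add: sum_subtractf right_diff_distrib)
    qed
    have "(\<Sum>i\<in>A. d i * M i b) = 0" unfolding sm using j by simp
    moreover have "(\<Sum>i\<in>A. d i * M i b') = 0" if "b' \<in> B" for b'
      unfolding sm using c that by simp
    moreover have "\<exists>i\<in>A. d i \<noteq> 0" using c(1) by (auto simp: d_def)
    ultimately show ?thesis by (intro exI[of _ d]) auto
  qed
qed

text \<open>Bases of \<open>V/W\<close> are handled as indexed families, which can be mapped and
  reindexed without checking that representatives stay distinct.\<close>

definition quotient_family ::
    "('k::field \<Rightarrow> 'v \<Rightarrow> 'v::ab_group_add) \<Rightarrow> 'v set \<Rightarrow> 'v set \<Rightarrow> 'i set \<Rightarrow> ('i \<Rightarrow> 'v) \<Rightarrow> bool" where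
  "quotient_family s V W A e \<longleftrightarrow> finite A \<and> (\<forall>i\<in>A. e i \<in> V) \<and>
     (\<forall>c. (\<Sum>i\<in>A. s (c i) (e i)) \<in> W \<longrightarrow> (\<forall>i\<in>A. c i = 0)) \<and>
     (\<forall>v\<in>V. \<exists>c. v - (\<Sum>i\<in>A. s (c i) (e i)) \<in> W)"

text \<open>A relation instead of the function \<open>quotient_dim\<close>: it also asserts finite
  dimension, whereas \<open>quotient_dim\<close> defaults to 0.\<close>

definition has_qdim ::
    "('k::field \<Rightarrow> 'v \<Rightarrow> 'v::ab_group_add) \<Rightarrow> 'v set \<Rightarrow> 'v set \<Rightarrow> nat \<Rightarrow> bool" where
  "has_qdim s V W k \<longleftrightarrow> (\<exists>e. quotient_family s V W {..<k} e)"

text \<open>Steinitz: expand each \<open>f i\<close> in the family \<open>e\<close> modulo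
  \<open>W\<close>. With more vectors than coordinates the coefficient rows are dependent, and this
  dependence lands in \<open>W\<close>.\<close>

lemma quotient_family_card_le:
  assumes vs: "vector_space s" and W: "module.subspace s W"
    and e: "quotient_family s V W A e"
    and A': "finite A'" "\<And>i. i \<in> A' \<Longrightarrow> f i \<in> V"
    and indep: "\<And>c. (\<Sum>i\<in>A'. s (c i) (f i)) \<in> W \<Longrightarrow> \<forall>i\<in>A'. c i = 0"
  shows "card A' \<le> card A"
proof (rule ccontr)
  interpret vector_space s by fact
  assume "\<not> ?thesis"
  then have lt: "card A < card A'" by simp
  have finA: "finite A" using e by (simp add: quotient_family_def)
  have "\<forall>i\<in>A'. \<exists>m. f i - (\<Sum>j\<in>A. s (m j) (e j)) \<in> W"
    using e A'(2) by (simp add: quotient_family_def)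
  then obtain m where m: "\<And>i. i \<in> A' \<Longrightarrow> f i - (\<Sum>j\<in>A. s (m i j) (e j)) \<in> W" by metis
  from homogeneous_system[OF finA A'(1) lt, of m] obtain c
    where c: "\<exists>i\<in>A'. c i \<noteq> 0" "\<forall>j\<in>A. (\<Sum>i\<in>A'. c i * m i j) = 0" by blast
  have "(\<Sum>i\<in>A'. s (c i) (f i - (\<Sum>j\<in>A. s (m i j) (e j)))) \<in> W"
    using W m by (intro subspace_sum subspace_scale) auto
  moreover have "(\<Sum>i\<in>A'. s (c i) (\<Sum>j\<in>A. s (m i j) (e j))) = 0"
  proof -
    have "(\<Sum>i\<in>A'. s (c i) (\<Sum>j\<in>A. s (m i j) (e j))) = (\<Sum>i\<in>A'. \<Sum>j\<in>A. s (c i * m i j) (e j))"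
      by (simp add: scale_sum_right)
    also have "\<dots> = (\<Sum>j\<in>A. s (\<Sum>i\<in>A'. c i * m i j) (e j))"
      by (subst sum.swap) (simp add: scale_sum_left)
    also have "\<dots> = 0" using c(2) by simp
    finally show ?thesis .
  qed
  ultimately have "(\<Sum>i\<in>A'. s (c i) (f i)) \<in> W"
    by (simp add: scale_right_diff_distrib sum_subtractf)
  with indep c(1) show False by blast
qed

text \<open>Every set chosen by \<open>quotient_basis\<close> is compared with the family in both
  directions, so the choice made in \<open>quotient_dim\<close> does not matter.\<close>

lemma quotient_dim_eq_card:
  assumes vs: "vector_space s" and V: "module.subspace s V" and W: "module.subspace s W"
    and e: "quotient_family s V W A e"
  shows "quotient_dim s V W = card A"
proof -
  interpret vector_space s by fact
  have fam: "finite A" "\<And>i. i \<in> A \<Longrightarrow> e i \<in> V"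
    "\<And>c. (\<Sum>i\<in>A. s (c i) (e i)) \<in> W \<Longrightarrow> \<forall>i\<in>A. c i = 0"
    "\<And>v. v \<in> V \<Longrightarrow> \<exists>c. v - (\<Sum>i\<in>A. s (c i) (e i)) \<in> W"
    using e unfolding quotient_family_def by blast+
  have inj: "inj_on e A"
  proof (rule inj_onI, rule ccontr)
    fix i j assume ij: "i \<in> A" "j \<in> A" "e i = e j" "i \<noteq> j"
    define c where "c = (\<lambda>l. if l = i then 1 else if l = j then - 1 else (0::'a))"
    have "(\<Sum>l\<in>A. s (c l) (e l)) = s (c i) (e i) + (s (c j) (e j) + (\<Sum>l\<in>A-{i}-{j}. s (c l) (e l)))"
      using ij fam(1) by (subst sum.remove[of A i], simp, simp, subst sum.remove[of _ j]) auto
    also have "(\<Sum>l\<in>A-{i}-{j}. s (c l) (e l)) = 0"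
      by (rule sum.neutral) (auto simp: c_def)
    finally have "(\<Sum>l\<in>A. s (c l) (e l)) = 0" using ij by (simp add: c_def)
    then have "(\<Sum>l\<in>A. s (c l) (e l)) \<in> W" using W subspace_0 by simp
    from fam(3)[OF this] ij(1) show False by (auto simp: c_def)
  qed
  have span_img: "x \<in> span (e ` A) \<longleftrightarrow> (\<exists>c. x = (\<Sum>i\<in>A. s (c i) (e i)))" for x
  proof -
    have "span (e ` A) = range (\<lambda>u. \<Sum>v\<in>e ` A. s (u v) v)"
      using fam(1) by (intro span_finite) auto
    moreover have "(\<exists>u. x = (\<Sum>v\<in>e ` A. s (u v) v)) \<longleftrightarrow> (\<exists>c. x = (\<Sum>i\<in>A. s (c i) (e i)))"
    proof
      assume "\<exists>u. x = (\<Sum>v\<in>e ` A. s (u v) v)"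
      then obtain u where "x = (\<Sum>v\<in>e ` A. s (u v) v)" by blast
      then have "x = (\<Sum>i\<in>A. s (u (e i)) (e i))" using inj by (simp add: sum.reindex)
      then show "\<exists>c. x = (\<Sum>i\<in>A. s (c i) (e i))" by (intro exI[of _ "\<lambda>i. u (e i)"])
    next
      assume "\<exists>c. x = (\<Sum>i\<in>A. s (c i) (e i))"
      then obtain c where "x = (\<Sum>i\<in>A. s (c i) (e i))" by blast
      then have "x = (\<Sum>v\<in>e ` A. s (c (the_inv_into A e v)) v)"
        using inj by (simp add: sum.reindex the_inv_into_f_f)
      then show "\<exists>u. x = (\<Sum>v\<in>e ` A. s (u v) v)"
        by (intro exI[of _ "\<lambda>v. c (the_inv_into A e v)"])
    qed
    ultimately show ?thesis by auto
  qed
  have ex: "quotient_basis s V W (e ` A)"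
    unfolding quotient_basis_def
  proof (intro conjI ballI)
    show "e ` A \<subseteq> V" using fam(2) by blast
    show "\<not> dependent (e ` A)"
    proof -
      have "\<forall>v\<in>e ` A. u v = 0" if "(\<Sum>v\<in>e ` A. s (u v) v) = 0" for u
      proof -
        have "(\<Sum>i\<in>A. s (u (e i)) (e i)) = 0" using that inj by (simp add: sum.reindex)
        then have "(\<Sum>i\<in>A. s (u (e i)) (e i)) \<in> W" using W subspace_0 by simp
        from fam(3)[OF this] show ?thesis by blast
      qed
      then show ?thesis using fam(1) by (auto simp: dependent_finite)
    qed
    show "span (e ` A) \<inter> W = {0}"
    proof
      show "span (e ` A) \<inter> W \<subseteq> {0}"
      proof
        fix x assume x: "x \<in> span (e ` A) \<inter> W"
        then obtain c where c: "x = (\<Sum>i\<in>A. s (c i) (e i))" using span_img by auto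
        with fam(3)[of c] x have "\<forall>i\<in>A. c i = 0" by simp
        then show "x \<in> {0}" using c by simp
      qed
      show "{0} \<subseteq> span (e ` A) \<inter> W" using W subspace_0 span_zero by auto
    qed
    show "\<exists>b\<in>span (e ` A). v - b \<in> W" if "v \<in> V" for v
      using fam(4)[OF that] span_img by blast
  qed
  have card_eq: "card B = card A" if B: "quotient_basis s V W B" for B
  proof -
    have B': "B \<subseteq> V" "independent B" "span B \<inter> W = {0}" "\<forall>v\<in>V. \<exists>b\<in>span B. v - b \<in> W"
      using B by (auto simp: quotient_basis_def)
    have indB: "\<forall>i\<in>B0. c i = 0" if "finite B0" "B0 \<subseteq> B" "(\<Sum>i\<in>B0. s (c i) i) \<in> W" for B0 c
    proof -
      have "(\<Sum>i\<in>B0. s (c i) i) \<in> span B"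
        using that by (intro span_sum span_scale span_base) auto
      then have "(\<Sum>i\<in>B0. s (c i) i) = 0" using that B' by blast
      then show ?thesis using independentD[OF B'(2) that(1,2)] by blast
    qed
    have bound: "card B0 \<le> card A" if "finite B0" "B0 \<subseteq> B" for B0
      using quotient_family_card_le[OF vs W e that(1), of "\<lambda>x. x"] that B'(1) indB[OF that] by blast
    \<comment> \<open>An infinite basis would have \<open>card\<close> equal to 0; the bound on its
      finite subsets rules this out.\<close>
    have finB: "finite B"
    proof (rule ccontr)
      assume "infinite B"
      then obtain B0 where "finite B0" "card B0 = Suc (card A)" "B0 \<subseteq> B"
        by (meson infinite_arbitrarily_large)
      with bound show False by fastforce
    qed
    have qfB: "quotient_family s V W B (\<lambda>x. x)"
      unfolding quotient_family_def
    proof (intro conjI ballI allI impI)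
      fix v assume "v \<in> V"
      then obtain b where "b \<in> span B" "v - b \<in> W" using B'(4) by blast
      then show "\<exists>c. v - (\<Sum>i\<in>B. s (c i) i) \<in> W"
        using finB by (auto simp: span_finite)
    qed (use finB B' indB in auto)
    have "card A \<le> card B"
      by (rule quotient_family_card_le[OF vs W qfB fam(1), of e]) (use fam in blast)+
    with bound[OF finB] show ?thesis by simp
  qed
  show ?thesis unfolding quotient_dim_def using card_eq someI[of "quotient_basis s V W", OF ex] by blast
qed

lemma quotient_family_reindex:
  assumes "bij_betw h A B"
  shows "quotient_family s V W A (e \<circ> h) \<longleftrightarrow> quotient_family s V W B e"
proof -
  have B: "B = h ` A" and inj: "inj_on h A" using assms by (auto simp: bij_betw_def)
  have fin: "finite A \<longleftrightarrow> finite B" using B inj by (metis finite_image_iff)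
  have sums: "(\<Sum>i\<in>A. s (c (h i)) (e (h i))) = (\<Sum>i\<in>B. s (c i) (e i))" for c
    unfolding B by (simp add: sum.reindex[OF inj])
  have ext: "(\<Sum>i\<in>A. s (c i) (e (h i))) = (\<Sum>i\<in>B. s (c (the_inv_into A h i)) (e i))" for c
    unfolding B by (simp add: sum.reindex[OF inj] the_inv_into_f_f[OF inj])
  have mem: "(\<forall>i\<in>A. e (h i) \<in> V) \<longleftrightarrow> (\<forall>i\<in>B. e i \<in> V)" by (simp add: B)
  have ind: "(\<forall>c. (\<Sum>i\<in>A. s (c i) (e (h i))) \<in> W \<longrightarrow> (\<forall>i\<in>A. c i = 0)) \<longleftrightarrow>
    (\<forall>c. (\<Sum>i\<in>B. s (c i) (e i)) \<in> W \<longrightarrow> (\<forall>i\<in>B. c i = 0))" (is "?L \<longleftrightarrow> ?R")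
  proof
    assume L: ?L
    show ?R
    proof (intro allI impI)
      fix c assume "(\<Sum>i\<in>B. s (c i) (e i)) \<in> W"
      with sums[of c] L[THEN spec, of "\<lambda>i. c (h i)"] have "\<forall>i\<in>A. c (h i) = 0" by simp
      then show "\<forall>i\<in>B. c i = 0" unfolding B by simp
    qed
  next
    assume R: ?R
    show ?L
    proof (intro allI impI)
      fix c assume "(\<Sum>i\<in>A. s (c i) (e (h i))) \<in> W"
      with ext[of c] R[THEN spec, of "\<lambda>i. c (the_inv_into A h i)"]
      have "\<forall>i\<in>B. c (the_inv_into A h i) = 0" by simp
      then show "\<forall>i\<in>A. c i = 0"
        unfolding B by (simp add: the_inv_into_f_f[OF inj])
    qed
  qed
  have sp: "(\<exists>c. v - (\<Sum>i\<in>A. s (c i) (e (h i))) \<in> W) \<longleftrightarrow> (\<exists>c. v - (\<Sum>i\<in>B. s (c i) (e i)) \<in> W)" for v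
    using sums ext by metis
  show ?thesis unfolding quotient_family_def o_def by (simp only: fin mem ind sp)
qed

lemma has_qdim_card:
  assumes "quotient_family s V W A e"
  shows "has_qdim s V W (card A)"
proof -
  have "finite A" using assms by (simp add: quotient_family_def)
  then obtain h where "bij_betw h {..<card A} A"
    using ex_bij_betw_nat_finite by (metis atLeast0LessThan)
  from quotient_family_reindex[OF this] assms show ?thesis
    unfolding has_qdim_def by blast
qed

lemma has_qdim_quotient_dim:
  assumes "vector_space s" "module.subspace s V" "module.subspace s W" "has_qdim s V W k"
  shows "quotient_dim s V W = k"
  using assms quotient_dim_eq_card unfolding has_qdim_def by fastforce

text \<open>The assumptions say that \<open>f\<close> induces an isomorphism from \<open>V/W\<close>
  to \<open>V'/W'\<close>, with surjectivity only up to \<open>W'\<close>. The comparisons of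
  homology and of Hilbert functions below go through this lemma.\<close>

lemma has_qdim_linear_iff:
  assumes lin: "Vector_Spaces.linear s s' f"
    and V: "module.subspace s V" and W': "module.subspace s' W'"
    and VV: "\<And>v. v \<in> V \<Longrightarrow> f v \<in> V'"
    and WW: "\<And>v. v \<in> W \<Longrightarrow> f v \<in> W'"
    and inj: "\<And>v. v \<in> V \<Longrightarrow> f v \<in> W' \<Longrightarrow> v \<in> W"
    and surj: "\<And>v'. v' \<in> V' \<Longrightarrow> \<exists>v\<in>V. v' - f v \<in> W'"
  shows "has_qdim s V W k \<longleftrightarrow> has_qdim s' V' W' k"
proof -
  interpret f: Vector_Spaces.linear s s' f by fact
  have fsum: "f (\<Sum>i\<in>A. s (c i) (e i)) = (\<Sum>i\<in>A. s' (c i) (f (e i)))" for A :: "nat set" and c e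
    by (simp add: f.sum f.scale)
  show ?thesis
  proof
    assume "has_qdim s V W k"
    then obtain e where "quotient_family s V W {..<k} e"
      unfolding has_qdim_def by blast
    then have e: "\<And>i. i < k \<Longrightarrow> e i \<in> V"
      "\<And>c. (\<Sum>i<k. s (c i) (e i)) \<in> W \<Longrightarrow> \<forall>i<k. c i = 0"
      "\<And>v. v \<in> V \<Longrightarrow> \<exists>c. v - (\<Sum>i<k. s (c i) (e i)) \<in> W"
      unfolding quotient_family_def by blast+
    have "quotient_family s' V' W' {..<k} (f \<circ> e)"
      unfolding quotient_family_def o_def
    proof (intro conjI ballI allI impI)
      fix c assume a: "(\<Sum>i<k. s' (c i) (f (e i))) \<in> W'"
      have "(\<Sum>i<k. s (c i) (e i)) \<in> V"
        using e(1) V by (intro f.vs1.subspace_sum f.vs1.subspace_scale) auto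
      with a inj[of "(\<Sum>i<k. s (c i) (e i))"] have "(\<Sum>i<k. s (c i) (e i)) \<in> W" by (simp add: fsum)
      then show "c i = 0" if "i \<in> {..<k}" for i using e(2) that by auto
    next
      fix v' assume "v' \<in> V'"
      then obtain v where v: "v \<in> V" "v' - f v \<in> W'" using surj by blast
      from e(3)[OF v(1)] obtain c where "v - (\<Sum>i<k. s (c i) (e i)) \<in> W" by blast
      from WW[OF this] have "f v - (\<Sum>i<k. s' (c i) (f (e i))) \<in> W'" by (simp add: f.diff fsum)
      from f.vs2.subspace_add[OF W' v(2) this]
      show "\<exists>c. v' - (\<Sum>i<k. s' (c i) (f (e i))) \<in> W'" by auto
    qed (use e VV in auto)
    then show "has_qdim s' V' W' k" unfolding has_qdim_def by blast
  next
    assume "has_qdim s' V' W' k"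
    then obtain e where "quotient_family s' V' W' {..<k} e"
      unfolding has_qdim_def by blast
    then have e: "\<And>i. i < k \<Longrightarrow> e i \<in> V'"
      "\<And>c. (\<Sum>i<k. s' (c i) (e i)) \<in> W' \<Longrightarrow> \<forall>i<k. c i = 0"
      "\<And>v. v \<in> V' \<Longrightarrow> \<exists>c. v - (\<Sum>i<k. s' (c i) (e i)) \<in> W'"
      unfolding quotient_family_def by blast+
    have "\<forall>i<k. \<exists>v\<in>V. e i - f v \<in> W'" using surj e(1) by blast
    then obtain v where v: "\<And>i. i < k \<Longrightarrow> v i \<in> V" "\<And>i. i < k \<Longrightarrow> e i - f (v i) \<in> W'" by metis
    have diff: "(\<Sum>i<k. s' (c i) (e i)) - f (\<Sum>i<k. s (c i) (v i)) \<in> W'" for c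
    proof -
      have "(\<Sum>i<k. s' (c i) (e i - f (v i))) \<in> W'"
        using v W' by (intro f.vs2.subspace_sum f.vs2.subspace_scale) auto
      then show ?thesis by (simp add: fsum f.vs2.scale_right_diff_distrib sum_subtractf)
    qed
    have "quotient_family s V W {..<k} v"
      unfolding quotient_family_def
    proof (intro conjI ballI allI impI)
      fix c assume "(\<Sum>i<k. s (c i) (v i)) \<in> W"
      from f.vs2.subspace_add[OF W' diff[of c] WW[OF this]]
      have "(\<Sum>i<k. s' (c i) (e i)) \<in> W'" by simp
      then show "c i = 0" if "i \<in> {..<k}" for i using e(2) that by auto
    next
      fix x assume x: "x \<in> V"
      from e(3)[OF VV[OF x]] obtain c where c: "f x - (\<Sum>i<k. s' (c i) (e i)) \<in> W'" by blast
      have "f (x - (\<Sum>i<k. s (c i) (v i))) \<in> W'"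
        using f.vs2.subspace_add[OF W' c diff[of c]] by (simp add: f.diff)
      moreover have "x - (\<Sum>i<k. s (c i) (v i)) \<in> V"
        using x v V by (intro f.vs1.subspace_diff f.vs1.subspace_sum f.vs1.subspace_scale) auto
      ultimately show "\<exists>c. x - (\<Sum>i<k. s (c i) (v i)) \<in> W" using inj by blast
    qed (use v in auto)
    then show "has_qdim s V W k" unfolding has_qdim_def by blast
  qed
qed

text \<open>Gaussian elimination at the point \<open>a\<^sub>0\<close>, carried out for all
  \<open>a\<close> at once; \<open>P\<close> is the product of the pivots, in place of a maximal
  minor. The class \<open>F\<close> is left abstract because it is used both for polynomial
  functions of many coordinates and for polynomials in one parameter.\<close>

lemma independence_is_open:
  fixes F :: "('a \<Rightarrow> 'k::field) set"
  assumes F: "(\<lambda>_. 1) \<in> F" "\<And>f g. f \<in> F \<Longrightarrow> g \<in> F \<Longrightarrow> (\<lambda>a. f a * g a) \<in> F"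
      "\<And>f g. f \<in> F \<Longrightarrow> g \<in> F \<Longrightarrow> (\<lambda>a. f a - g a) \<in> F"
    and "finite A"
    and M: "\<And>i b. (\<lambda>a. M a i b) \<in> F"
    and indep: "\<And>c. (\<And>b. b \<in> E \<Longrightarrow> (\<Sum>i\<in>A. c i * M a\<^sub>0 i b) = 0) \<Longrightarrow> \<forall>i\<in>A. c i = 0"
  shows "\<exists>P\<in>F. P a\<^sub>0 \<noteq> 0 \<and> (\<forall>a. P a \<noteq> 0 \<longrightarrow>
           (\<forall>c. (\<forall>b\<in>E. (\<Sum>i\<in>A. c i * M a i b) = 0) \<longrightarrow> (\<forall>i\<in>A. c i = 0)))"
  using \<open>finite A\<close> M indep
proof (induction A arbitrary: M rule: finite_induct)
  case empty
  show ?case using F(1) by (intro bexI[of _ "\<lambda>_. 1"]) auto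
next
  case (insert i\<^sub>0 A)
  have "\<exists>b\<^sub>0\<in>E. M a\<^sub>0 i\<^sub>0 b\<^sub>0 \<noteq> 0"
  proof (rule ccontr)
    assume "\<not> ?thesis"
    then have "(\<Sum>i\<in>insert i\<^sub>0 A. (if i = i\<^sub>0 then 1 else 0) * M a\<^sub>0 i b) = 0" if "b \<in> E" for b
      using that by (intro sum.neutral) auto
    from insert.prems(2)[OF this] show False by auto
  qed
  then obtain b\<^sub>0 where b\<^sub>0: "b\<^sub>0 \<in> E" "M a\<^sub>0 i\<^sub>0 b\<^sub>0 \<noteq> 0" by blast
  \<comment> \<open>The elimination is free of fractions, since \<open>F\<close> is closed under
    products and differences but not under division.\<close>
  define M' where "M' = (\<lambda>a i b. M a i\<^sub>0 b\<^sub>0 * M a i b - M a i b\<^sub>0 * M a i\<^sub>0 b)"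
  have M': "(\<lambda>a. M' a i b) \<in> F" for i b
    unfolding M'_def by (intro F insert.prems)
  have sumM': "(\<Sum>i\<in>A. c i * M' a i b) = M a i\<^sub>0 b\<^sub>0 * (\<Sum>i\<in>A. c i * M a i b) - (\<Sum>i\<in>A. c i * M a i b\<^sub>0) * M a i\<^sub>0 b"
    for a c b by (simp add: M'_def right_diff_distrib sum_subtractf sum_distrib_left sum_distrib_right algebra_simps)
  have "\<forall>i\<in>A. c i = 0" if c: "\<And>b. b \<in> E \<Longrightarrow> (\<Sum>i\<in>A. c i * M' a\<^sub>0 i b) = 0" for c
  proof -
    define d where "d = (\<lambda>i. if i = i\<^sub>0 then - (\<Sum>i\<in>A. c i * M a\<^sub>0 i b\<^sub>0) else M a\<^sub>0 i\<^sub>0 b\<^sub>0 * c i)"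
    have "(\<Sum>i\<in>insert i\<^sub>0 A. d i * M a\<^sub>0 i b) = 0" if "b \<in> E" for b
    proof -
      have "(\<Sum>i\<in>A. d i * M a\<^sub>0 i b) = (\<Sum>i\<in>A. M a\<^sub>0 i\<^sub>0 b\<^sub>0 * c i * M a\<^sub>0 i b)"
        using insert.hyps by (intro sum.cong) (auto simp: d_def)
      then show ?thesis using insert.hyps c[OF that]
        by (simp add: sumM' d_def sum_distrib_left algebra_simps)
    qed
    from insert.prems(2)[OF this] have "\<forall>i\<in>A. d i = 0" by auto
    then show ?thesis using b\<^sub>0 insert.hyps by (auto simp: d_def split: if_splits)
  qed
  from insert.IH[of M', OF M' this] obtain P where P: "P \<in> F" "P a\<^sub>0 \<noteq> 0"
    "\<And>a c. P a \<noteq> 0 \<Longrightarrow> (\<forall>b\<in>E. (\<Sum>i\<in>A. c i * M' a i b) = 0) \<Longrightarrow> \<forall>i\<in>A. c i = 0" by blast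
  show ?case
  proof (intro bexI[of _ "\<lambda>a. M a i\<^sub>0 b\<^sub>0 * P a"] conjI allI impI)
    show "(\<lambda>a. M a i\<^sub>0 b\<^sub>0 * P a) \<in> F" using F P insert.prems by blast
    show "M a\<^sub>0 i\<^sub>0 b\<^sub>0 * P a\<^sub>0 \<noteq> 0" using b\<^sub>0 P by simp
    fix a c assume a: "M a i\<^sub>0 b\<^sub>0 * P a \<noteq> 0" and c: "\<forall>b\<in>E. (\<Sum>i\<in>insert i\<^sub>0 A. c i * M a i b) = 0"
    then have *: "(\<Sum>i\<in>A. c i * M a i b) = - (c i\<^sub>0 * M a i\<^sub>0 b)" if "b \<in> E" for b
      using insert.hyps that by (simp add: eq_neg_iff_add_eq_0 add.commute)
    have "(\<Sum>i\<in>A. c i * M' a i b) = 0" if "b \<in> E" for b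
      by (simp add: sumM' *[OF that] *[OF b\<^sub>0(1)])
    with P(3)[of a c] a have A0: "\<forall>i\<in>A. c i = 0" by auto
    with *[OF b\<^sub>0(1)] a have "c i\<^sub>0 = 0" by simp
    with A0 show "\<forall>i\<in>insert i\<^sub>0 A. c i = 0" by simp
  qed
qed

section \<open>Polynomials\<close>

text \<open>As a simplification rule this loops together with associativity of multiplication.\<close>

declare pol_mod.scale_scale [simp del]

abbreviation "lookup \<equiv> Poly_Mapping.lookup"
abbreviation "keys \<equiv> Poly_Mapping.keys"
abbreviation "single \<equiv> Poly_Mapping.single"

lemma lookup_single_times_add:
  fixes p :: "'m::cancel_comm_monoid_add \<Rightarrow>\<^sub>0 'k::comm_semiring_1"
  shows "lookup (single u c * p) (u + m) = c * lookup p m"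
  by (simp add: lookup_mult lookup_single when_mult)

lemma lookup_single_times_nonmult:
  fixes p :: "'m::cancel_comm_monoid_add \<Rightarrow>\<^sub>0 'k::comm_semiring_1"
  assumes "\<And>q. m \<noteq> u + q"
  shows "lookup (single u c * p) m = 0"
  using assms by (simp add: lookup_mult lookup_single when_mult)

lemma single_add_minus:
  fixes m :: "'n \<Rightarrow>\<^sub>0 nat"
  assumes "lookup m i > 0"
  shows "single i 1 + (m - single i 1) = m"
  using assms by (intro poly_mapping_eqI) (auto simp: lookup_add lookup_minus lookup_single when_def)

lemma lookup_Var_times:
  fixes p :: "('n, 'k::field) mpoly"
  shows "lookup (Var i * p) m = (if lookup m i > 0 then lookup p (m - single i 1) else 0)"
proof (cases "lookup m i > 0")
  case True
  then show ?thesis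
    using lookup_single_times_add[of "single i 1" 1 p "m - single i 1"]
    by (simp add: Var_def single_add_minus del: One_nat_def)
next
  case False
  have "m \<noteq> single i 1 + q" for q
    using False by (auto simp: lookup_add)
  then show ?thesis
    using False lookup_single_times_nonmult[of m "single i 1" 1 p] by (simp add: Var_def)
qed

lemma lookup_Var_times_add [simp]: "lookup (Var i * p) (single i 1 + m) = lookup p m"
  using lookup_single_times_add[of "single i 1" 1 p m] by (simp add: Var_def)

lemma lookup_Const_times [simp]:
  fixes p :: "('n, 'k::field) mpoly"
  shows "lookup (Const c * p) m = c * lookup p m"
  using lookup_single_times_add[of 0 c p m] by (simp add: Const_def)

lemma lookup_pscale [simp]: "lookup (pscale c p) m = c * lookup p m"
  by (simp add: pscale_def)

lemma Const_0 [simp]: "Const 0 = 0" by (simp add: Const_def)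
lemma Const_1 [simp]: "Const 1 = 1" by (simp add: Const_def)
lemma Const_add: "Const (a + b) = Const a + Const b" by (simp add: Const_def single_add)
lemma Const_mult: "Const (a * b) = Const a * Const b" by (simp add: Const_def mult_single)

lemma Const_sum: "Const (\<Sum>i\<in>A. f i) = (\<Sum>i\<in>A. Const (f i))"
  by (induction A rule: infinite_finite_induct) (simp_all add: Const_add)

lemma pscale_ideal: "is_ideal I \<Longrightarrow> p \<in> I \<Longrightarrow> pscale c p \<in> I"
  by (simp add: pscale_def pol_mod.subspace_scale)

lemma sum_single_keys:
  fixes p :: "'m \<Rightarrow>\<^sub>0 'k::comm_monoid_add"
  assumes "finite A" "keys p \<subseteq> A"
  shows "(\<Sum>m\<in>A. single m (lookup p m)) = p"
proof (rule poly_mapping_eqI)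
  fix m
  have "lookup (\<Sum>m\<in>A. single m (lookup p m)) m = (\<Sum>m'\<in>A. if m' = m then lookup p m' else 0)"
    by (simp add: lookup_sum lookup_single when_def)
  also have "\<dots> = lookup p m"
    using assms by (auto simp: sum.delta in_keys_iff)
  finally show "lookup (\<Sum>m\<in>A. single m (lookup p m)) m = lookup p m" .
qed

lemma mpoly_induct [case_names single add]:
  fixes p :: "('n, 'k::field) mpoly"
  assumes "\<And>m c. P (single m c)" "\<And>p q. P p \<Longrightarrow> P q \<Longrightarrow> P (p + q)"
  shows "P p"
proof -
  have "P (\<Sum>m\<in>A. single m (lookup p m))" if "finite A" for A
    using that
  proof (induction A)
    case empty
    show ?case using assms(1)[of 0 0] by simp
  qed (simp add: assms)
  from this[of "keys p"] show ?thesis by (simp add: sum_single_keys)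
qed

subsection \<open>Restriction to a set of monomials\<close>

lift_definition part :: "('m \<Rightarrow> bool) \<Rightarrow> ('m \<Rightarrow>\<^sub>0 'k::zero) \<Rightarrow> 'm \<Rightarrow>\<^sub>0 'k"
  is "\<lambda>Q f m. if Q m then f m else 0"
  by (rule finite_subset[rotated]) auto

lemma lookup_part [simp]: "lookup (part Q p) m = (if Q m then lookup p m else 0)"
  by transfer simp

lemma keys_part: "keys (part Q p) = {m \<in> keys p. Q m}"
  by (auto simp: in_keys_iff split: if_splits)

lemma part_add: "part Q (p + q) = part Q p + part Q (q :: 'm \<Rightarrow>\<^sub>0 'k::monoid_add)"
  by (rule poly_mapping_eqI) (simp add: lookup_add)

lemma part_0 [simp]: "part Q 0 = 0"
  by (rule poly_mapping_eqI) simp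

lemma part_sum: "part Q (\<Sum>i\<in>A. f i) = (\<Sum>i\<in>A. part Q (f i :: 'm \<Rightarrow>\<^sub>0 'k::comm_monoid_add))"
  by (induction A rule: infinite_finite_induct) (simp_all add: part_add)

lemma part_id: "(\<And>m. m \<in> keys p \<Longrightarrow> Q m) \<Longrightarrow> part Q p = p"
  by (rule poly_mapping_eqI) (auto simp: in_keys_iff)

lemma part_eq_0: "(\<And>m. m \<in> keys p \<Longrightarrow> \<not> Q m) \<Longrightarrow> part Q p = 0"
  by (rule poly_mapping_eqI) (auto simp: in_keys_iff)

lemma part_split: "p = part Q p + part (\<lambda>m. \<not> Q m) (p :: 'm \<Rightarrow>\<^sub>0 'k::monoid_add)"
  by (rule poly_mapping_eqI) (simp add: lookup_add)

text \<open>Every monomial of \<open>f\<close> translates the condition \<open>Q'\<close> into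
  \<open>Q\<close>, so restriction commutes with multiplication. For homogeneous \<open>f\<close>
  and conditions on degrees this says that graded components are respected.\<close>

lemma part_mult:
  fixes f p :: "('n, 'k::field) mpoly"
  assumes "\<And>u m. u \<in> keys f \<Longrightarrow> Q (u + m) \<longleftrightarrow> Q' m"
  shows "part Q (f * p) = f * part Q' p"
proof -
  have "part Q (f * p) = part Q (f * part Q' p) + part Q (f * part (\<lambda>m. \<not> Q' m) p)"
    by (metis part_split distrib_left part_add)
  also have "part Q (f * part Q' p) = f * part Q' p"
    using assms keys_mult[of f "part Q' p"] by (intro part_id) (auto simp: keys_part)
  also have "part Q (f * part (\<lambda>m. \<not> Q' m) p) = 0"
    using assms keys_mult[of f "part (\<lambda>m. \<not> Q' m) p"] by (intro part_eq_0) (auto simp: keys_part)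
  finally show ?thesis by simp
qed

subsection \<open>Degrees\<close>

lemma mdeg_add [simp]: "mdeg (m + m') = mdeg m + mdeg m'"
  by (simp add: mdeg_def lookup_add sum.distrib)

lemma mdeg_0 [simp]: "mdeg 0 = 0"
  by (simp add: mdeg_def)

lemma mdeg_single [simp]: "mdeg (single i k) = k"
  by (simp add: mdeg_def lookup_single when_def)

lemma mdeg_eq_0_iff [simp]: "mdeg m = 0 \<longleftrightarrow> m = 0"
  by (auto simp: mdeg_def intro: poly_mapping_eqI)

lemma lookup_le_mdeg: "lookup m i \<le> mdeg m"
  unfolding mdeg_def by (rule member_le_sum) auto

lemma finite_mdeg: "finite {m :: 'n::finite \<Rightarrow>\<^sub>0 nat. mdeg m \<le> d}"
proof -
  have "f \<in> PiE UNIV (\<lambda>_. {..d})" if "f \<in> lookup ` {m :: 'n \<Rightarrow>\<^sub>0 nat. mdeg m \<le> d}" for f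
    using that order_trans[OF lookup_le_mdeg] by (auto simp: PiE_iff)
  then have "lookup ` {m :: 'n \<Rightarrow>\<^sub>0 nat. mdeg m \<le> d} \<subseteq> PiE UNIV (\<lambda>_. {..d})" by blast
  moreover have "finite (PiE (UNIV :: 'n set) (\<lambda>_. {..d}))" by (rule finite_PiE) auto
  ultimately have "finite (lookup ` {m :: 'n \<Rightarrow>\<^sub>0 nat. mdeg m \<le> d})" by (rule finite_subset)
  then show ?thesis by (rule finite_imageD) (simp add: inj_on_def)
qed

lemma finite_mdeg_eq: "finite {m :: 'n::finite \<Rightarrow>\<^sub>0 nat. mdeg m = d}"
  by (rule finite_subset[OF _ finite_mdeg[of d]]) auto

lemma homogeneousI: "(\<And>m. lookup p m \<noteq> 0 \<Longrightarrow> mdeg m = d) \<Longrightarrow> homogeneous d p"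
  by (auto simp: homogeneous_def in_keys_iff)

lemma homogeneousD: "homogeneous d p \<Longrightarrow> lookup p m \<noteq> 0 \<Longrightarrow> mdeg m = d"
  by (auto simp: homogeneous_def in_keys_iff)

lemma homogeneous_0 [simp]: "homogeneous d 0"
  by (simp add: homogeneous_def)

lemma homogeneous_single: "homogeneous (mdeg m) (single m c)"
  by (auto simp: homogeneous_def)

lemma homogeneous_Const [simp]: "homogeneous 0 (Const c)"
  using homogeneous_single[of 0 c] by (simp add: Const_def)

lemma homogeneous_Var [simp]: "homogeneous (Suc 0) (Var i)"
  by (simp add: Var_def homogeneous_def)

lemma homogeneous_mult: "homogeneous d p \<Longrightarrow> homogeneous e q \<Longrightarrow> homogeneous (d + e) (p * q)"
  using keys_mult[of p q] by (fastforce simp: homogeneous_def)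

lemma homogeneous_add: "homogeneous d p \<Longrightarrow> homogeneous d q \<Longrightarrow> homogeneous d (p + q)"
  using keys_add[of p q] by (auto simp: homogeneous_def)

lemma homogeneous_diff: "homogeneous d p \<Longrightarrow> homogeneous d q \<Longrightarrow> homogeneous d (p - q)"
  by (rule homogeneousI) (metis diff_self homogeneousD lookup_minus)

lemma homogeneous_sum: "(\<And>i. i \<in> A \<Longrightarrow> homogeneous d (f i)) \<Longrightarrow> homogeneous d (\<Sum>i\<in>A. f i)"
  by (induction A rule: infinite_finite_induct) (auto intro: homogeneous_add)

lemma homogeneous_pscale: "homogeneous d p \<Longrightarrow> homogeneous d (pscale c p)"
  by (auto simp: homogeneous_def in_keys_iff)

lemma homogeneous_power: "homogeneous d p \<Longrightarrow> homogeneous (k * d) (p ^ k)"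
proof (induction k)
  case 0
  show ?case using homogeneous_Const[of 1] by simp
qed (auto dest: homogeneous_mult)

lemma homogeneous_prod:
  "(\<And>i. i \<in> A \<Longrightarrow> homogeneous (d i) (f i)) \<Longrightarrow> homogeneous (\<Sum>i\<in>A. d i) (\<Prod>i\<in>A. f i)"
proof (induction A rule: infinite_finite_induct)
  case (infinite A)
  then show ?case using homogeneous_Const[of 1] by simp
next
  case empty
  then show ?case using homogeneous_Const[of 1] by simp
qed (auto intro: homogeneous_mult)

lemma subspace_hom_comp: "module.subspace pscale (hom_comp d)"
proof -
  interpret vector_space pscale by (rule vector_space_pscale)
  show ?thesis by (auto simp: subspace_def hom_comp_def homogeneous_add homogeneous_pscale)
qed

lemma subspace_ideal_hom_comp: "is_ideal I \<Longrightarrow> module.subspace pscale (I \<inter> hom_comp d)"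
proof -
  interpret vector_space pscale by (rule vector_space_pscale)
  assume "is_ideal I"
  then show ?thesis
    using pscale_ideal[of I]
    by (auto simp: subspace_def hom_comp_def homogeneous_add homogeneous_pscale
        pol_mod.subspace_0 pol_mod.subspace_add)
qed

abbreviation "hpart d \<equiv> part (\<lambda>m. mdeg m = d)"

lemma homogeneous_hpart: "homogeneous d (hpart d p)"
  by (rule homogeneousI) (auto split: if_splits)

lemma hpart_id: "homogeneous d p \<Longrightarrow> hpart d p = p"
  by (rule part_id) (auto simp: homogeneous_def)

lemma homogeneous_ideal_hpart:
  assumes "homogeneous_ideal I" "p \<in> I"
  shows "hpart d p \<in> I"
proof -
  obtain S where S: "\<And>s. s \<in> S \<Longrightarrow> \<exists>d. homogeneous d s" "I = ideal_gen S"
    using assms by (auto simp: homogeneous_ideal_def)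
  have "p \<in> ideal_gen S" using assms S by simp
  then show ?thesis unfolding S(2)
  proof (induction rule: pol_mod.span_induct_alt)
    case base
    show ?case by (simp add: pol_mod.span_zero)
  next
    case (step c x y)
    obtain e where "homogeneous e x" using S step by blast
    \<comment> \<open>The condition \<open>e + mdeg m = d\<close> replaces a degree d - e, which
      would be truncated for e > d; in that case no monomial satisfies it and the part is 0, as it
      should be.\<close>
    then have "hpart d (x * c) = x * part (\<lambda>m. e + mdeg m = d) c"
      by (intro part_mult) (auto simp: homogeneous_def)
    then have "hpart d (c * x + y) = part (\<lambda>m. e + mdeg m = d) c * x + hpart d y"
      by (simp add: part_add mult.commute)
    then show ?case
      using step by (simp add: pol_mod.span_add pol_mod.span_base pol_mod.span_scale)
  qed
qed

lemma is_ideal_of_homogeneous: "homogeneous_ideal I \<Longrightarrow> is_ideal I"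
  by (auto simp: homogeneous_ideal_def)

lemma sum_hpart:
  assumes "finite D" "mdeg ` keys p \<subseteq> D"
  shows "(\<Sum>d\<in>D. hpart d p) = (p :: ('n::finite, 'k::field) mpoly)"
proof (rule poly_mapping_eqI)
  fix m
  have "lookup (\<Sum>d\<in>D. hpart d p) m = (\<Sum>d\<in>D. if d = mdeg m then lookup p m else 0)"
    by (simp add: lookup_sum eq_commute)
  also have "\<dots> = lookup p m"
    using assms by (cases "lookup p m = 0") (auto simp: image_subset_iff in_keys_iff)
  finally show "lookup (\<Sum>d\<in>D. hpart d p) m = lookup p m" .
qed

subsection \<open>Evaluation homomorphisms\<close>

definition mon_eval :: "('n \<Rightarrow> 'r::comm_ring_1) \<Rightarrow> ('n \<Rightarrow>\<^sub>0 nat) \<Rightarrow> 'r" where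
  "mon_eval a m = (\<Prod>i\<in>keys m. a i ^ lookup m i)"

lemma mon_eval_superset: "finite A \<Longrightarrow> keys m \<subseteq> A \<Longrightarrow> mon_eval a m = (\<Prod>i\<in>A. a i ^ lookup m i)"
  unfolding mon_eval_def by (rule prod.mono_neutral_left) (auto simp: in_keys_iff)

lemma mon_eval_add: "mon_eval a (m + m') = mon_eval a m * mon_eval a m'"
proof -
  let ?A = "keys m \<union> keys m'"
  have "mon_eval a (m + m') = (\<Prod>i\<in>?A. a i ^ lookup (m + m') i)"
    using keys_add[of m m'] by (intro mon_eval_superset) auto
  also have "\<dots> = (\<Prod>i\<in>?A. a i ^ lookup m i) * (\<Prod>i\<in>?A. a i ^ lookup m' i)"
    by (simp add: lookup_add power_add prod.distrib)
  also have "\<dots> = mon_eval a m * mon_eval a m'"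
    by (simp add: mon_eval_superset[of ?A])
  finally show ?thesis .
qed

lemma mon_eval_0 [simp]: "mon_eval a 0 = 1"
  by (simp add: mon_eval_def)

lemma mon_eval_single [simp]: "mon_eval a (single i k) = a i ^ k"
  by (auto simp: mon_eval_def)

text \<open>Covers both uses of \<open>mp_eval\<close>: evaluation at points of affine space, with
  the identity on coefficients, and linear substitution, with \<open>Const\<close>.\<close>

locale coeff_hom =
  fixes h :: "'k::field \<Rightarrow> 'r::comm_ring_1"
  assumes h_0: "h 0 = 0" and h_1: "h 1 = 1"
    and h_add: "h (a + b) = h a + h b" and h_mult: "h (a * b) = h a * h b"
begin

lemma eval_superset:
  "finite A \<Longrightarrow> keys p \<subseteq> A \<Longrightarrow> mp_eval h a p = (\<Sum>m\<in>A. h (lookup p m) * mon_eval a m)"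
  unfolding mp_eval_def mon_eval_def[symmetric]
  by (rule sum.mono_neutral_left) (auto simp: in_keys_iff h_0)

lemma eval_add: "mp_eval h a (p + q) = mp_eval h a p + mp_eval h a q"
proof -
  let ?A = "keys p \<union> keys q"
  have "mp_eval h a (p + q) = (\<Sum>m\<in>?A. h (lookup (p + q) m) * mon_eval a m)"
    using keys_add[of p q] by (intro eval_superset) auto
  also have "\<dots> = (\<Sum>m\<in>?A. h (lookup p m) * mon_eval a m) + (\<Sum>m\<in>?A. h (lookup q m) * mon_eval a m)"
    by (simp add: lookup_add h_add distrib_right sum.distrib)
  also have "\<dots> = mp_eval h a p + mp_eval h a q"
    by (simp add: eval_superset[of ?A])
  finally show ?thesis .
qed

lemma eval_single [simp]: "mp_eval h a (single m c) = h c * mon_eval a m"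
  by (subst eval_superset[of "{m}"]) auto

lemma eval_mult: "mp_eval h a (p * q) = mp_eval h a p * mp_eval h a q"
proof (induction p rule: mpoly_induct)
  case (single m c)
  show ?case
    by (induction q rule: mpoly_induct)
      (simp_all add: mult_single h_mult mon_eval_add eval_add algebra_simps)
qed (simp add: eval_add distrib_right)

lemma eval_0 [simp]: "mp_eval h a 0 = 0"
  by (simp add: mp_eval_def)

lemma eval_Const [simp]: "mp_eval h a (Const c) = h c"
  by (simp add: Const_def)

lemma eval_1 [simp]: "mp_eval h a 1 = 1"
  using eval_Const[of a 1] by (simp add: h_1)

lemma eval_Var [simp]: "mp_eval h a (Var i) = a i"
  by (simp add: Var_def h_1)

lemma eval_sum: "mp_eval h a (\<Sum>i\<in>A. f i) = (\<Sum>i\<in>A. mp_eval h a (f i))"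
  by (induction A rule: infinite_finite_induct) (simp_all add: eval_add)

end

interpretation eval_id: coeff_hom "\<lambda>c::'k::field. c"
  by unfold_locales auto

interpretation eval_Const: coeff_hom "Const :: 'k::field \<Rightarrow> ('n, 'k) mpoly"
  by unfold_locales (auto simp: Const_add Const_mult)

subsection \<open>Linear changes of coordinates\<close>

lemma coord_change_add: "coord_change g (p + q) = coord_change g p + coord_change g q"
  by (simp add: coord_change_def eval_Const.eval_add)

lemma coord_change_mult: "coord_change g (p * q) = coord_change g p * coord_change g q"
  by (simp add: coord_change_def eval_Const.eval_mult)

lemma coord_change_0 [simp]: "coord_change g 0 = 0"
  by (simp add: coord_change_def)

lemma coord_change_1 [simp]: "coord_change g 1 = 1"
  by (simp add: coord_change_def)

lemma coord_change_Const [simp]: "coord_change g (Const c) = Const c"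
  by (simp add: coord_change_def)

lemma coord_change_Var: "coord_change g (Var j) = (\<Sum>i\<in>UNIV. Const (g $ i $ j) * Var i)"
  by (simp add: coord_change_def)

lemma coord_change_sum: "coord_change g (\<Sum>i\<in>A. f i) = (\<Sum>i\<in>A. coord_change g (f i))"
  by (simp add: coord_change_def eval_Const.eval_sum)

lemma coord_change_pscale: "coord_change g (pscale c p) = pscale c (coord_change g p)"
  by (simp add: pscale_def coord_change_mult)

lemma coord_change_diff: "coord_change g (p - q) = coord_change g p - coord_change g q"
  by (metis coord_change_add diff_add_cancel add_diff_cancel_right')

lemma coord_change_power: "coord_change g (p ^ k) = coord_change g p ^ k"
  by (induction k) (simp_all add: coord_change_mult)

lemma coord_change_prod: "coord_change g (\<Prod>i\<in>A. f i) = (\<Prod>i\<in>A. coord_change g (f i))"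
  by (induction A rule: infinite_finite_induct) (simp_all add: coord_change_mult)

lemma Var_power: "Var i ^ k = (single (single i k) 1 :: ('n, 'k::field) mpoly)"
  by (induction k) (simp_all add: Var_def mult_single single_add[symmetric])

lemma single_eq_prod:
  fixes c :: "'k::field"
  shows "single m c = Const c * (\<Prod>i\<in>UNIV. Var i ^ lookup m (i :: 'n::finite))"
proof -
  have "(\<Prod>i\<in>A. Var i ^ lookup m i) = (single (\<Sum>i\<in>A. single i (lookup m i)) 1 :: ('n, 'k::field) mpoly)"
    if "finite A" for A
    using that by (induction A) (simp_all add: Var_power mult_single)
  from this[of UNIV] have "(\<Prod>i\<in>UNIV. Var i ^ lookup m i) = (single m 1 :: ('n, 'k::field) mpoly)"
    by (simp add: sum_single_keys)
  then show ?thesis by (simp add: Const_def mult_single)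
qed

lemma ring_hom_eqI:
  fixes f f' :: "('n::finite, 'k::field) mpoly \<Rightarrow> 'r::comm_ring_1"
  assumes "\<And>p q. f (p + q) = f p + f q" "\<And>p q. f (p * q) = f p * f q" "f 1 = 1"
    and "\<And>p q. f' (p + q) = f' p + f' q" "\<And>p q. f' (p * q) = f' p * f' q" "f' 1 = 1"
    and "\<And>c. f (Const c) = f' (Const c)" "\<And>i. f (Var i) = f' (Var i)"
  shows "f p = f' p"
proof (induction p rule: mpoly_induct)
  case (single m c)
  have pw: "f (Var i ^ k) = f' (Var i ^ k)" for i k
    by (induction k) (simp_all add: assms)
  have "f (\<Prod>i\<in>A. Var i ^ lookup m i) = f' (\<Prod>i\<in>A. Var i ^ lookup m i)" for A
    by (induction A rule: infinite_finite_induct) (simp_all add: assms pw)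
  then show ?case by (simp add: single_eq_prod assms)
qed (simp add: assms)

text \<open>Column j of the matrix holds the image of x_j, so substitutions compose in the order of
  the matrix product, without transposition.\<close>

lemma coord_change_compose:
  fixes g h :: "'k::field^'n^'n"
  shows "coord_change g (coord_change h p) = coord_change (g ** h) p"
proof (rule ring_hom_eqI[where f = "\<lambda>p. coord_change g (coord_change h p)"])
  fix j
  have "coord_change g (coord_change h (Var j)) =
      (\<Sum>i\<in>UNIV. Const (h $ i $ j) * (\<Sum>l\<in>UNIV. Const (g $ l $ i) * Var l))"
    by (simp add: coord_change_Var coord_change_sum coord_change_mult)
  also have "\<dots> = (\<Sum>l\<in>UNIV. \<Sum>i\<in>UNIV. Const (g $ l $ i * h $ i $ j) * Var l)"
    by (subst sum.swap) (simp add: sum_distrib_left Const_mult algebra_simps)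
  also have "\<dots> = (\<Sum>l\<in>UNIV. Const ((g ** h) $ l $ j) * Var l)"
    by (simp add: matrix_matrix_mult_def sum_distrib_right Const_sum)
  finally show "coord_change g (coord_change h (Var j)) = coord_change (g ** h) (Var j)"
    by (simp add: coord_change_Var)
qed (simp_all add: coord_change_add coord_change_mult)

lemma coord_change_mat_1 [simp]: "coord_change (mat 1 :: 'k::field^'n^'n) p = p"
proof (rule ring_hom_eqI[where f' = "\<lambda>p. p"])
  fix j :: 'n
  have "(\<Sum>i\<in>UNIV. Const ((mat 1 :: 'k^'n^'n) $ i $ j) * Var i) =
      (\<Sum>i\<in>UNIV. if i = j then Var i else (0 :: ('n, 'k) mpoly))"
    by (rule sum.cong) (auto simp: mat_def)
  then show "coord_change (mat 1 :: 'k^'n^'n) (Var j) = Var j" by (simp add: coord_change_Var)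
qed (simp_all add: coord_change_add coord_change_mult)

lemma coord_change_homogeneous: "homogeneous d p \<Longrightarrow> homogeneous d (coord_change g p)"
proof -
  assume p: "homogeneous d p"
  have "homogeneous (Suc 0) (Const (g $ i $ j) * Var i)" for i j
    using homogeneous_mult[OF homogeneous_Const homogeneous_Var] by simp
  then have lin: "homogeneous 1 (\<Sum>i\<in>UNIV. Const (g $ i $ j) * Var i)" for j
    by (auto intro: homogeneous_sum)
  have "homogeneous (\<Sum>j\<in>UNIV. lookup m j * 1) (\<Prod>j\<in>UNIV. coord_change g (Var j) ^ lookup m j)" for m
    by (intro homogeneous_prod homogeneous_power) (simp only: coord_change_Var lin)
  then have "homogeneous (mdeg m) (\<Prod>j\<in>UNIV. coord_change g (Var j) ^ lookup m j)" for m
    by (simp add: mdeg_def)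
  from homogeneous_mult[OF homogeneous_Const this]
  have "homogeneous (mdeg m) (coord_change g (single m c))" for m c
    by (subst single_eq_prod) (simp add: coord_change_mult coord_change_prod coord_change_power)
  then have "homogeneous d (\<Sum>m\<in>keys p. coord_change g (single m (lookup p m)))"
    using p by (intro homogeneous_sum) (auto simp: homogeneous_def)
  then show ?thesis
    using sum_single_keys[of "keys p" p] by (simp add: coord_change_sum[symmetric])
qed

lemma coord_change_inverse:
  assumes "g' ** g = mat 1"
  shows "coord_change g' (coord_change g p) = p"
  using assms by (simp add: coord_change_compose)

lemma invertible_inverse_ex: "invertible (g :: 'k::field^'n^'n) \<Longrightarrow> \<exists>g'. g' ** g = mat 1 \<and> g ** g' = mat 1"
  by (auto simp: invertible_def)

lemma is_ideal_coord_change: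
  assumes "invertible g" "is_ideal I"
  shows "is_ideal (coord_change g ` I)"
proof -
  obtain g' where g': "g' ** g = mat 1" "g ** g' = mat 1" using assms invertible_inverse_ex by blast
  show ?thesis unfolding pol_mod.subspace_def
  proof (intro conjI ballI allI)
    show "0 \<in> coord_change g ` I"
      using assms pol_mod.subspace_0 by (intro image_eqI[of _ _ 0]) auto
    fix x y assume "x \<in> coord_change g ` I" "y \<in> coord_change g ` I"
    then obtain p q where "p \<in> I" "q \<in> I" "x + y = coord_change g (p + q)"
      by (auto simp: coord_change_add)
    then show "x + y \<in> coord_change g ` I"
      using assms pol_mod.subspace_add by blast
  next
    fix c x assume "x \<in> coord_change g ` I"
    then obtain p where p: "p \<in> I" "x = coord_change g p" by blast
    then have "c * x = coord_change g (coord_change g' c * p)"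
      using g' by (simp add: coord_change_mult coord_change_inverse)
    then show "c * x \<in> coord_change g ` I"
      using p assms pol_mod.subspace_scale by blast
  qed
qed

lemma coord_change_hpart: "hpart d (coord_change g p) = coord_change g (hpart d p)"
proof -
  let ?D = "insert d (mdeg ` keys p)"
  have "hpart d (coord_change g p) = hpart d (coord_change g (\<Sum>e\<in>?D. hpart e p))"
    by (subst sum_hpart) auto
  also have "\<dots> = (\<Sum>e\<in>?D. hpart d (coord_change g (hpart e p)))"
    by (simp only: coord_change_sum part_sum)
  also have "\<dots> = (\<Sum>e\<in>?D. if e = d then coord_change g (hpart e p) else 0)"
  proof (rule sum.cong)
    fix e
    have "homogeneous e (coord_change g (hpart e p))"
      by (intro coord_change_homogeneous homogeneous_hpart)
    then show "hpart d (coord_change g (hpart e p)) = (if e = d then coord_change g (hpart e p) else 0)"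
      by (auto simp: hpart_id intro!: part_eq_0) (auto simp: homogeneous_def)
  qed simp
  also have "\<dots> = coord_change g (hpart d p)" by (subst sum.delta) auto
  finally show ?thesis .
qed

section \<open>Koszul kchains\<close>

text \<open>Division by x_j in which the monomials not divisible by x_j are dropped; it is a left
  inverse of multiplication by x_j.\<close>

lift_definition vshift :: "'n \<Rightarrow> ('n, 'k::field) mpoly \<Rightarrow> ('n, 'k) mpoly"
  is "\<lambda>j f m. f (m + single j 1)"
proof -
  fix j and f :: "('n \<Rightarrow>\<^sub>0 nat) \<Rightarrow> 'k"
  assume "finite {m. f m \<noteq> 0}"
  then show "finite {m. f (m + single j 1) \<noteq> 0}"
    using finite_vimageI[of "{m. f m \<noteq> 0}" "\<lambda>m. m + single j 1"]
    by (simp add: vimage_def inj_on_def del: One_nat_def)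
qed

lemma lookup_vshift [simp]: "lookup (vshift j p) m = lookup p (m + single j 1)"
  by transfer simp

definition koszul_sign :: "'n::linorder \<Rightarrow> 'n set \<Rightarrow> 'k::field" where
  "koszul_sign j T = (- 1) ^ card {l \<in> T. l < j}"

lemma koszul_sign_square [simp]: "koszul_sign j T * koszul_sign j T = 1"
  by (simp add: koszul_sign_def flip: power_mult_distrib)

lemma koszul_sign_square' [simp]: "koszul_sign j T * (koszul_sign j T * x) = x"
  by (simp flip: mult.assoc)

lemma koszul_sign_insert:
  fixes i j :: "'n::{finite,linorder}"
  assumes "j \<notin> T"
  shows "koszul_sign i (insert j T) = (if j < i then - koszul_sign i T else koszul_sign i T)"
proof (cases "j < i")
  case True
  then have "{l \<in> insert j T. l < i} = insert j {l \<in> T. l < i}" by auto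
  then show ?thesis using True assms by (simp add: koszul_sign_def)
next
  case False
  then have "{l \<in> insert j T. l < i} = {l \<in> T. l < i}" by auto
  then show ?thesis using False by (simp add: koszul_sign_def)
qed

text \<open>The presence of the other index changes the sign in exactly one of the two orders of
  removal, namely for the larger index. This is what makes the square of the differential
  vanish.\<close>

lemma koszul_sign_swap:
  fixes i j :: "'n::{finite,linorder}"
  assumes "i \<noteq> j" "i \<notin> T" "j \<notin> T"
  shows "koszul_sign j T * koszul_sign i (insert j T) = - (koszul_sign i T * koszul_sign j (insert i T))"
  using assms by (auto simp: koszul_sign_insert)

type_synonym ('n, 'k) chain = "'n set \<Rightarrow> nat \<Rightarrow> ('n, 'k) mpoly"

definition vscale :: "'k::field \<Rightarrow> (nat \<Rightarrow> ('n, 'k) mpoly) \<Rightarrow> nat \<Rightarrow> ('n, 'k) mpoly" where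
  "vscale c v = (\<lambda>l. pscale c (v l))"

definition cscale :: "'k::field \<Rightarrow> ('n, 'k) chain \<Rightarrow> ('n, 'k) chain" where
  "cscale c w = (\<lambda>T l. pscale c (w T l))"

lemma vector_space_vscale: "vector_space (vscale :: 'k::field \<Rightarrow> (nat \<Rightarrow> ('n, 'k) mpoly) \<Rightarrow> _)"
proof -
  interpret vector_space "pscale :: 'k \<Rightarrow> ('n, 'k) mpoly \<Rightarrow> _" by (rule vector_space_pscale)
  show ?thesis
    by unfold_locales (simp_all add: vscale_def fun_eq_iff scale_right_distrib scale_left_distrib)
qed

lemma vector_space_cscale: "vector_space (cscale :: 'k::field \<Rightarrow> ('n, 'k) chain \<Rightarrow> _)"
proof -
  interpret vector_space "pscale :: 'k \<Rightarrow> ('n, 'k) mpoly \<Rightarrow> _" by (rule vector_space_pscale)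
  show ?thesis
    by unfold_locales (simp_all add: cscale_def fun_eq_iff scale_right_distrib scale_left_distrib)
qed

text \<open>
  An element of \<open>\<Lambda>\<^sup>p \<otimes> R\<^sup>r\<close> is encoded by its coefficients: \<open>w T\<close> is the coefficient of the
  wedge product of the basis vectors with indices in \<open>T\<close>, taken in increasing order.
\<close>

definition koszul_d :: "('n::{finite,linorder}, 'k::field) chain \<Rightarrow> ('n, 'k) chain" where
  "koszul_d w = (\<lambda>T l. \<Sum>j\<in>-T. pscale (koszul_sign j T) (Var j * w (insert j T) l))"

lemma lookup_koszul_d:
  "lookup (koszul_d w T l) m =
     (\<Sum>j\<in>-T. koszul_sign j T * (if lookup m j > 0 then lookup (w (insert j T) l) (m - single j 1) else 0))"
  by (simp add: koszul_d_def lookup_sum lookup_Var_times)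

lemma koszul_d_add: "koszul_d (w + w') = koszul_d w + koszul_d w'"
  by (simp add: koszul_d_def fun_eq_iff pscale_def sum.distrib algebra_simps)

lemma koszul_d_diff: "koszul_d (w - w') = koszul_d w - koszul_d w'"
  by (metis koszul_d_add diff_add_cancel add_diff_cancel_right')

lemma koszul_d_cscale: "koszul_d (cscale c w) = cscale c (koszul_d w)"
  by (simp add: koszul_d_def cscale_def fun_eq_iff pscale_def sum_distrib_left algebra_simps)

lemma koszul_d_0 [simp]: "koszul_d 0 = 0"
  by (metis koszul_d_diff diff_self)

lemma linear_koszul_d:
  "Vector_Spaces.linear cscale cscale (koszul_d :: ('n::{finite,linorder}, 'k::field) chain \<Rightarrow> _)"
  by (simp add: Vector_Spaces.linear_iff vector_space_cscale koszul_d_add koszul_d_cscale)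

lemma koszul_d_koszul_d [simp]:
  fixes w :: "('n::{finite,linorder}, 'k::field) chain"
  shows "koszul_d (koszul_d w) = 0"
proof (intro ext)
  fix T :: "'n set" and l :: nat
  define a where "a = (\<lambda>j i. pscale (koszul_sign j T * koszul_sign i (insert j T))
      (Var j * (Var i * w (insert i (insert j T)) l)))"
  define P where "P = {(j, i). j \<notin> T \<and> i \<notin> T \<and> i \<noteq> j}"
  define Q where "Q = {(j, i). j \<notin> T \<and> i \<notin> T \<and> j < i}"
  have anti: "a i j = - a j i" if "(j, i) \<in> Q" for i j
  proof -
    have "koszul_sign j T * koszul_sign i (insert j T) = - (koszul_sign i T * koszul_sign j (insert i T) :: 'k)"
      using that by (intro koszul_sign_swap) (auto simp: Q_def)
    then show ?thesis
      by (simp add: a_def pscale_def Const_def single_uminus insert_commute mult.left_commute)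
  qed
  have "koszul_d (koszul_d w) T l = (\<Sum>j\<in>-T. \<Sum>i\<in>-(insert j T). a j i)"
    by (simp add: koszul_d_def a_def pscale_def Const_mult sum_distrib_left algebra_simps)
  also have "\<dots> = (\<Sum>(j, i)\<in>P. a j i)"
    by (subst sum.Sigma) (auto simp: P_def intro!: sum.cong)
  also have "P = Q \<union> prod.swap ` Q"
    by (auto simp: P_def Q_def image_iff)
  also have "(\<Sum>(j, i)\<in>Q \<union> prod.swap ` Q. a j i) = (\<Sum>(j, i)\<in>Q. a j i) + (\<Sum>(j, i)\<in>prod.swap ` Q. a j i)"
    by (rule sum.union_disjoint) (auto simp: Q_def)
  also have "(\<Sum>(j, i)\<in>prod.swap ` Q. a j i) = (\<Sum>(j, i)\<in>Q. a i j)"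
    by (subst sum.reindex) (auto simp: case_prod_unfold)
  also have "\<dots> = - (\<Sum>(j, i)\<in>Q. a j i)"
    unfolding sum_negf[symmetric] by (rule sum.cong) (auto simp: anti)
  finally show "koszul_d (koszul_d w) T l = 0 T l" by simp
qed

text \<open>Total degrees are integers, so that no subtraction of degrees is truncated.\<close>

definition free_part :: "nat \<Rightarrow> (nat \<Rightarrow> nat) \<Rightarrow> int \<Rightarrow> (nat \<Rightarrow> ('n::finite, 'k::field) mpoly) set" where
  "free_part r a t = {v. \<forall>l. (r \<le> l \<longrightarrow> v l = 0) \<and> (\<forall>m\<in>keys (v l). int (mdeg m) + int (a l) = t)}"

text \<open>Each exterior generator has degree 1, so the coefficients have degree
  \<open>t - int p\<close>; with this convention \<open>koszul_d\<close> preserves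
  \<open>t\<close>.\<close>

definition kchains :: "nat \<Rightarrow> (nat \<Rightarrow> nat) \<Rightarrow> nat \<Rightarrow> int \<Rightarrow> ('n::finite, 'k::field) chain set" where
  "kchains r a p t = {w. \<forall>T. (card T \<noteq> p \<longrightarrow> w T = 0) \<and> w T \<in> free_part r a (t - int p)}"

definition kchains_in ::
    "nat \<Rightarrow> (nat \<Rightarrow> nat) \<Rightarrow> (nat \<Rightarrow> ('n, 'k) mpoly) set \<Rightarrow> nat \<Rightarrow> int \<Rightarrow> ('n::finite, 'k::field) chain set" where
  "kchains_in r a Z p t = {w \<in> kchains r a p t. \<forall>T. w T \<in> Z}"

definition submod :: "nat \<Rightarrow> (nat \<Rightarrow> ('n, 'k::field) mpoly) set \<Rightarrow> bool" where
  "submod r Z \<longleftrightarrow> Z \<subseteq> free_mod r \<and> 0 \<in> Z \<and> (\<forall>u\<in>Z. \<forall>v\<in>Z. u + v \<in> Z) \<and> (\<forall>f. \<forall>v\<in>Z. (\<lambda>l. f * v l) \<in> Z)"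

lemma free_partI:
  "(\<And>l. r \<le> l \<Longrightarrow> v l = 0) \<Longrightarrow> (\<And>l m. lookup (v l) m \<noteq> 0 \<Longrightarrow> int (mdeg m) + int (a l) = t) \<Longrightarrow>
    v \<in> free_part r a t"
  by (auto simp: free_part_def in_keys_iff)

lemma free_partD:
  assumes "v \<in> free_part r a t"
  shows "r \<le> l \<Longrightarrow> v l = 0" "lookup (v l) m \<noteq> 0 \<Longrightarrow> int (mdeg m) + int (a l) = t"
  using assms by (auto simp: free_part_def in_keys_iff)

lemma free_part_0 [simp]: "0 \<in> free_part r a t"
  by (simp add: free_part_def)

lemma free_part_add:
  assumes "u \<in> free_part r a t" "v \<in> free_part r a t"
  shows "u + v \<in> free_part r a t"
proof (rule free_partI)
  fix l m
  show "(u + v) l = 0" if "r \<le> l" using assms that by (simp add: free_partD)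
  assume "lookup ((u + v) l) m \<noteq> 0"
  then have "lookup (u l) m \<noteq> 0 \<or> lookup (v l) m \<noteq> 0" by (auto simp: lookup_add)
  then show "int (mdeg m) + int (a l) = t" using assms free_partD(2) by blast
qed

lemma free_part_diff:
  assumes "u \<in> free_part r a t" "v \<in> free_part r a t"
  shows "u - v \<in> free_part r a t"
proof (rule free_partI)
  fix l m
  show "(u - v) l = 0" if "r \<le> l" using assms that by (simp add: free_partD)
  assume "lookup ((u - v) l) m \<noteq> 0"
  then have "lookup (u l) m \<noteq> 0 \<or> lookup (v l) m \<noteq> 0" by (auto simp: lookup_minus)
  then show "int (mdeg m) + int (a l) = t" using assms free_partD(2) by blast
qed

lemma free_part_vscale: "v \<in> free_part r a t \<Longrightarrow> vscale c v \<in> free_part r a t"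
  by (rule free_partI) (auto simp: vscale_def pscale_def dest: free_partD)

lemma free_part_free_mod: "v \<in> free_part r a t \<Longrightarrow> v \<in> free_mod r"
  by (simp add: free_mod_def free_partD)

lemma kchainsI:
  "(\<And>T. card T \<noteq> p \<Longrightarrow> w T = 0) \<Longrightarrow> (\<And>T. card T = p \<Longrightarrow> w T \<in> free_part r a (t - int p)) \<Longrightarrow> w \<in> kchains r a p t"
  unfolding kchains_def using free_part_0 by (smt (verit, best) mem_Collect_eq)

lemma kchainsD:
  assumes "w \<in> kchains r a p t"
  shows "card T \<noteq> p \<Longrightarrow> w T = 0" "w T \<in> free_part r a (t - int p)"
  using assms by (auto simp: kchains_def)

lemma subspace_kchains:
  "module.subspace cscale (kchains r a p t :: ('n::finite, 'k::field) chain set)"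
proof -
  interpret vector_space cscale by (rule vector_space_cscale)
  show ?thesis unfolding subspace_def
  proof (intro conjI ballI allI)
    show "0 \<in> kchains r a p t" by (rule kchainsI) auto
    fix w w' :: "('n, 'k) chain" assume "w \<in> kchains r a p t" "w' \<in> kchains r a p t"
    then show "w + w' \<in> kchains r a p t"
      by (intro kchainsI) (auto simp: kchainsD intro: free_part_add)
  next
    fix c and w :: "('n, 'k) chain" assume w: "w \<in> kchains r a p t"
    have "cscale c w T = vscale c (w T)" for T by (simp add: cscale_def vscale_def)
    then show "cscale c w \<in> kchains r a p t"
      using w by (intro kchainsI) (simp_all add: kchainsD free_part_vscale, simp add: vscale_def pscale_def fun_eq_iff)
  qed
qed

lemma submodD:
  assumes "submod r Z"
  shows "v \<in> Z \<Longrightarrow> v \<in> free_mod r" "0 \<in> Z" "u \<in> Z \<Longrightarrow> v \<in> Z \<Longrightarrow> u + v \<in> Z"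
    "v \<in> Z \<Longrightarrow> (\<lambda>l. f * v l) \<in> Z" "v \<in> Z \<Longrightarrow> vscale c v \<in> Z" "u \<in> Z \<Longrightarrow> v \<in> Z \<Longrightarrow> u - v \<in> Z"
proof -
  show "v \<in> Z \<Longrightarrow> v \<in> free_mod r" "0 \<in> Z" "u \<in> Z \<Longrightarrow> v \<in> Z \<Longrightarrow> u + v \<in> Z"
    and mul: "\<And>f v. v \<in> Z \<Longrightarrow> (\<lambda>l. f * v l) \<in> Z" for f v u
    using assms by (auto simp: submod_def)
  show "v \<in> Z \<Longrightarrow> vscale c v \<in> Z" using mul[of v "Const c"] by (simp add: vscale_def pscale_def)
  assume uv: "u \<in> Z" "v \<in> Z"
  have "u + (\<lambda>l. - 1 * v l) \<in> Z" using assms uv mul[OF uv(2)] unfolding submod_def by blast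
  moreover have "u + (\<lambda>l. - 1 * v l) = u - v" by (simp add: fun_eq_iff)
  ultimately show "u - v \<in> Z" by simp
qed

lemma submod_sum:
  assumes "submod r Z" "\<And>i. i \<in> A \<Longrightarrow> v i \<in> Z"
  shows "(\<Sum>i\<in>A. v i) \<in> Z"
  using assms(2) by (induction A rule: infinite_finite_induct) (auto intro: submodD[OF assms(1)])

lemma sum_fun_apply: "(\<Sum>i\<in>A. f i) x = (\<Sum>i\<in>A. f i x)"
  by (induction A rule: infinite_finite_induct) auto

lemma subspace_kchains_in:
  fixes Z :: "(nat \<Rightarrow> ('n::finite, 'k::field) mpoly) set"
  shows "submod r Z \<Longrightarrow> module.subspace cscale (kchains_in r a Z p t)"
proof -
  assume Z: "submod r Z"
  interpret vector_space cscale by (rule vector_space_cscale)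
  have "cscale c w T = vscale c (w T)" for T c and w :: "('n, 'k) chain"
    by (simp add: cscale_def vscale_def)
  then show ?thesis
    using subspace_kchains[of r a p t, where 'n = 'n and 'k = 'k] submodD[OF Z]
    unfolding subspace_def kchains_in_def by auto
qed

lemma koszul_d_kchains: "w \<in> kchains r a (Suc p) t \<Longrightarrow> koszul_d w \<in> kchains r a p t"
proof (rule kchainsI)
  fix T assume w: "w \<in> kchains r a (Suc p) t"
  show "koszul_d w T = 0" if "card T \<noteq> p"
  proof
    fix l
    have "w (insert j T) = 0" if "j \<in> -T" for j
      using that \<open>card T \<noteq> p\<close> w by (intro kchainsD) auto
    then show "koszul_d w T l = 0 l" by (simp add: koszul_d_def pscale_def)
  qed
  show "koszul_d w T \<in> free_part r a (t - int p)"
  proof (rule free_partI)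
    show "koszul_d w T l = 0" if "r \<le> l" for l
    proof -
      have "w S l = 0" for S using free_partD(1)[OF kchainsD(2)[OF w] that] .
      then show ?thesis by (simp add: koszul_d_def pscale_def)
    qed
    fix l m assume "lookup (koszul_d w T l) m \<noteq> 0"
    then obtain j where "koszul_sign j T *
        (if lookup m j > 0 then lookup (w (insert j T) l) (m - single j 1) else 0) \<noteq> 0"
      unfolding lookup_koszul_d by (rule sum.not_neutral_contains_not_neutral)
    then have j: "lookup m j > 0" "lookup (w (insert j T) l) (m - single j 1) \<noteq> 0"
      by (auto split: if_splits)
    have "mdeg m = Suc (mdeg (m - single j 1))"
      using single_add_minus[OF j(1)] mdeg_add[of "single j 1" "m - single j 1"] by simp
    with free_partD(2)[OF kchainsD(2)[OF w] j(2)] show "int (mdeg m) + int (a l) = t - int p" by simp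
  qed
qed

text \<open>
  In the multidegree of the monomial \<open>\<beta>\<close>, the Koszul complex is the chain complex of the simplex on
  the support of \<open>\<beta>\<close>. It is contracted onto a chosen vertex \<open>b\<close> of the simplex.
\<close>

lemma koszul_exact:
  fixes w :: "('n::{finite,linorder}, 'k::field) chain"
  assumes w: "w \<in> kchains r a p t" and dw: "koszul_d w = 0"
    and p: "p = 0 \<Longrightarrow> \<forall>l. const_coeff (w {} l) = 0"
  shows "\<exists>e\<in>kchains r a (Suc p) t. koszul_d e = w"
proof -
  \<comment> \<open>The term m e_T has multidegree \<open>m + chi T\<close>, which the differential
    does not change.\<close>
  define chi :: "'n set \<Rightarrow> 'n \<Rightarrow>\<^sub>0 nat" where "chi = (\<lambda>T. \<Sum>j\<in>T. single j 1)"
  have chi_insert: "chi (insert j T) = single j 1 + chi T" if "j \<notin> T" for j T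
    using that by (simp add: chi_def)
  \<comment> \<open>The chosen vertex depends on the multidegree only; this is what makes the terms
    of the contraction match up.\<close>
  define vt :: "('n \<Rightarrow>\<^sub>0 nat) \<Rightarrow> 'n" where "vt = (\<lambda>m. SOME j. lookup m j > 0)"
  have vt: "lookup m (vt m) > 0" if "m \<noteq> 0" for m
  proof -
    have "\<exists>j. lookup m j > 0" using that by (metis gr0I lookup_zero poly_mapping_eqI)
    then show ?thesis unfolding vt_def by (rule someI_ex)
  qed
  \<comment> \<open>The cone construction: divide by x_b and insert b, where b is the vertex chosen
    for the multidegree of the term at hand.\<close>
  define e :: "('n, 'k) chain" where "e = (\<lambda>S l. \<Sum>b\<in>S. pscale (koszul_sign b (S - {b}))
      (part (\<lambda>m. vt (m + chi S) = b) (vshift b (w (S - {b}) l))))"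
  have lookup_e: "lookup (e S l) m = (if vt (m + chi S) \<in> S then koszul_sign (vt (m + chi S)) (S - {vt (m + chi S)}) *
      lookup (w (S - {vt (m + chi S)}) l) (m + single (vt (m + chi S)) 1) else 0)" for S l m
  proof -
    have "lookup (e S l) m = (\<Sum>b\<in>S. if b = vt (m + chi S) then koszul_sign b (S - {b}) *
      lookup (w (S - {b}) l) (m + single b 1) else 0)"
      unfolding e_def lookup_sum by (rule sum.cong) auto
    then show ?thesis by (simp add: sum.delta)
  qed
  have "e \<in> kchains r a (Suc p) t"
  proof (rule kchainsI)
    show "e S = 0" if "card S \<noteq> Suc p" for S
    proof
      fix l
      have "w (S - {b}) = 0" if "b \<in> S" for b
        using that \<open>card S \<noteq> Suc p\<close> card_Suc_Diff1[of S b] by (intro kchainsD(1)[OF w]) auto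
      then show "e S l = 0 l" by (intro poly_mapping_eqI) (auto simp: lookup_e)
    qed
    show "e S \<in> free_part r a (t - int (Suc p))" for S
    proof (rule free_partI)
      show "e S l = 0" if "r \<le> l" for l
        using free_partD(1)[OF kchainsD(2)[OF w] that] by (intro poly_mapping_eqI) (auto simp: lookup_e)
      fix l m assume "lookup (e S l) m \<noteq> 0"
      then have "lookup (w (S - {vt (m + chi S)}) l) (m + single (vt (m + chi S)) 1) \<noteq> 0"
        by (auto simp: lookup_e split: if_splits)
      from free_partD(2)[OF kchainsD(2)[OF w] this]
      show "int (mdeg m) + int (a l) = t - int (Suc p)" by simp
    qed
  qed
  moreover have "koszul_d e = w"
  proof (intro ext poly_mapping_eqI)
    fix T l m
    define b where "b = vt (m + chi T)"
    have shift: "m - single j 1 + chi (insert j T) = m + chi T" if "j \<notin> T" "lookup m j > 0" for j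
      using single_add_minus[OF that(2)] by (simp only: chi_insert[OF that(1)]) (metis add.assoc add.commute)
    have de: "lookup (koszul_d e T l) m = (\<Sum>j\<in>-T. koszul_sign j T * (if lookup m j > 0 \<and> b \<in> insert j T then
        koszul_sign b (insert j T - {b}) * lookup (w (insert j T - {b}) l) (m - single j 1 + single b 1) else 0))"
      unfolding lookup_koszul_d lookup_e
      by (intro sum.cong refl arg_cong2[where f = "(*)"]) (auto simp: shift b_def simp del: One_nat_def)
    show "lookup (koszul_d e T l) m = lookup (w T l) m"
    \<comment> \<open>Multidegree 0 has an empty support and hence no vertex. It occurs only for
      empty \<open>T\<close> and the monomial 1, and there the assumption on constant coefficients
      takes over.\<close>
    proof (cases "m + chi T = 0")
      case True
      then have m0: "m = 0" by (metis add_eq_0_iff_both_eq_0 mdeg_add mdeg_eq_0_iff)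
      then have "chi T = 0" using True by simp
      have T: "T = {}"
      proof (rule ccontr)
        assume "T \<noteq> {}"
        then obtain j where j: "j \<in> T" by blast
        then have "chi (insert j (T - {j})) = single j 1 + chi (T - {j})" by (intro chi_insert) auto
        then have "mdeg (chi T) \<noteq> 0" using j by (simp add: insert_absorb)
        then show False using \<open>chi T = 0\<close> by simp
      qed
      have "lookup (w T l) m = 0"
      proof (cases "p = 0")
        case True
        then show ?thesis using p T m0 by (simp add: const_coeff_def)
      next
        case False
        then have "w T = 0" using T by (intro kchainsD(1)[OF w]) auto
        then show ?thesis by simp
      qed
      then show ?thesis by (simp add: lookup_koszul_d m0)
    next
      case False
      from vt[OF False] have b: "lookup (m + chi T) b > 0" by (simp add: b_def)
      show ?thesis
      proof (cases "b \<in> T")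
        case False
        have "lookup (chi T) b = 0" using False by (auto simp: chi_def lookup_sum lookup_single when_def)
        with b have mb: "lookup m b > 0" by (simp add: lookup_add)
        have "lookup (koszul_d e T l) m = (\<Sum>j\<in>-T. if j = b then lookup (w T l) m else 0)"
          unfolding de
        proof (rule sum.cong)
          fix j assume "j \<in> -T"
          show "koszul_sign j T * (if lookup m j > 0 \<and> b \<in> insert j T then
            koszul_sign b (insert j T - {b}) * lookup (w (insert j T - {b}) l) (m - single j 1 + single b 1) else 0)
            = (if j = b then lookup (w T l) m else 0)"
            using False mb single_add_minus[OF mb] by (auto simp: add.commute)
        qed simp
        then show ?thesis using False by simp
      next
        case True
        \<comment> \<open>Inserting b into \<open>T\<close> is impossible here. The cycle condition
          at \<open>T'\<close>, read at the monomial m x_b, expresses the coefficient of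
          \<open>w T\<close> by those of the sets \<open>insert j T'\<close> that occur in
          \<open>koszul_d e\<close>.\<close>
        define T' where "T' = T - {b}"
        have T: "T = insert b T'" "b \<notin> T'" using True by (auto simp: T'_def)
        have "0 = lookup (koszul_d w T' l) (m + single b 1)" by (simp add: dw)
        also have "\<dots> = (\<Sum>j\<in>-T'. koszul_sign j T' * (if lookup (m + single b 1) j > 0
            then lookup (w (insert j T') l) (m + single b 1 - single j 1) else 0))"
          by (simp only: lookup_koszul_d)
        also have "-T' = insert b (-T)" using T by auto
        also have "(\<Sum>j\<in>insert b (-T). koszul_sign j T' * (if lookup (m + single b 1) j > 0
            then lookup (w (insert j T') l) (m + single b 1 - single j 1) else 0)) =
          koszul_sign b T' * lookup (w T l) m + (\<Sum>j\<in>-T. koszul_sign j T' * (if lookup m j > 0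
            then lookup (w (insert j T') l) (m - single j 1 + single b 1) else 0))"
        proof (subst sum.insert)
          have "m + single b 1 - single j 1 = m - single j 1 + single b 1" if "j \<in> -T" "lookup m j > 0" for j
            using that by (intro poly_mapping_eqI) (auto simp: lookup_add lookup_minus lookup_single when_def)
          moreover have "lookup (m + single b 1) j = lookup m j" if "j \<in> -T" for j
            using that T by (auto simp: lookup_add lookup_single when_def)
          ultimately show "koszul_sign b T' * (if 0 < lookup (m + single b 1) b then lookup (w (insert b T') l) (m + single b 1 - single b 1) else 0) +
            (\<Sum>x\<in>- T. koszul_sign x T' * (if 0 < lookup (m + single b 1) x then lookup (w (insert x T') l) (m + single b 1 - single x 1) else 0)) =
            koszul_sign b T' * lookup (w T l) m + (\<Sum>j\<in>-T. koszul_sign j T' * (if lookup m j > 0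
            then lookup (w (insert j T') l) (m - single j 1 + single b 1) else 0))"
            unfolding T(1)[symmetric]
            by (intro arg_cong2[where f = "(+)"] sum.cong refl) (auto simp: lookup_add)
        qed (use T in auto)
        finally have rel: "koszul_sign b T' * lookup (w T l) m = - (\<Sum>j\<in>-T. koszul_sign j T' *
          (if lookup m j > 0 then lookup (w (insert j T') l) (m - single j 1 + single b 1) else 0))"
          by (simp add: eq_neg_iff_add_eq_0)
        have sgn: "koszul_sign j T * koszul_sign b (insert j T') = - (koszul_sign b T' * (koszul_sign j T' :: 'k))"
          if "j \<in> -T" for j
        proof -
          have "koszul_sign j T' * koszul_sign b (insert j T') = - (koszul_sign b T' * (koszul_sign j T :: 'k))"
            using koszul_sign_swap[of b j T'] that T by auto
          then have "koszul_sign j T * (koszul_sign j T' * (koszul_sign j T' * koszul_sign b (insert j T'))) =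
              koszul_sign j T * (koszul_sign j T' * (- (koszul_sign b T' * (koszul_sign j T :: 'k))))"
            by (simp only:)
          also have "\<dots> = - (koszul_sign b T' * koszul_sign j T') * (koszul_sign j T * koszul_sign j T)"
            by (simp only: mult_minus_left mult_minus_right mult_ac)
          finally show ?thesis by simp
        qed
        have "lookup (koszul_d e T l) m = (\<Sum>j\<in>-T. - (koszul_sign b T' * (koszul_sign j T' *
          (if lookup m j > 0 then lookup (w (insert j T') l) (m - single j 1 + single b 1) else 0))))"
          unfolding de
        proof (rule sum.cong)
          fix j assume j: "j \<in> -T"
          then have "insert j T - {b} = insert j T'" "b \<in> insert j T" using T by auto
          then show "koszul_sign j T * (if 0 < lookup m j \<and> b \<in> insert j T then koszul_sign b (insert j T - {b}) *
             lookup (w (insert j T - {b}) l) (m - single j 1 + single b 1) else 0) =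
            - (koszul_sign b T' * (koszul_sign j T' * (if 0 < lookup m j then lookup (w (insert j T') l) (m - single j 1 + single b 1) else 0)))"
            using sgn[OF j] by (simp flip: mult.assoc)
        qed simp
        also have "\<dots> = koszul_sign b T' * (koszul_sign b T' * lookup (w T l) m)"
          by (simp only: rel sum_negf sum_distrib_left mult_minus_right)
        finally show ?thesis by simp
      qed
    qed
  qed
  ultimately show ?thesis by blast
qed

section \<open>Koszul homology of quotients of graded free modules, and dimension shifting\<close>

section \<open>Graded maps of free modules\<close>

text \<open>Koszul cycles of \<open>G/Z\<close> represented by chains of the free module
  \<open>G\<close>, so that no quotient module has to be formed.\<close>

definition rel_cycles ::
    "nat \<Rightarrow> (nat \<Rightarrow> nat) \<Rightarrow> (nat \<Rightarrow> ('n, 'k) mpoly) set \<Rightarrow> nat \<Rightarrow> int \<Rightarrow> ('n::{finite,linorder}, 'k::field) chain set" where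
  "rel_cycles r a Z p t = {w \<in> kchains r a p t. \<forall>T. koszul_d w T \<in> Z}"

definition rel_boundaries ::
    "nat \<Rightarrow> (nat \<Rightarrow> nat) \<Rightarrow> (nat \<Rightarrow> ('n, 'k) mpoly) set \<Rightarrow> nat \<Rightarrow> int \<Rightarrow> ('n::{finite,linorder}, 'k::field) chain set" where
  "rel_boundaries r a Z p t = {z + koszul_d e | z e. z \<in> kchains_in r a Z p t \<and> e \<in> kchains r a (Suc p) t}"

text \<open>
  For the graded free module \<open>G\<close> with \<open>r\<close> generators of degrees \<open>a\<close>, this says that the Koszul
  homology \<open>H\<^sub>p\<close> of \<open>G/Z\<close> has dimension \<open>h\<close> in degree \<open>t\<close>.
\<close>

definition koszul_hdim ::
    "nat \<Rightarrow> (nat \<Rightarrow> nat) \<Rightarrow> (nat \<Rightarrow> ('n::{finite,linorder}, 'k::field) mpoly) set \<Rightarrow> nat \<Rightarrow> int \<Rightarrow> nat \<Rightarrow> bool" where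
  "koszul_hdim r a Z p t h \<longleftrightarrow> has_qdim cscale (rel_cycles r a Z p t) (rel_boundaries r a Z p t) h"

lemma subspace_rel_cycles:
  fixes Z :: "(nat \<Rightarrow> ('n::{finite,linorder}, 'k::field) mpoly) set"
  assumes Z: "submod r Z"
  shows "module.subspace cscale (rel_cycles r a Z p t)"
proof -
  interpret vector_space cscale by (rule vector_space_cscale)
  have "cscale c w T = vscale c (w T)" for T c and w :: "('n, 'k) chain"
    by (simp add: cscale_def vscale_def)
  then show ?thesis
    using subspace_kchains[of r a p t, where 'n = 'n and 'k = 'k] submodD[OF Z]
    unfolding subspace_def rel_cycles_def by (auto simp: koszul_d_add koszul_d_cscale)
qed

text \<open>Modulo boundaries of chains in \<open>Z\<close>, this is the kernel of the map from
  H_p(Z) to H_p(G). The condition of bounding in \<open>G\<close> matters for p = 0, where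
  \<open>G\<close> itself has Koszul homology.\<close>

definition exact_cycles ::
    "nat \<Rightarrow> (nat \<Rightarrow> nat) \<Rightarrow> (nat \<Rightarrow> ('n, 'k) mpoly) set \<Rightarrow> nat \<Rightarrow> int \<Rightarrow> ('n::{finite,linorder}, 'k::field) chain set" where
  "exact_cycles r a Z p t = {z \<in> koszul_d ` kchains r a (Suc p) t. \<forall>T. z T \<in> Z}"

lemma subspace_exact_boundaries:
  fixes Z :: "(nat \<Rightarrow> ('n::{finite,linorder}, 'k::field) mpoly) set"
  assumes "submod r Z"
  shows "module.subspace cscale (koszul_d ` kchains_in r a Z p t)"
proof -
  interpret d: Vector_Spaces.linear cscale cscale "koszul_d :: ('n, 'k) chain \<Rightarrow> _"
    by (rule linear_koszul_d)
  show ?thesis by (rule d.subspace_image[OF subspace_kchains_in[OF assms]])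
qed

text \<open>The connecting homomorphism of \<open>0 \<rightarrow> Z \<rightarrow> G \<rightarrow> G/Z \<rightarrow> 0\<close>.\<close>

lemma koszul_hdim_connecting:
  fixes Z :: "(nat \<Rightarrow> ('n::{finite,linorder}, 'k::field) mpoly) set"
  assumes Z: "submod r Z"
  shows "koszul_hdim r a Z (Suc p) t h \<longleftrightarrow>
    has_qdim cscale (exact_cycles r a Z p t) (koszul_d ` kchains_in r a Z (Suc p) t) h"
  unfolding koszul_hdim_def
proof (rule has_qdim_linear_iff[where f = koszul_d])
  show "Vector_Spaces.linear cscale cscale (koszul_d :: ('n, 'k) chain \<Rightarrow> _)" by (rule linear_koszul_d)
  show "module.subspace cscale (rel_cycles r a Z (Suc p) t)" by (rule subspace_rel_cycles[OF Z])
  show "module.subspace cscale (koszul_d ` kchains_in r a Z (Suc p) t)"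
    by (rule subspace_exact_boundaries[OF Z])
  fix w assume "w \<in> rel_boundaries r a Z (Suc p) t"
  then show "koszul_d w \<in> koszul_d ` kchains_in r a Z (Suc p) t"
    by (auto simp: rel_boundaries_def koszul_d_add)
next
  fix w assume w: "w \<in> rel_cycles r a Z (Suc p) t" "koszul_d w \<in> koszul_d ` kchains_in r a Z (Suc p) t"
  then obtain z where z: "z \<in> kchains_in r a Z (Suc p) t" "koszul_d w = koszul_d z" by blast
  \<comment> \<open>The difference is a cycle of \<open>G\<close> itself in positive exterior
    degree, and hence bounds.\<close>
  have "w - z \<in> kchains r a (Suc p) t"
  proof -
    interpret vector_space "cscale :: 'k \<Rightarrow> ('n, 'k) chain \<Rightarrow> _" by (rule vector_space_cscale)
    show ?thesis using w z subspace_diff[OF subspace_kchains] by (auto simp: rel_cycles_def kchains_in_def)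
  qed
  moreover have "koszul_d (w - z) = 0" using z by (simp add: koszul_d_diff)
  ultimately obtain e where "e \<in> kchains r a (Suc (Suc p)) t" "koszul_d e = w - z"
    using koszul_exact by blast
  then have "w = z + koszul_d e" by simp
  then show "w \<in> rel_boundaries r a Z (Suc p) t"
    unfolding rel_boundaries_def using z \<open>e \<in> _\<close> by blast
next
  fix z assume "z \<in> exact_cycles r a Z p t"
  then obtain w where w: "w \<in> kchains r a (Suc p) t" "z = koszul_d w" "\<forall>T. z T \<in> Z"
    by (auto simp: exact_cycles_def)
  then have "w \<in> rel_cycles r a Z (Suc p) t" by (simp add: rel_cycles_def)
  moreover have "0 \<in> kchains_in r a Z (Suc p) t"
    using Z by (auto simp: kchains_in_def submod_def intro: kchainsI)
  then have "z - koszul_d w \<in> koszul_d ` kchains_in r a Z (Suc p) t"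
    using w by (metis diff_self image_eqI koszul_d_0)
  ultimately show "\<exists>w\<in>rel_cycles r a Z (Suc p) t. z - koszul_d w \<in> koszul_d ` kchains_in r a Z (Suc p) t"
    by blast
qed (auto simp: rel_cycles_def exact_cycles_def)

definition mat_map ::
    "nat \<Rightarrow> nat \<Rightarrow> (nat \<Rightarrow> nat \<Rightarrow> ('n, 'k::field) mpoly) \<Rightarrow> (nat \<Rightarrow> ('n, 'k) mpoly) \<Rightarrow> nat \<Rightarrow> ('n, 'k) mpoly" where
  "mat_map r r' D v = (\<lambda>l. if l < r then \<Sum>j<r'. D l j * v j else 0)"

definition component :: "(nat \<Rightarrow> nat) \<Rightarrow> int \<Rightarrow> (nat \<Rightarrow> ('n::finite, 'k::field) mpoly) \<Rightarrow> nat \<Rightarrow> ('n, 'k) mpoly" where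
  "component a t v = (\<lambda>l. part (\<lambda>m. int (mdeg m) + int (a l) = t) (v l))"

lemma component_free_part: "v \<in> free_mod r \<Longrightarrow> component a t v \<in> free_part r a t"
  by (rule free_partI) (auto simp: component_def free_mod_def split: if_splits)

lemma component_id: "v \<in> free_part r a t \<Longrightarrow> component a t v = v"
  by (auto simp: component_def fun_eq_iff free_part_def intro: part_id)

text \<open>The map given by \<open>D\<close> after tensoring with k = R/(x_1, ..., x_n).\<close>

definition const_map ::
    "nat \<Rightarrow> nat \<Rightarrow> (nat \<Rightarrow> nat \<Rightarrow> ('n, 'k::field) mpoly) \<Rightarrow> (nat \<Rightarrow> 'k) \<Rightarrow> nat \<Rightarrow> 'k" where
  "const_map r r' D c = (\<lambda>l. if l < r then \<Sum>j<r'. const_coeff (D l j) * c j else 0)"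

definition const_part :: "nat \<Rightarrow> (nat \<Rightarrow> nat) \<Rightarrow> int \<Rightarrow> (nat \<Rightarrow> 'k::field) set" where
  "const_part r a t = {c. \<forall>j. c j \<noteq> 0 \<longrightarrow> j < r \<and> int (a j) = t}"

lemma const_coeff_add: "const_coeff (p + q) = const_coeff p + const_coeff q"
  by (simp add: const_coeff_def lookup_add)

lemma const_coeff_diff: "const_coeff (p - q) = const_coeff p - const_coeff q"
  by (simp add: const_coeff_def lookup_minus)

lemma const_coeff_0 [simp]: "const_coeff 0 = 0"
  by (simp add: const_coeff_def)

lemma const_coeff_Const [simp]: "const_coeff (Const c) = c"
  by (simp add: const_coeff_def Const_def)

lemma const_coeff_sum: "const_coeff (\<Sum>i\<in>A. f i) = (\<Sum>i\<in>A. const_coeff (f i))"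
  by (simp add: const_coeff_def lookup_sum)

lemma const_coeff_Var_times [simp]: "const_coeff (Var j * p) = 0"
  by (simp add: const_coeff_def lookup_Var_times)

lemma const_coeff_pscale [simp]: "const_coeff (pscale c p) = c * const_coeff p"
  by (simp add: const_coeff_def)

lemma const_coeff_mult:
  fixes p q :: "('n::finite, 'k::field) mpoly"
  shows "const_coeff (p * q) = const_coeff p * const_coeff q"
proof (induction p rule: mpoly_induct)
  case (single m c)
  show ?case
  proof (cases "m = 0")
    case True
    then have "single m c = Const c" by (simp add: Const_def)
    then show ?thesis by (simp add: const_coeff_def[of "_ * _"]) (simp add: const_coeff_def)
  next
    case False
    have "0 \<noteq> m + u" for u :: "'n \<Rightarrow>\<^sub>0 nat"
    proof
      assume "0 = m + u"
      then have "mdeg (m + u) = 0" by (metis mdeg_0)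
      then show False using False by simp
    qed
    then have "const_coeff (single m c * q) = 0"
      unfolding const_coeff_def by (rule lookup_single_times_nonmult)
    moreover have "const_coeff (single m c) = 0" using False by (simp add: const_coeff_def lookup_single)
    ultimately show ?thesis by simp
  qed
qed (simp add: distrib_right const_coeff_add)

lemma free_mod_closed:
  "0 \<in> free_mod r" "u \<in> free_mod r \<Longrightarrow> v \<in> free_mod r \<Longrightarrow> u + v \<in> free_mod r"
  "u \<in> free_mod r \<Longrightarrow> v \<in> free_mod r \<Longrightarrow> u - v \<in> free_mod r"
  "v \<in> free_mod r \<Longrightarrow> (\<lambda>l. f * v l) \<in> free_mod r" for u v :: "nat \<Rightarrow> ('n, 'k::field) mpoly"
  by (auto simp: free_mod_def)

definition const_vec :: "(nat \<Rightarrow> ('n, 'k::field) mpoly) \<Rightarrow> nat \<Rightarrow> 'k" where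
  "const_vec v = (\<lambda>j. const_coeff (v j))"

lemma linear_const_vec: "Vector_Spaces.linear vscale fscale const_vec"
  by (auto simp: Vector_Spaces.linear_iff vector_space_vscale vector_space_fscale const_vec_def
      fun_eq_iff const_coeff_add vscale_def fscale_def)

definition vchain :: "(nat \<Rightarrow> ('n, 'k::field) mpoly) \<Rightarrow> ('n, 'k) chain" where
  "vchain v = (\<lambda>T. if T = {} then v else 0)"

lemma vchain_kchains: "v \<in> free_part r a t \<Longrightarrow> vchain v \<in> kchains r a 0 t"
  by (rule kchainsI) (auto simp: vchain_def)

lemma koszul_d_vchain: "koszul_d (vchain v) = 0"
  by (simp add: koszul_d_def vchain_def fun_eq_iff pscale_def)

text \<open>Without constant coefficients a vector lies in (x_1, ..., x_n) times the free module,
  which is the image of the last Koszul differential.\<close>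

lemma vchain_boundary:
  fixes v :: "nat \<Rightarrow> ('n::{finite,linorder}, 'k::field) mpoly"
  assumes "v \<in> free_part r a t" "const_vec v = 0"
  shows "\<exists>w\<in>kchains r a (Suc 0) t. koszul_d w = vchain v"
  using koszul_exact[OF vchain_kchains[OF assms(1)] koszul_d_vchain] assms(2)
  by (auto simp: vchain_def const_vec_def fun_eq_iff)

lemma boundary_vchain:
  assumes "w \<in> kchains r a (Suc 0) t"
  shows "koszul_d w = vchain (koszul_d w {})" "const_vec (koszul_d w {}) = 0"
proof -
  show "koszul_d w = vchain (koszul_d w {})"
    using kchainsD(1)[OF koszul_d_kchains[OF assms]] by (auto simp: vchain_def fun_eq_iff)
  show "const_vec (koszul_d w {}) = 0"
    by (simp add: const_vec_def koszul_d_def fun_eq_iff const_coeff_sum)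
qed

text \<open>A homomorphism of degree 0 from the free module with generator degrees \<open>a'\<close>
  to the one with degrees \<open>a\<close>. Zero entries of \<open>D\<close> satisfy the condition
  vacuously.\<close>

locale graded_map =
  fixes r :: nat and a :: "nat \<Rightarrow> nat" and r' :: nat and a' :: "nat \<Rightarrow> nat"
    and D :: "nat \<Rightarrow> nat \<Rightarrow> ('n::{finite,linorder}, 'k::field) mpoly"
  assumes deg: "\<And>l j m. l < r \<Longrightarrow> j < r' \<Longrightarrow> m \<in> keys (D l j) \<Longrightarrow> mdeg m + a l = a' j"
begin

abbreviation "\<phi> \<equiv> mat_map r r' D"
abbreviation "im \<equiv> \<phi> ` free_mod r'"
abbreviation "ker \<equiv> {v \<in> free_mod r'. \<phi> v = 0}"

lemma map_add: "\<phi> (u + v) = \<phi> u + \<phi> v"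
  by (simp add: mat_map_def fun_eq_iff distrib_left sum.distrib)

lemma map_diff: "\<phi> (u - v) = \<phi> u - \<phi> v"
  by (metis map_add diff_add_cancel add_diff_cancel_right')

lemma map_0 [simp]: "\<phi> 0 = 0"
  by (simp add: mat_map_def fun_eq_iff)

lemma map_times: "\<phi> (\<lambda>l. f * v l) = (\<lambda>l. f * \<phi> v l)"
  by (auto simp: mat_map_def fun_eq_iff sum_distrib_left mult.left_commute)

lemma map_vscale: "\<phi> (vscale c v) = vscale c (\<phi> v)"
  by (simp add: vscale_def pscale_def map_times)

lemma map_sum: "\<phi> (\<Sum>i\<in>A. v i) = (\<Sum>i\<in>A. \<phi> (v i))"
  by (induction A rule: infinite_finite_induct) (simp_all only: map_add map_0 sum.insert sum.empty sum.infinite simp_thms)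

lemma map_component: "\<phi> (component a' t v) = component a t (\<phi> v)"
proof
  fix l
  have "part (\<lambda>m. int (mdeg m) + int (a l) = t) (D l j * v j) =
      D l j * part (\<lambda>m. int (mdeg m) + int (a' j) = t) (v j)" if "l < r" "j < r'" for j
    using deg[OF that] by (intro part_mult) fastforce
  then show "\<phi> (component a' t v) l = component a t (\<phi> v) l"
    by (simp add: mat_map_def component_def part_sum)
qed

lemma map_free_mod: "\<phi> v \<in> free_mod r"
  by (simp add: mat_map_def free_mod_def)

lemma map_free_part: "v \<in> free_part r' a' t \<Longrightarrow> \<phi> v \<in> free_part r a t"
  using map_component[of t v] component_free_part[OF map_free_mod, of a t v] by (simp add: component_id)

text \<open>Since the map is graded, any preimage can be replaced by its component of the right
  degree.\<close>

lemma map_lift: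
  assumes "z \<in> im" "z \<in> free_part r a t"
  shows "\<exists>u\<in>free_part r' a' t. \<phi> u = z"
proof -
  obtain v where v: "v \<in> free_mod r'" "z = \<phi> v" using assms by blast
  then have "\<phi> (component a' t v) = z" using map_component[of t v] assms by (simp add: component_id)
  then show ?thesis using component_free_part[OF v(1)] by blast
qed

lemma submod_im: "submod r im"
  unfolding submod_def
proof (intro conjI ballI allI)
  show "im \<subseteq> free_mod r" using map_free_mod by blast
  show "0 \<in> im" by (rule image_eqI[of _ _ 0]) (auto simp: free_mod_closed)
  fix u assume "u \<in> im"
  then obtain x where x: "x \<in> free_mod r'" "u = \<phi> x" by blast
  show "(\<lambda>l. f * u l) \<in> im" for f
    using x free_mod_closed(4)[OF x(1)] by (auto simp: map_times[symmetric])
  fix v assume "v \<in> im"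
  then obtain y where y: "y \<in> free_mod r'" "v = \<phi> y" by blast
  show "u + v \<in> im" unfolding x y map_add[symmetric] using free_mod_closed(2)[OF x(1) y(1)] by blast
qed

lemma submod_ker: "submod r' ker"
  unfolding submod_def by (auto simp: free_mod_closed map_add map_times fun_eq_iff)

definition cmap :: "('n, 'k) chain \<Rightarrow> ('n, 'k) chain" where
  "cmap w = (\<lambda>T. \<phi> (w T))"

lemma cmap_kchains:
  assumes w: "w \<in> kchains r' a' p t"
  shows "cmap w \<in> kchains r a p t"
proof (rule kchainsI)
  fix T
  show "cmap w T = 0" if "card T \<noteq> p"
    by (simp only: cmap_def kchainsD(1)[OF w that] map_0)
  show "cmap w T \<in> free_part r a (t - int p)"
    by (simp only: cmap_def map_free_part[OF kchainsD(2)[OF w]])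
qed

lemma cmap_kchains_in:
  assumes w: "w \<in> kchains r' a' p t"
  shows "cmap w \<in> kchains_in r a im p t"
proof -
  have "cmap w T \<in> im" for T
    unfolding cmap_def by (rule imageI[OF free_part_free_mod[OF kchainsD(2)[OF w]]])
  then show ?thesis using cmap_kchains[OF w] by (simp add: kchains_in_def)
qed

lemma cmap_add: "cmap (u + v) = cmap u + cmap v"
  by (simp add: cmap_def fun_eq_iff map_add)

lemma cmap_diff: "cmap (u - v) = cmap u - cmap v"
  by (metis cmap_add diff_add_cancel add_diff_cancel_right')

lemma linear_cmap: "Vector_Spaces.linear cscale cscale cmap"
proof -
  have *: "cscale c w T = vscale c (w T)" for T c and w :: "('n, 'k) chain"
    by (simp add: cscale_def vscale_def)
  have "cmap (cscale c w) = cscale c (cmap w)" for c w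
    by (rule ext) (simp only: cmap_def * map_vscale)
  then show ?thesis by (simp add: Vector_Spaces.linear_iff vector_space_cscale cmap_add)
qed

lemma koszul_d_cmap: "koszul_d (cmap w) = cmap (koszul_d w)"
proof
  fix T
  have *: "koszul_d w T = (\<Sum>j\<in>-T. (\<lambda>l. (Const (koszul_sign j T) * Var j) * w (insert j T) l))"
    for w :: "('n, 'k) chain"
    by (simp add: fun_eq_iff koszul_d_def sum_fun_apply pscale_def mult.assoc)
  show "koszul_d (cmap w) T = cmap (koszul_d w) T"
    by (simp only: * cmap_def map_sum map_times)
qed

lemma cmap_lift:
  assumes "z \<in> kchains_in r a im p t"
  shows "\<exists>e\<in>kchains r' a' p t. cmap e = z"
proof -
  have "\<exists>u. (card T \<noteq> p \<longrightarrow> u = 0) \<and> u \<in> free_part r' a' (t - int p) \<and> \<phi> u = z T" for T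
  proof (cases "card T = p")
    case True
    then show ?thesis using map_lift[of "z T" "t - int p"] assms by (auto simp: kchains_in_def kchainsD)
  next
    case False
    then have "z T = 0" using assms by (auto simp: kchains_in_def kchainsD)
    then show ?thesis by (intro exI[of _ 0]) auto
  qed
  then obtain e where e: "\<And>T. (card T \<noteq> p \<longrightarrow> e T = 0) \<and> e T \<in> free_part r' a' (t - int p) \<and> \<phi> (e T) = z T"
    by metis
  then have "e \<in> kchains r' a' p t" by (intro kchainsI) auto
  moreover have "cmap e = z" using e by (simp add: cmap_def fun_eq_iff)
  ultimately show ?thesis by blast
qed

lemma ker_chainI: "w \<in> kchains r' a' p t \<Longrightarrow> cmap w T = 0 \<Longrightarrow> w T \<in> ker"
  using free_part_free_mod kchainsD(2) by (fastforce simp: cmap_def)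

lemma ker_kchains_inI:
  assumes w: "w \<in> kchains r' a' p t" and 0: "cmap w = 0"
  shows "w \<in> kchains_in r' a' ker p t"
proof -
  have "w T \<in> ker" for T by (rule ker_chainI[OF w]) (simp add: 0)
  then show ?thesis using w unfolding kchains_in_def by blast
qed

lemma cmap_ker: "w T \<in> ker \<Longrightarrow> cmap w T = 0"
  by (simp add: cmap_def)

text \<open>The source modulo \<open>ker\<close> is isomorphic to \<open>im\<close>, and the
  connecting homomorphism identifies H_(p+1) of \<open>im\<close> with H_(p+2) of the target modulo
  \<open>im\<close>, because free modules have no Koszul homology in positive exterior
  degrees.\<close>

lemma koszul_hdim_shift:
  "koszul_hdim r' a' ker (Suc p) t h \<longleftrightarrow> koszul_hdim r a im (Suc (Suc p)) t h"
proof -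
  interpret c: Vector_Spaces.linear cscale cscale cmap by (rule linear_cmap)
  have "has_qdim cscale (rel_cycles r' a' ker (Suc p) t) (rel_boundaries r' a' ker (Suc p) t) h \<longleftrightarrow>
    has_qdim cscale (exact_cycles r a im (Suc p) t) (koszul_d ` kchains_in r a im (Suc (Suc p)) t) h"
  proof (rule has_qdim_linear_iff[OF linear_cmap])
    show "module.subspace cscale (rel_cycles r' a' ker (Suc p) t)"
      by (rule subspace_rel_cycles[OF submod_ker])
    show "module.subspace cscale (koszul_d ` kchains_in r a im (Suc (Suc p)) t)"
      by (rule subspace_exact_boundaries[OF submod_im])
    fix w assume w: "w \<in> rel_cycles r' a' ker (Suc p) t"
    have "koszul_d (cmap w) = 0"
      using w cmap_ker by (auto simp: rel_cycles_def koszul_d_cmap fun_eq_iff)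
    moreover have "cmap w \<in> kchains r a (Suc p) t" using w by (auto simp: rel_cycles_def cmap_kchains)
    ultimately obtain e where "e \<in> kchains r a (Suc (Suc p)) t" "koszul_d e = cmap w"
      using koszul_exact[of "cmap w" r a "Suc p" t] by blast
    then have "cmap w \<in> koszul_d ` kchains r a (Suc (Suc p)) t" by (metis image_eqI)
    moreover have "cmap w T \<in> im" for T
    proof -
      have "w T \<in> free_mod r'"
        using w by (auto simp: rel_cycles_def intro: free_part_free_mod kchainsD(2))
      then show ?thesis unfolding cmap_def by (rule imageI)
    qed
    ultimately show "cmap w \<in> exact_cycles r a im (Suc p) t" by (simp add: exact_cycles_def)
  next
    fix w assume "w \<in> rel_boundaries r' a' ker (Suc p) t"
    then obtain z e where ze: "z \<in> kchains_in r' a' ker (Suc p) t" "e \<in> kchains r' a' (Suc (Suc p)) t"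
      "w = z + koszul_d e" by (auto simp: rel_boundaries_def)
    have "cmap z = 0" using ze(1) by (auto simp: kchains_in_def cmap_def fun_eq_iff)
    then have "cmap w = koszul_d (cmap e)" by (simp add: ze cmap_add koszul_d_cmap)
    moreover have "cmap e \<in> kchains_in r a im (Suc (Suc p)) t"
      by (rule cmap_kchains_in[OF ze(2)])
    ultimately show "cmap w \<in> koszul_d ` kchains_in r a im (Suc (Suc p)) t" by blast
  next
    fix w assume w: "w \<in> rel_cycles r' a' ker (Suc p) t"
      "cmap w \<in> koszul_d ` kchains_in r a im (Suc (Suc p)) t"
    then obtain z where z: "z \<in> kchains_in r a im (Suc (Suc p)) t" "cmap w = koszul_d z" by blast
    obtain e where e: "e \<in> kchains r' a' (Suc (Suc p)) t" "cmap e = z" using cmap_lift[OF z(1)] by blast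
    have "w - koszul_d e \<in> kchains r' a' (Suc p) t"
      using w(1) koszul_d_kchains[OF e(1)] c.vs1.subspace_diff[OF subspace_kchains]
      by (auto simp: rel_cycles_def)
    moreover have "cmap (w - koszul_d e) = 0"
      using z e by (simp add: cmap_diff koszul_d_cmap[symmetric])
    ultimately have "w - koszul_d e \<in> kchains_in r' a' ker (Suc p) t"
      by (rule ker_kchains_inI)
    then show "w \<in> rel_boundaries r' a' ker (Suc p) t"
      unfolding rel_boundaries_def using e(1) by (smt (verit) diff_add_cancel mem_Collect_eq)
  next
    fix z assume "z \<in> exact_cycles r a im (Suc p) t"
    then obtain y where y: "y \<in> kchains r a (Suc (Suc p)) t" "z = koszul_d y" "\<forall>T. z T \<in> im"
      by (auto simp: exact_cycles_def)
    then have "z \<in> kchains_in r a im (Suc p) t" by (simp add: kchains_in_def koszul_d_kchains)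
    then obtain e where e: "e \<in> kchains r' a' (Suc p) t" "cmap e = z" using cmap_lift by blast
    have "cmap (koszul_d e) = 0" using e y by (simp add: koszul_d_cmap[symmetric])
    then have "e \<in> rel_cycles r' a' ker (Suc p) t"
      using e ker_chainI[OF koszul_d_kchains[OF e(1)]] by (simp add: rel_cycles_def)
    moreover have "z - cmap e \<in> koszul_d ` kchains_in r a im (Suc (Suc p)) t"
      using e c.vs1.subspace_0[OF subspace_exact_boundaries[OF submod_im]] by simp
    ultimately show "\<exists>e\<in>rel_cycles r' a' ker (Suc p) t. z - cmap e \<in> koszul_d ` kchains_in r a im (Suc (Suc p)) t"
      by blast
  qed
  then show ?thesis unfolding koszul_hdim_connecting[OF submod_im] by (simp add: koszul_hdim_def)
qed

definition const_free_part :: "int \<Rightarrow> (nat \<Rightarrow> ('n, 'k) mpoly) set" where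
  "const_free_part t = {v \<in> free_part r' a' t. \<forall>l. const_coeff (\<phi> v l) = 0}"

lemma const_vec_map: "const_vec (\<phi> v) = const_map r r' D (const_vec v)"
  by (simp add: const_vec_def mat_map_def const_map_def fun_eq_iff const_coeff_sum const_coeff_mult)

lemma subspace_const_free_part: "module.subspace vscale (const_free_part t)"
proof -
  interpret vector_space "vscale :: 'k \<Rightarrow> (nat \<Rightarrow> ('n, 'k) mpoly) \<Rightarrow> _" by (rule vector_space_vscale)
  show ?thesis unfolding subspace_def const_free_part_def
    by (auto simp: free_part_add free_part_vscale map_add map_vscale const_coeff_add vscale_def[of _ "\<phi> _"])
qed

text \<open>
  Both the homology of \<open>F \<otimes> k\<close> and \<open>H\<^sub>1\<close> of the cokernel are quotients of the same space of elements
  \<open>v\<close> such that \<open>\<phi> v\<close> has no constant coefficients.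
\<close>

lemma tensor_hdim_iff:
  assumes D': "graded_map r' a' r'' a'' D'" and ex: "mat_map r' r'' D' ` free_mod r'' = ker"
  shows "has_qdim fscale {c \<in> const_part r' a' t. const_map r r' D c = 0}
      (const_map r' r'' D' ` const_part r'' a'' t) h \<longleftrightarrow> koszul_hdim r a im 1 t h"
proof -
  interpret D': graded_map r' a' r'' a'' D' by (rule D')
  interpret v: vector_space "vscale :: 'k \<Rightarrow> (nat \<Rightarrow> ('n, 'k) mpoly) \<Rightarrow> _" by (rule vector_space_vscale)
  interpret f: vector_space "fscale :: 'k \<Rightarrow> _" by (rule vector_space_fscale)
  \<comment> \<open>The common kernel of the two quotient maps: (x_1, ..., x_n) times the source,
    plus \<open>ker\<close>.\<close>
  define N where "N = {w + z | w z. w \<in> free_part r' a' t \<and> const_vec w = 0 \<and> z \<in> free_part r' a' t \<and> z \<in> ker}"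
  have const_sub: "f.subspace (const_map r' r'' D' ` const_part r'' a'' t)"
  proof -
    have s: "f.subspace (const_part r'' a'' t :: (nat \<Rightarrow> 'k) set)"
      by (auto simp: f.subspace_def const_part_def fscale_def) (metis add_0)+
    have "Vector_Spaces.linear fscale fscale (const_map r' r'' D')"
      by (simp add: Vector_Spaces.linear_iff vector_space_fscale const_map_def fscale_def fun_eq_iff
          distrib_left sum.distrib sum_distrib_left mult.left_commute)
    then interpret l: Vector_Spaces.linear fscale fscale "const_map r' r'' D'" .
    show ?thesis by (rule l.subspace_image[OF s])
  qed
  have const_of: "const_vec v \<in> const_part r a t" if "v \<in> free_part r a t"
    for v :: "nat \<Rightarrow> ('n, 'k) mpoly" and r a
  proof -
    have "j < r \<and> int (a j) = t" if "lookup (v j) 0 \<noteq> 0" for j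
      using free_partD(1)[OF \<open>v \<in> _\<close>, of j] free_partD(2)[OF \<open>v \<in> _\<close> that] that by (cases "j < r") auto
    then show ?thesis by (auto simp: const_part_def const_vec_def const_coeff_def)
  qed
  have lift_const: "(\<lambda>j. Const (c j) :: ('n, 'k) mpoly) \<in> free_part r a t" "const_vec (\<lambda>j. Const (c j) :: ('n, 'k) mpoly) = c"
    if "c \<in> const_part r a t" for c :: "nat \<Rightarrow> 'k" and r a
  proof -
    show "(\<lambda>j. Const (c j) :: ('n, 'k) mpoly) \<in> free_part r a t"
    proof (rule free_partI)
      show "Const (c l) = (0 :: ('n, 'k) mpoly)" if "r \<le> l" for l
      proof -
        have "c l = 0" using \<open>c \<in> const_part r a t\<close> that unfolding const_part_def using not_le by blast
        then show ?thesis by simp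
      qed
      fix l m assume "lookup (Const (c l) :: ('n, 'k) mpoly) m \<noteq> 0"
      then have "m = 0" "c l \<noteq> 0" by (auto simp: Const_def lookup_single when_def split: if_splits)
      then show "int (mdeg m) + int (a l) = t" using that by (auto simp: const_part_def)
    qed
  qed (simp add: const_vec_def)
  \<comment> \<open>First description: reduce v modulo the variables. Exactness at the source
    identifies the constant parts of \<open>ker\<close> with the image of
    \<open>const_map r' r'' D'\<close>.\<close>
  have iff1: "has_qdim vscale (const_free_part t) N h \<longleftrightarrow>
    has_qdim fscale {c \<in> const_part r' a' t. const_map r r' D c = 0} (const_map r' r'' D' ` const_part r'' a'' t) h"
  proof (rule has_qdim_linear_iff[OF linear_const_vec subspace_const_free_part const_sub])
    fix v assume "v \<in> const_free_part t"
    then show "const_vec v \<in> {c \<in> const_part r' a' t. const_map r r' D c = 0}"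
      using const_of[of v] const_vec_map[of v]
      by (auto simp: const_free_part_def) (simp add: const_vec_def fun_eq_iff)
  next
    fix v assume "v \<in> N"
    then obtain w z where wz: "v = w + z" "const_vec w = 0" "z \<in> free_part r' a' t" "z \<in> ker"
      by (auto simp: N_def)
    then obtain u where u: "u \<in> free_part r'' a'' t" "D'.\<phi> u = z"
      using D'.map_lift ex by blast
    have "const_vec v = const_vec z"
      using wz by (simp add: const_vec_def const_coeff_add fun_eq_iff)
    also have "\<dots> = const_map r' r'' D' (const_vec u)"
      using D'.const_vec_map[of u] u by simp
    finally show "const_vec v \<in> const_map r' r'' D' ` const_part r'' a'' t"
      using const_of[OF u(1)] by blast
  next
    fix v assume v: "v \<in> const_free_part t" "const_vec v \<in> const_map r' r'' D' ` const_part r'' a'' t"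
    then obtain c where c: "c \<in> const_part r'' a'' t" "const_vec v = const_map r' r'' D' c" by blast
    define z where "z = D'.\<phi> (\<lambda>j. Const (c j))"
    have z: "z \<in> free_part r' a' t" "z \<in> ker"
      unfolding z_def using D'.map_free_part lift_const(1)[OF c(1)] free_part_free_mod ex by blast+
    have "const_vec z = const_map r' r'' D' c"
      using D'.const_vec_map[of "\<lambda>j. Const (c j)"]
      by (simp add: z_def const_vec_def)
    then have "const_vec (v - z) = 0"
      using c by (simp add: const_vec_def const_coeff_diff fun_eq_iff)
    moreover have "v - z \<in> free_part r' a' t" using v z by (auto simp: const_free_part_def free_part_diff)
    ultimately show "v \<in> N" unfolding N_def using z by (smt (verit) diff_add_cancel mem_Collect_eq)
  next
    fix c assume c: "c \<in> {c \<in> const_part r' a' t. const_map r r' D c = 0}"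
    have "(\<lambda>j. Const (c j)) \<in> const_free_part t"
      using c lift_const const_vec_map[of "\<lambda>j. Const (c j)"]
      by (auto simp: const_free_part_def const_vec_def fun_eq_iff)
    moreover have "c - const_vec (\<lambda>j. Const (c j)) \<in> const_map r' r'' D' ` const_part r'' a'' t"
      using c lift_const(2) f.subspace_0[OF const_sub] by (simp add: const_vec_def)
    ultimately show "\<exists>v\<in>const_free_part t. c - const_vec v \<in> const_map r' r'' D' ` const_part r'' a'' t"
      by blast
  qed
  have lin: "Vector_Spaces.linear vscale cscale (\<lambda>v. vchain (\<phi> v))"
  proof -
    have "vchain (\<phi> (vscale c v)) = cscale c (vchain (\<phi> v))" for c v
      unfolding map_vscale by (auto simp: vchain_def cscale_def vscale_def pscale_def fun_eq_iff)
    then show ?thesis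
      by (auto simp: Vector_Spaces.linear_iff vector_space_vscale vector_space_cscale vchain_def map_add fun_eq_iff)
  qed
  \<comment> \<open>Second description: \<open>\<phi> v\<close> has no constant coefficients, so it
    bounds in the target, and its class is one that the connecting homomorphism hits.\<close>
  have iff2: "has_qdim vscale (const_free_part t) N h \<longleftrightarrow>
    has_qdim cscale (exact_cycles r a im 0 t) (koszul_d ` kchains_in r a im (Suc 0) t) h"
  proof (rule has_qdim_linear_iff[OF lin subspace_const_free_part subspace_exact_boundaries[OF submod_im]])
    fix v assume v: "v \<in> const_free_part t"
    then have v': "v \<in> free_part r' a' t" "const_vec (\<phi> v) = 0"
      by (auto simp: const_free_part_def const_vec_def fun_eq_iff)
    obtain w where "w \<in> kchains r a (Suc 0) t" "koszul_d w = vchain (\<phi> v)"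
      using vchain_boundary[OF map_free_part[OF v'(1)] v'(2)] by blast
    moreover have "vchain (\<phi> v) T \<in> im" for T
      using submodD(2)[OF submod_im] free_part_free_mod[OF v'(1)] by (auto simp: vchain_def)
    ultimately show "vchain (\<phi> v) \<in> exact_cycles r a im 0 t"
      unfolding exact_cycles_def by (intro CollectI conjI allI) (metis image_eqI)
  next
    fix v assume "v \<in> N"
    then obtain w z where wz: "v = w + z" "w \<in> free_part r' a' t" "const_vec w = 0" "z \<in> ker"
      by (auto simp: N_def)
    obtain e where e: "e \<in> kchains r' a' (Suc 0) t" "koszul_d e = vchain w"
      using vchain_boundary[OF wz(2,3)] by blast
    have "vchain (\<phi> v) = cmap (vchain w)"
    proof
      have "\<phi> v = \<phi> w" using wz by (simp add: map_add)
      then show "vchain (\<phi> v) T = cmap (vchain w) T" for T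
        unfolding vchain_def cmap_def by (cases "T = {}") (simp_all only: if_True if_False map_0 simp_thms)
    qed
    also have "\<dots> = koszul_d (cmap e)" by (simp add: koszul_d_cmap e)
    finally show "vchain (\<phi> v) \<in> koszul_d ` kchains_in r a im (Suc 0) t"
      using cmap_kchains_in[OF e(1)] by blast
  next
    fix v assume v: "v \<in> const_free_part t" "vchain (\<phi> v) \<in> koszul_d ` kchains_in r a im (Suc 0) t"
    then obtain z where z: "z \<in> kchains_in r a im (Suc 0) t" "vchain (\<phi> v) = koszul_d z" by blast
    obtain e where e: "e \<in> kchains r' a' (Suc 0) t" "cmap e = z" using cmap_lift[OF z(1)] by blast
    define w where "w = koszul_d e {}"
    have "vchain (\<phi> v) = cmap (koszul_d e)" using z e by (simp add: koszul_d_cmap[symmetric])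
    then have "vchain (\<phi> v) {} = cmap (koszul_d e) {}" by simp
    then have "\<phi> v = \<phi> w" by (simp add: vchain_def cmap_def w_def)
    moreover have w: "w \<in> free_part r' a' t"
      using kchainsD(2)[OF koszul_d_kchains[OF e(1)]] by (simp add: w_def)
    moreover have "const_vec w = 0" using boundary_vchain(2)[OF e(1)] by (simp add: w_def)
    moreover have vw: "v - w \<in> free_part r' a' t" using v w by (auto simp: const_free_part_def free_part_diff)
    moreover have "v - w \<in> ker" using free_part_free_mod[OF vw] \<open>\<phi> v = \<phi> w\<close> by (simp add: map_diff)
    ultimately show "v \<in> N" unfolding N_def by (smt (verit) add.commute diff_add_cancel mem_Collect_eq)
  next
    fix z assume "z \<in> exact_cycles r a im 0 t"
    then obtain y where y: "y \<in> kchains r a (Suc 0) t" "z = koszul_d y" "\<forall>T. z T \<in> im"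
      by (auto simp: exact_cycles_def)
    have zc: "z = vchain (z {})" "const_vec (z {}) = 0" using boundary_vchain[OF y(1)] y(2) by auto
    have "z {} \<in> free_part r a t" using kchainsD(2)[OF koszul_d_kchains[OF y(1)]] y(2) by simp
    then obtain v where v: "v \<in> free_part r' a' t" "\<phi> v = z {}" using map_lift y(3) by blast
    then have "v \<in> const_free_part t" using zc by (auto simp: const_free_part_def const_vec_def fun_eq_iff)
    moreover have "z - vchain (\<phi> v) \<in> koszul_d ` kchains_in r a im (Suc 0) t"
    proof -
      interpret c: vector_space "cscale :: 'k \<Rightarrow> ('n, 'k) chain \<Rightarrow> _" by (rule vector_space_cscale)
      show ?thesis using v zc c.subspace_0[OF subspace_exact_boundaries[OF submod_im]] by simp
    qed
    ultimately show "\<exists>v\<in>const_free_part t. z - vchain (\<phi> v) \<in> koszul_d ` kchains_in r a im (Suc 0) t"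
      by blast
  qed
  show ?thesis using iff1 iff2 koszul_hdim_connecting[OF submod_im, of a 0] by simp
qed

end

section \<open>Free resolutions and Betti numbers\<close>

lemma has_qdim_0_iff: "has_qdim s V W 0 \<longleftrightarrow> V \<subseteq> W"
  by (auto simp: has_qdim_def quotient_family_def)

definition graded_sub :: "(nat \<Rightarrow> nat) \<Rightarrow> (nat \<Rightarrow> ('n::finite, 'k::field) mpoly) set \<Rightarrow> bool" where
  "graded_sub a Z \<longleftrightarrow> (\<forall>v\<in>Z. \<forall>t. component a t v \<in> Z)"

text \<open>A graded piece has finite dimension. Together with a bound on the degrees of generators
  this yields finite generation of submodules, with no appeal to the Hilbert basis theorem.\<close>

lemma finite_spanning_free_part:
  fixes Z :: "(nat \<Rightarrow> ('n::finite, 'k::field) mpoly) set"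
  assumes "Z \<subseteq> free_part r a t"
  shows "\<exists>G. finite G \<and> G \<subseteq> Z \<and> Z \<subseteq> module.span vscale G"
proof -
  interpret vector_space "vscale :: 'k \<Rightarrow> (nat \<Rightarrow> ('n, 'k) mpoly) \<Rightarrow> _" by (rule vector_space_vscale)
  define u :: "nat \<times> ('n \<Rightarrow>\<^sub>0 nat) \<Rightarrow> nat \<Rightarrow> ('n, 'k) mpoly"
    where "u = (\<lambda>(i, m) l. if l = i then single m 1 else 0)"
  define M where "M = {m :: 'n \<Rightarrow>\<^sub>0 nat. mdeg m \<le> nat t}"
  have finM: "finite M" unfolding M_def by (rule finite_mdeg)
  let ?U = "u ` ({..<r} \<times> M)"
  have "v \<in> span ?U" if v: "v \<in> free_part r a t" for v
  proof -
    have "v = (\<Sum>x\<in>{..<r} \<times> M. vscale (lookup (v (fst x)) (snd x)) (u x))"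
    proof
      fix l
      have "(\<Sum>x\<in>{..<r} \<times> M. vscale (lookup (v (fst x)) (snd x)) (u x)) l =
          (\<Sum>i<r. \<Sum>m\<in>M. if l = i then single m (lookup (v l) m) else 0)"
        by (simp add: sum_fun_apply sum.cartesian_product vscale_def u_def pscale_def Const_def
            mult_single case_prod_unfold if_distrib cong: if_cong)
      also have "\<dots> = (\<Sum>i<r. if l = i then \<Sum>m\<in>M. single m (lookup (v l) m) else 0)"
        by (intro sum.cong) auto
      also have "\<dots> = (if l < r then \<Sum>m\<in>M. single m (lookup (v l) m) else 0)" by simp
      also have "(\<Sum>m\<in>M. single m (lookup (v l) m)) = v l"
        using free_partD(2)[OF v, of l] finM by (intro sum_single_keys) (fastforce simp: M_def in_keys_iff)+
      finally show "v l = (\<Sum>x\<in>{..<r} \<times> M. vscale (lookup (v (fst x)) (snd x)) (u x)) l"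
        using free_partD(1)[OF v, of l] by (cases "l < r") auto
    qed
    also have "\<dots> \<in> span ?U" by (intro span_sum span_scale span_base) auto
    finally show ?thesis .
  qed
  then have ZU: "Z \<subseteq> span ?U" using assms by blast
  obtain G where G: "G \<subseteq> Z" "independent G" "Z \<subseteq> span G" using maximal_independent_subset by blast
  have "finite G"
    using independent_span_bound[of ?U G] G ZU finM by auto
  with G show ?thesis by blast
qed

lemma sum_components:
  fixes v :: "nat \<Rightarrow> ('n::finite, 'k::field) mpoly"
  assumes "v \<in> free_mod r"
  shows "\<exists>D. finite D \<and> v = (\<Sum>t\<in>D. component a (int t) v)"
proof -
  define D where "D = (\<Union>l<r. (\<lambda>m. mdeg m + a l) ` keys (v l))"
  have finD: "finite D" by (simp add: D_def)
  have "v = (\<Sum>t\<in>D. component a (int t) v)"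
  proof (intro ext poly_mapping_eqI)
    fix l m
    have "lookup ((\<Sum>t\<in>D. component a (int t) v) l) m = (\<Sum>t\<in>D. if t = mdeg m + a l then lookup (v l) m else 0)"
      unfolding sum_fun_apply lookup_sum by (rule sum.cong) (auto simp: component_def)
    also have "\<dots> = (if mdeg m + a l \<in> D then lookup (v l) m else 0)" using finD by simp
    also have "\<dots> = lookup (v l) m"
    proof (cases "lookup (v l) m = 0")
      case False
      have "v l = 0" if "\<not> l < r" using assms that by (auto simp: free_mod_def)
      then have "l < r" using False by (cases "l < r") simp_all
      then have "mdeg m + a l \<in> D" using False unfolding D_def
        by (intro UN_I[of l] imageI) (simp_all add: in_keys_iff)
      then show ?thesis by simp
    qed simp
    finally show "lookup (v l) m = lookup ((\<Sum>t\<in>D. component a (int t) v) l) m" by simp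
  qed
  with finD show ?thesis by blast
qed

text \<open>
  By the graded Nakayama lemma, vanishing of \<open>H\<^sub>1\<close> of \<open>G/Z\<close> in large degrees bounds the degrees of the
  generators of \<open>Z\<close>.
\<close>

lemma finite_presentation:
  fixes Z :: "(nat \<Rightarrow> ('n::{finite,linorder}, 'k::field) mpoly) set"
  assumes Z: "submod r Z" "graded_sub a Z"
    and bound: "\<And>t. t \<ge> B \<Longrightarrow> koszul_hdim r a Z 1 t 0"
  shows "\<exists>r' a' D. graded_map r a r' a' D \<and> mat_map r r' D ` free_mod r' = Z"
proof -
  interpret v: vector_space "vscale :: 'k \<Rightarrow> (nat \<Rightarrow> ('n, 'k) mpoly) \<Rightarrow> _" by (rule vector_space_vscale)
  \<comment> \<open>From degree \<open>B'\<close> on, the assumed vanishing applies and, since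
    \<open>a l < B'\<close> for all \<open>l < r\<close>, elements have no constant
    coefficients.\<close>
  define B' where "B' = Suc (nat B + (\<Sum>l<r. a l))"
  have "\<exists>G. finite G \<and> G \<subseteq> Z \<inter> free_part r a (int t) \<and> Z \<inter> free_part r a (int t) \<subseteq> v.span G" for t
    by (rule finite_spanning_free_part) auto
  then obtain G where G: "\<And>t. finite (G t)" "\<And>t. G t \<subseteq> Z \<inter> free_part r a (int t)"
    "\<And>t. Z \<inter> free_part r a (int t) \<subseteq> v.span (G t)" by metis
  \<comment> \<open>Generators are paired with their degrees, which become the twists; a vector
    occurring in several degrees is counted separately.\<close>
  define P where "P = (SIGMA t:{..<B'}. G t)"
  define r' where "r' = card P"
  have "finite P" using G by (simp add: P_def)
  then obtain h where h: "bij_betw h {..<r'} P"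
    unfolding r'_def using ex_bij_betw_nat_finite by (metis atLeast0LessThan)
  define D where "D = (\<lambda>l j. snd (h j) l)"
  have hP: "h j \<in> P" if "j < r'" for j using h that by (auto simp: bij_betw_def)
  have snd_h: "snd (h j) \<in> Z" "snd (h j) \<in> free_part r a (int (fst (h j)))" if "j < r'" for j
    using hP[OF that] G(2)[of "fst (h j)"] by (auto simp: P_def)
  interpret graded_map r a r' "\<lambda>j. fst (h j)" D
  proof
    fix l j m assume "l < r" "j < r'" "m \<in> keys (D l j)"
    then show "mdeg m + a l = fst (h j)"
      using free_partD(2)[OF snd_h(2)[of j], of l m] by (simp add: D_def in_keys_iff)
  qed
  have unit: "snd (h j) \<in> im" if j: "j < r'" for j
  proof (rule image_eqI)
    show "(\<lambda>i. if i = j then 1 else 0) \<in> free_mod r'" using j by (simp add: free_mod_def)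
    show "snd (h j) = \<phi> (\<lambda>i. if i = j then 1 else 0)"
    proof
      fix l
      have "snd (h j) l = 0" if "r \<le> l" using free_partD(1)[OF snd_h(2)[OF j] that] .
      moreover have "(\<Sum>i<r'. D l i * (if i = j then 1 else 0)) = D l j"
        using j by (simp add: if_distrib cong: if_cong)
      ultimately show "snd (h j) l = \<phi> (\<lambda>i. if i = j then 1 else 0) l"
        by (simp add: mat_map_def D_def)
    qed
  qed
  have "v.subspace im"
    using submodD[OF submod_im] by (simp add: v.subspace_def)
  have low: "Z \<inter> free_part r a (int t) \<subseteq> im" if "t < B'" for t
  proof -
    have "G t \<subseteq> im"
    proof
      fix g assume "g \<in> G t"
      then have "(t, g) \<in> h ` {..<r'}" using h that by (auto simp: P_def bij_betw_def)
      then obtain j where "j < r'" "h j = (t, g)" by auto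
      then show "g \<in> im" using unit[of j] by simp
    qed
    then have "v.span (G t) \<subseteq> im" using \<open>v.subspace im\<close> by (rule v.span_minimal)
    then show ?thesis using G(3) by blast
  qed
  have all: "Z \<inter> free_part r a (int t) \<subseteq> im" for t
  proof (induction t)
    case 0
    show ?case by (rule low) (simp add: B'_def)
  next
    case (Suc t)
    show ?case
    proof (cases "Suc t < B'")
      case False
      show ?thesis
      proof
        fix z assume z: "z \<in> Z \<inter> free_part r a (int (Suc t))"
        have "const_coeff (z l) = 0" for l
        proof (rule ccontr)
          assume nz: "const_coeff (z l) \<noteq> 0"
          then have "lookup (z l) 0 \<noteq> 0" by (simp add: const_coeff_def)
          with free_partD(2)[of z r a "int (Suc t)" l 0] z have al: "a l = Suc t" by simp
          have "l < r" using nz z free_partD(1)[of z r a "int (Suc t)" l] by (cases "l < r") auto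
          then have "a l \<le> (\<Sum>l<r. a l)" by (intro member_le_sum) auto
          then show False using al False by (simp add: B'_def)
        qed
        then have "const_vec z = 0" by (simp add: const_vec_def fun_eq_iff)
        then obtain w where w: "w \<in> kchains r a (Suc 0) (int (Suc t))" "koszul_d w = vchain z"
          using vchain_boundary z by blast
        \<comment> \<open>\<open>w\<close> is a cycle modulo \<open>Z\<close>, hence up to a
          boundary a chain \<open>y\<close> with coefficients in \<open>Z\<close>. Thus z is a
          combination of products x_j y_j, where the y_j lie in \<open>Z\<close> and have degree one
          less: the induction hypothesis applies to them.\<close>
        have "w \<in> rel_cycles r a Z 1 (int (Suc t))"
          using w z submodD(2)[OF Z(1)] by (auto simp: rel_cycles_def vchain_def)
        moreover have "int (Suc t) \<ge> B" using False by (simp add: B'_def)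
        ultimately have "w \<in> rel_boundaries r a Z 1 (int (Suc t))"
          using bound[of "int (Suc t)"] by (auto simp: koszul_hdim_def has_qdim_0_iff)
        then obtain y e where y: "y \<in> kchains_in r a Z 1 (int (Suc t))" "w = y + koszul_d e"
          by (auto simp: rel_boundaries_def)
        then have "koszul_d y = vchain z" using w by (simp add: koszul_d_add)
        then have "z = koszul_d y {}" by (simp add: vchain_def)
        also have "\<dots> = (\<Sum>j\<in>UNIV. (\<lambda>l. (Const (koszul_sign j {}) * Var j) * y {j} l))"
          by (simp add: fun_eq_iff koszul_d_def sum_fun_apply pscale_def mult.assoc)
        also have "\<dots> \<in> im"
        proof (intro submod_sum[OF submod_im] submodD(4)[OF submod_im])
          fix j
          have "y {j} \<in> Z" "y {j} \<in> free_part r a (int t)"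
            using y(1) kchainsD(2)[of y r a 1 "int (Suc t)" "{j}"] by (auto simp: kchains_in_def)
          then show "y {j} \<in> im" using Suc by blast
        qed
        finally show "z \<in> im" .
      qed
    qed (rule low)
  qed
  have "im = Z"
  proof
    show "im \<subseteq> Z"
    proof
      fix z assume "z \<in> im"
      then obtain x where x: "z = \<phi> x" by blast
      have "z = (\<Sum>j<r'. (\<lambda>l. x j * snd (h j) l))"
      proof
        fix l
        have "snd (h j) l = 0" if "r \<le> l" "j < r'" for j
          using free_partD(1)[OF snd_h(2)[OF that(2)] that(1)] .
        then show "z l = (\<Sum>j<r'. (\<lambda>l. x j * snd (h j) l)) l"
          by (auto simp: x mat_map_def sum_fun_apply D_def mult.commute)
      qed
      also have "\<dots> \<in> Z" using snd_h by (intro submod_sum[OF Z(1)] submodD(4)[OF Z(1)]) auto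
      finally show "z \<in> Z" .
    qed
    show "Z \<subseteq> im"
    proof
      fix z assume z: "z \<in> Z"
      obtain E where E: "finite E" "z = (\<Sum>t\<in>E. component a (int t) z)"
        using sum_components[OF submodD(1)[OF Z(1) z]] by blast
      have "component a (int t) z \<in> im" for t
        using z Z(2) component_free_part[OF submodD(1)[OF Z(1) z]] all[of t] by (auto simp: graded_sub_def)
      then have "(\<Sum>t\<in>E. component a (int t) z) \<in> im" by (intro submod_sum[OF submod_im])
      with E show "z \<in> im" by simp
    qed
  qed
  then show ?thesis using graded_map_axioms by blast
qed

section \<open>Existence of a resolution of finite ranks, and Tor as Koszul homology\<close>

definition ideal_vecs :: "('n, 'k::field) mpoly set \<Rightarrow> (nat \<Rightarrow> ('n, 'k) mpoly) set" where
  "ideal_vecs J = {v. v 0 \<in> J \<and> (\<forall>l\<ge>1. v l = 0)}"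

lemma submod_ideal_vecs: "is_ideal J \<Longrightarrow> submod 1 (ideal_vecs J)"
  by (auto simp: submod_def ideal_vecs_def free_mod_def pol_mod.subspace_0 pol_mod.subspace_add
      pol_mod.subspace_scale)

text \<open>Iterating \<open>finite_presentation\<close> requires a degree bound for each syzygy
  module. A single \<open>B\<close> serves all of them, because shifting trades a syzygy step for an
  exterior degree and keeps the total degree; for this the vanishing must be assumed in every
  exterior degree \<open>Suc p\<close>.\<close>

lemma free_resolution_exists:
  fixes J :: "('n::{finite,linorder}, 'k::field) mpoly set"
  assumes J: "is_ideal J" "\<And>p d. p \<in> J \<Longrightarrow> hpart d p \<in> J"
    and bound: "\<And>t p. t \<ge> B \<Longrightarrow> koszul_hdim 1 (\<lambda>_. 0) (ideal_vecs J) (Suc p) t 0"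
  shows "\<exists>F. graded_free_resolution J F"
proof -
  define ok :: "nat \<times> (nat \<Rightarrow> nat) \<times> (nat \<Rightarrow> ('n, 'k) mpoly) set \<Rightarrow> bool" where
    "ok = (\<lambda>(r, a, Z). submod r Z \<and> graded_sub a Z \<and> (\<forall>t\<ge>B. \<forall>p. koszul_hdim r a Z (Suc p) t 0))"
  define nxt :: "nat \<times> (nat \<Rightarrow> nat) \<times> (nat \<Rightarrow> ('n, 'k) mpoly) set \<Rightarrow>
      nat \<times> (nat \<Rightarrow> nat) \<times> (nat \<Rightarrow> ('n, 'k) mpoly) set \<Rightarrow> (nat \<Rightarrow> nat \<Rightarrow> ('n, 'k) mpoly) \<Rightarrow> bool" where
    "nxt = (\<lambda>(r, a, Z) (r', a', Z') D. graded_map r a r' a' D \<and> mat_map r r' D ` free_mod r' = Z \<and>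
        {v \<in> free_mod r'. mat_map r r' D v = 0} = Z')"
  define s0 where "s0 = (1 :: nat, (\<lambda>_. 0) :: nat \<Rightarrow> nat, ideal_vecs J)"
  have ok0: "ok s0"
  proof -
    have "component (\<lambda>_. 0) t v \<in> ideal_vecs J" if v: "v \<in> ideal_vecs J" for t v
    proof -
      have "component (\<lambda>_. 0) t v 0 = (if t < 0 then 0 else hpart (nat t) (v 0))"
        by (rule poly_mapping_eqI) (auto simp: component_def)
      then show ?thesis using v J pol_mod.subspace_0[OF J(1)] by (auto simp: ideal_vecs_def component_def)
    qed
    then show ?thesis
      using submod_ideal_vecs[OF J(1)] bound by (simp add: ok_def s0_def graded_sub_def)
  qed
  have step: "\<exists>s'. ok s' \<and> (\<exists>D. nxt s s' D)" if s: "ok s" for s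
  proof -
    obtain r a Z where sZ: "s = (r, a, Z)" by (cases s)
    have Z: "submod r Z" "graded_sub a Z" "\<And>t p. t \<ge> B \<Longrightarrow> koszul_hdim r a Z (Suc p) t 0"
      using s by (auto simp: ok_def sZ)
    obtain r' a' D where D: "graded_map r a r' a' D" "mat_map r r' D ` free_mod r' = Z"
      using finite_presentation[OF Z(1,2), of B] Z(3)[of _ 0] by auto
    interpret graded_map r a r' a' D by (rule D(1))
    have "graded_sub a' ker"
      unfolding graded_sub_def
    proof (intro ballI allI)
      fix v t assume v: "v \<in> ker"
      then have "component a' t v \<in> free_mod r'" using free_part_free_mod[OF component_free_part] by blast
      moreover have "\<phi> (component a' t v) = 0"
        unfolding map_component using v by (simp add: component_def fun_eq_iff)
      ultimately show "component a' t v \<in> ker" by blast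
    qed
    moreover have "koszul_hdim r' a' ker (Suc p) t 0" if "t \<ge> B" for t p
      using koszul_hdim_shift[of p t 0] Z(3)[OF that] D(2) by simp
    ultimately have "ok (r', a', ker)" using submod_ker by (simp add: ok_def)
    moreover have "nxt s (r', a', ker) D" using D by (simp add: nxt_def sZ)
    ultimately show ?thesis by blast
  qed
  have "\<exists>f. \<forall>q. (ok (f q) \<and> (q = 0 \<longrightarrow> f q = s0)) \<and> (\<exists>D. nxt (f q) (f (Suc q)) D)"
  proof (rule dependent_nat_choice)
    show "\<exists>s. ok s \<and> (0 = 0 \<longrightarrow> s = s0)" using ok0 by blast
    fix s and q :: nat assume "ok s \<and> (q = 0 \<longrightarrow> s = s0)"
    then show "\<exists>s'. (ok s' \<and> (Suc q = 0 \<longrightarrow> s' = s0)) \<and> (\<exists>D. nxt s s' D)"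
      using step[of s] by simp
  qed
  then obtain f where f: "f 0 = s0" "\<And>q. \<exists>D. nxt (f q) (f (Suc q)) D" by blast
  then obtain D where D: "\<And>q. nxt (f q) (f (Suc q)) (D q)" by metis
  define R where "R = (\<lambda>q. fst (f q))"
  define a where "a = (\<lambda>q. fst (snd (f q)))"
  define Z where "Z = (\<lambda>q. snd (snd (f q)))"
  have fq: "f q = (R q, a q, Z q)" for q by (simp add: R_def a_def Z_def)
  have gm: "graded_map (R q) (a q) (R (Suc q)) (a (Suc q)) (D q)"
    and im: "mat_map (R q) (R (Suc q)) (D q) ` free_mod (R (Suc q)) = Z q"
    and ker: "{v \<in> free_mod (R (Suc q)). mat_map (R q) (R (Suc q)) (D q) v = 0} = Z (Suc q)" for q
    using D[of q] unfolding fq nxt_def by auto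
  have init: "R 0 = 1" "a 0 = (\<lambda>_. 0)" "Z 0 = ideal_vecs J"
    using f(1) by (auto simp: R_def a_def Z_def s0_def)
  \<comment> \<open>Stage 0 of the sequence is R with the submodule \<open>J\<close>. Hence F_q is
    stage q + 1, and the matrix \<open>D 0\<close>, which has a single row, is the
    augmentation.\<close>
  define F where "F = \<lparr>rank = (\<lambda>q. R (Suc q)), twist = (\<lambda>q. a (Suc q)), aug = D 0 0, diff = (\<lambda>q. D (Suc q))\<rparr>"
  have diff_map: "diff_map F q = mat_map (R (Suc q)) (R (Suc (Suc q))) (D (Suc q))" for q
    by (simp add: fun_eq_iff diff_map_def mat_map_def F_def)
  have aug_map: "mat_map (R 0) (R (Suc 0)) (D 0) v = (\<lambda>l. if l = 0 then aug_map F v else 0)" for v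
    by (auto simp: fun_eq_iff aug_map_def mat_map_def F_def init)
  have "graded_free_resolution J F"
    unfolding graded_free_resolution_def
  proof (intro conjI allI impI)
    show "homogeneous (twist F 0 j) (aug F j)" if "j < rank F 0" for j
      using graded_map.deg[OF gm[of 0], of 0 j] that by (auto simp: homogeneous_def F_def init)
    show "\<forall>m\<in>keys (diff F q l j). mdeg m + twist F q l = twist F (Suc q) j"
      if "l < rank F q" "j < rank F (Suc q)" for q l j
      using graded_map.deg[OF gm[of "Suc q"], of l j] that by (auto simp: F_def)
    have rk: "rank F q = R (Suc q)" for q by (simp add: F_def)
    have eq0: "(\<lambda>l. if l = 0 then aug_map F v else 0) = (0 :: nat \<Rightarrow> _) \<longleftrightarrow> aug_map F v = 0" for v
      by (auto simp: fun_eq_iff)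
    show "aug_map F ` free_mod (rank F 0) = J"
    proof -
      have "aug_map F ` free_mod (rank F 0) = (\<lambda>v. v 0) ` (\<lambda>v. \<lambda>l::nat. if l = 0 then aug_map F v else 0) ` free_mod (R (Suc 0))"
        by (simp add: image_image rk)
      also have "\<dots> = (\<lambda>v. v 0) ` ideal_vecs J"
        using im[of 0] unfolding aug_map init(3) by simp
      also have "\<dots> = J"
      proof
        show "J \<subseteq> (\<lambda>v. v 0) ` ideal_vecs J"
        proof
          fix p assume "p \<in> J"
          then show "p \<in> (\<lambda>v. v 0) ` ideal_vecs J"
            by (intro image_eqI[of _ _ "\<lambda>l. if l = 0 then p else 0"]) (auto simp: ideal_vecs_def)
        qed
      qed (auto simp: ideal_vecs_def)
      finally show ?thesis .
    qed
    show "{v \<in> free_mod (rank F 0). aug_map F v = 0} = diff_map F 0 ` free_mod (rank F 1)"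
      using ker[of 0] im[of "Suc 0"] unfolding aug_map eq0 diff_map by (simp add: rk)
    show "{v \<in> free_mod (rank F (Suc q)). diff_map F q v = 0} = diff_map F (Suc q) ` free_mod (rank F (Suc (Suc q)))" for q
      using ker[of "Suc q"] im[of "Suc (Suc q)"] unfolding diff_map by (simp add: rk)
  qed
  then show ?thesis by blast
qed

text \<open>With R prepended as stage 0 the augmentation becomes an ordinary matrix. Shifting then
  leads from R/J to stage q, where \<open>tensor_hdim_iff\<close> applies. Nothing depends on which
  resolution is given.\<close>

lemma tensor_homology_dim:
  fixes J :: "('n::{finite,linorder}, 'k::field) mpoly set"
  assumes J: "is_ideal J" "\<And>p. p \<in> J \<Longrightarrow> const_coeff p = 0"
    and F: "graded_free_resolution J F"
    and h: "koszul_hdim 1 (\<lambda>_. 0) (ideal_vecs J) (Suc q) (int i) h"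
  shows "quotient_dim fscale (cycles_k F q i) (boundaries_k F q i) = h"
proof -
  define R where "R = (\<lambda>q. case q of 0 \<Rightarrow> 1 | Suc q \<Rightarrow> rank F q)"
  define a where "a = (\<lambda>q. case q of 0 \<Rightarrow> (\<lambda>_. 0) | Suc q \<Rightarrow> twist F q)"
  define D where "D = (\<lambda>q. case q of 0 \<Rightarrow> (\<lambda>l. aug F) | Suc q \<Rightarrow> diff F q)"
  have res: "\<forall>j<rank F 0. homogeneous (twist F 0 j) (aug F j)"
    "\<forall>q. \<forall>l<rank F q. \<forall>j<rank F (Suc q). \<forall>m\<in>keys (diff F q l j). mdeg m + twist F q l = twist F (Suc q) j"
    "aug_map F ` free_mod (rank F 0) = J"
    "{v \<in> free_mod (rank F 0). aug_map F v = 0} = diff_map F 0 ` free_mod (rank F 1)"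
    "\<And>q. {v \<in> free_mod (rank F (Suc q)). diff_map F q v = 0} = diff_map F (Suc q) ` free_mod (rank F (Suc (Suc q)))"
    using F unfolding graded_free_resolution_def by auto
  have gm: "graded_map (R q) (a q) (R (Suc q)) (a (Suc q)) (D q)" for q
    using res(1,2) by unfold_locales (auto simp: R_def a_def D_def homogeneous_def split: nat.splits)
  have diff_map: "mat_map (R (Suc q)) (R (Suc (Suc q))) (D (Suc q)) = diff_map F q" for q
    by (simp add: fun_eq_iff diff_map_def mat_map_def R_def D_def)
  have aug_map: "mat_map (R 0) (R (Suc 0)) (D 0) v = (\<lambda>l. if l = 0 then aug_map F v else 0)" for v
    by (auto simp: fun_eq_iff aug_map_def mat_map_def R_def D_def)
  have eq0: "(\<lambda>l. if l = 0 then aug_map F v else 0) = (0 :: nat \<Rightarrow> _) \<longleftrightarrow> aug_map F v = 0" for v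
    by (auto simp: fun_eq_iff)
  have exact: "{v \<in> free_mod (R (Suc q)). mat_map (R q) (R (Suc q)) (D q) v = 0} =
      mat_map (R (Suc q)) (R (Suc (Suc q))) (D (Suc q)) ` free_mod (R (Suc (Suc q)))" for q
  proof (cases q)
    case 0
    show ?thesis using res(4) unfolding 0 aug_map eq0 diff_map by (simp add: R_def)
  next
    case (Suc p)
    show ?thesis using res(5)[of p] unfolding Suc diff_map by (simp add: R_def)
  qed
  define Z where "Z = (\<lambda>q. mat_map (R q) (R (Suc q)) (D q) ` free_mod (R (Suc q)))"
  have Z0: "Z 0 = ideal_vecs J"
  proof
    show "Z 0 \<subseteq> ideal_vecs J" 
      unfolding Z_def aug_map using res(3) by (auto simp: ideal_vecs_def R_def)
    show "ideal_vecs J \<subseteq> Z 0"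
    proof
      fix v assume v: "v \<in> ideal_vecs J"
      then obtain u where u: "u \<in> free_mod (rank F 0)" "aug_map F u = v 0"
        using res(3) unfolding ideal_vecs_def by (metis (no_types, lifting) imageE mem_Collect_eq)
      have "v = (\<lambda>l. if l = 0 then aug_map F u else 0)"
        using v u by (auto simp: fun_eq_iff ideal_vecs_def)
      then show "v \<in> Z 0" using u unfolding Z_def aug_map by (auto simp: R_def)
    qed
  qed
  have shift: "koszul_hdim (R (Suc q)) (a (Suc q)) (Z (Suc q)) (Suc p) t h \<longleftrightarrow>
      koszul_hdim (R q) (a q) (Z q) (Suc (Suc p)) t h" for q p t
    using graded_map.koszul_hdim_shift[OF gm, of q p t h] unfolding exact Z_def .
  have "koszul_hdim (R q) (a q) (Z q) (Suc p) t h \<longleftrightarrow> koszul_hdim (R 0) (a 0) (Z 0) (Suc (q + p)) t h" for p t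
    by (induction q arbitrary: p) (simp_all add: shift)
  from this[of 0] have "koszul_hdim (R q) (a q) (Z q) 1 (int i) h" using h
    by (simp add: Z0) (simp add: R_def a_def)
  then have dim: "has_qdim fscale {c \<in> const_part (R (Suc q)) (a (Suc q)) (int i). const_map (R q) (R (Suc q)) (D q) c = 0}
      (const_map (R (Suc q)) (R (Suc (Suc q))) (D (Suc q)) ` const_part (R (Suc (Suc q))) (a (Suc (Suc q))) (int i)) h"
    using graded_map.tensor_hdim_iff[OF gm gm exact[symmetric], of q "int i" h] by (simp add: Z_def)
  have cp: "const_part (R (Suc q)) (a (Suc q)) (int i) = tensor_k F q i" for q
    by (simp add: const_part_def tensor_k_def R_def a_def)
  have cm: "const_map (R (Suc q)) (R (Suc (Suc q))) (D (Suc q)) = diff_k F q" for q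
    by (simp add: fun_eq_iff const_map_def diff_k_def R_def D_def)
  \<comment> \<open>For q = 0 the augmentation becomes the zero map after tensoring, as elements of
    \<open>J\<close> have no constant term. This agrees with \<open>cycles_k F 0 i\<close> being the
    whole space.\<close>
  have cyc: "{c \<in> tensor_k F q i. const_map (R q) (R (Suc q)) (D q) c = 0} = cycles_k F q i"
  proof (cases q)
    case 0
    have "aug F j \<in> J" if "j < rank F 0" for j
    proof -
      have "aug_map F (\<lambda>l. if l = j then 1 else 0) = aug F j"
        using that by (simp add: aug_map_def if_distrib cong: if_cong)
      moreover have "(\<lambda>l. if l = j then 1 else 0) \<in> free_mod (rank F 0)" using that by (simp add: free_mod_def)
      ultimately show ?thesis using res(3) by (metis image_eqI)
    qed
    then have "const_map (R 0) (R (Suc 0)) (D 0) c = 0" for c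
      using J(2) by (simp add: fun_eq_iff const_map_def R_def D_def)
    then show ?thesis by (simp add: 0)
  next
    case (Suc p)
    show ?thesis by (simp add: Suc cm)
  qed
  interpret vector_space "fscale :: 'k \<Rightarrow> _" by (rule vector_space_fscale)
  have sub: "subspace (tensor_k F q i)" for q
    by (auto simp: subspace_def tensor_k_def fscale_def) (metis add_0)+
  have lin: "Vector_Spaces.linear fscale fscale (diff_k F q)" for q
    by (simp add: Vector_Spaces.linear_iff vector_space_fscale diff_k_def fscale_def fun_eq_iff
        distrib_left sum.distrib sum_distrib_left mult.left_commute)
  have "subspace (boundaries_k F q i)"
    unfolding boundaries_k_def
    using sub[of "Suc q"] module_hom.subspace_image[OF lin[THEN Vector_Spaces.linear.axioms(3), of q]] by blast
  moreover have "subspace (cycles_k F q i)"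
  proof (cases q)
    case 0
    then show ?thesis using sub[of 0] by simp
  next
    case (Suc p)
    interpret l: Vector_Spaces.linear fscale fscale "diff_k F p" by (rule lin)
    show ?thesis using sub[of "Suc p"] unfolding Suc cycles_k.simps subspace_def
      by (auto simp: l.add l.scale)
  qed
  moreover have "has_qdim fscale (cycles_k F q i) (boundaries_k F q i) h"
    using dim unfolding cp cm cyc boundaries_k_def[symmetric] .
  ultimately show ?thesis by (intro has_qdim_quotient_dim[OF vector_space_fscale])
qed

text \<open>The vanishing in large degrees provides some resolution, so that the choice in
  \<open>betti\<close> is meaningful; the value is then the same for every choice.\<close>

theorem betti_eqI:
  fixes J :: "('n::{finite,linorder}, 'k::field) mpoly set"
  assumes J: "is_ideal J" "\<And>p. p \<in> J \<Longrightarrow> const_coeff p = 0" "\<And>p d. p \<in> J \<Longrightarrow> hpart d p \<in> J"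
    and bound: "\<And>t p. t \<ge> B \<Longrightarrow> koszul_hdim 1 (\<lambda>_. 0) (ideal_vecs J) (Suc p) t 0"
    and h: "koszul_hdim 1 (\<lambda>_. 0) (ideal_vecs J) (Suc q) (int i) h"
  shows "betti J q i = h"
proof -
  have "graded_free_resolution J (SOME F. graded_free_resolution J F)"
    using free_resolution_exists[OF J(1,3) bound] by (rule someI_ex)
  from tensor_homology_dim[OF J(1,2) this h] show ?thesis by (simp add: betti_def Let_def)
qed

section \<open>Koszul homology of stable monomial ideals\<close>

definition mon_ideal :: "('n \<Rightarrow>\<^sub>0 nat) set \<Rightarrow> ('n, 'k::field) mpoly set" where
  "mon_ideal S = {p. keys p \<subseteq> S}"

lemma mon_idealI: "(\<And>m. lookup p m \<noteq> 0 \<Longrightarrow> m \<in> S) \<Longrightarrow> p \<in> mon_ideal S"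
  by (auto simp: mon_ideal_def in_keys_iff)

lemma mon_idealD: "p \<in> mon_ideal S \<Longrightarrow> lookup p m \<noteq> 0 \<Longrightarrow> m \<in> S"
  by (auto simp: mon_ideal_def in_keys_iff)

lemma vshift_add: "vshift j (p + q) = vshift j p + vshift j q"
  by (rule poly_mapping_eqI) (simp add: lookup_add)

lemma vshift_0 [simp]: "vshift j 0 = 0"
  by (rule poly_mapping_eqI) simp

lemma vshift_sum: "vshift j (\<Sum>i\<in>A. f i) = (\<Sum>i\<in>A. vshift j (f i))"
  by (induction A rule: infinite_finite_induct) (simp_all add: vshift_add)

lemma vshift_pscale: "vshift j (pscale c p) = pscale c (vshift j p)"
  by (rule poly_mapping_eqI) simp

lemma vshift_Var_same: "vshift j (Var j * p) = p"
  by (rule poly_mapping_eqI) (simp add: lookup_Var_times lookup_add)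

lemma vshift_Var_other:
  fixes p :: "('n, 'k::field) mpoly"
  assumes "i \<noteq> j"
  shows "vshift j (Var i * p) = Var i * vshift j p"
proof (rule poly_mapping_eqI)
  fix m :: "'n \<Rightarrow>\<^sub>0 nat"
  have "m + single j 1 - single i 1 = m - single i 1 + single j 1" if "lookup m i > 0"
    using that assms by (intro poly_mapping_eqI) (auto simp: lookup_add lookup_minus lookup_single when_def)
  moreover have "lookup (m + single j 1) i = lookup m i"
    using assms by (simp add: lookup_add lookup_single)
  ultimately show "lookup (vshift j (Var i * p)) m = lookup (Var i * vshift j p) m"
    by (simp add: lookup_Var_times)
qed

lemma is_ideal_mon_ideal:
  assumes "\<And>u m. m \<in> S \<Longrightarrow> u + m \<in> S"
  shows "is_ideal (mon_ideal S :: ('n, 'k::field) mpoly set)"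
  unfolding pol_mod.subspace_def
proof (intro conjI ballI allI)
  show "0 \<in> (mon_ideal S :: ('n, 'k) mpoly set)" by (simp add: mon_ideal_def)
  fix p :: "('n, 'k) mpoly" assume p: "p \<in> mon_ideal S"
  show "f * p \<in> mon_ideal S" for f
    using p keys_mult[of f p] assms by (fastforce simp: mon_ideal_def)
  fix q :: "('n, 'k) mpoly" assume "q \<in> mon_ideal S"
  with p show "p + q \<in> mon_ideal S" using keys_add[of p q] by (auto simp: mon_ideal_def)
qed

text \<open>The exchange is required only for monomials divisible by the last variable, which is
  weaker than stability in the usual sense and exactly what controls the kernel of x_n. Cofiniteness
  expresses that the quotient is Artinian.\<close>

locale stable_monomials =
  fixes S :: "('n::{finite,linorder} \<Rightarrow>\<^sub>0 nat) set"
  assumes mult_closed: "m \<in> S \<Longrightarrow> u + m \<in> S"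
    and stable: "single (Max UNIV) 1 + m \<in> S \<Longrightarrow> single j 1 + m \<in> S"
    and not_unit: "0 \<notin> S"
    and cofinite: "\<exists>M. \<forall>m. mdeg m \<ge> M \<longrightarrow> m \<in> S"
begin

abbreviation "x\<^sub>n \<equiv> Max UNIV :: 'n"
abbreviation "J \<equiv> mon_ideal S"

lemma is_ideal_J: "is_ideal (J :: ('n, 'k::field) mpoly set)"
  using mult_closed by (rule is_ideal_mon_ideal)

lemma J_closed:
  "(0 :: ('n, 'k) mpoly) \<in> J" "p \<in> J \<Longrightarrow> q \<in> J \<Longrightarrow> p + q \<in> J" "p \<in> J \<Longrightarrow> q \<in> J \<Longrightarrow> p - q \<in> J"
  "p \<in> J \<Longrightarrow> pscale c p \<in> J" "p \<in> J \<Longrightarrow> f * p \<in> J"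
  for p q f :: "('n, 'k::field) mpoly"
  using is_ideal_J[where 'k = 'k] pscale_ideal
  by (auto intro: pol_mod.subspace_0 pol_mod.subspace_add pol_mod.subspace_diff pol_mod.subspace_scale)

lemma J_sum: "(\<And>i. i \<in> A \<Longrightarrow> f i \<in> J) \<Longrightarrow> (\<Sum>i\<in>A. f i) \<in> J"
  for f :: "_ \<Rightarrow> ('n, 'k::field) mpoly"
  by (induction A rule: infinite_finite_induct) (auto intro: J_closed)

abbreviation "JV \<equiv> ideal_vecs J"

lemma JV_iff: "w \<in> kchains 1 a p t \<Longrightarrow> w T \<in> JV \<longleftrightarrow> w T 0 \<in> J"
  using free_partD(1)[OF kchainsD(2), of w 1 a p t] by (auto simp: ideal_vecs_def)

text \<open>Exterior degrees are at most n. In total degree at least M + n all coefficients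
  therefore have degree at least M and lie in \<open>J\<close>.\<close>

lemma koszul_hdim_bounded:
  "\<exists>B. \<forall>t\<ge>B. \<forall>p. koszul_hdim 1 (\<lambda>_. 0) (JV :: (nat \<Rightarrow> ('n, 'k::field) mpoly) set) (Suc p) t 0"
proof -
  obtain M where M: "\<And>m. mdeg m \<ge> M \<Longrightarrow> m \<in> S" using cofinite by blast
  have "koszul_hdim 1 (\<lambda>_. 0) (JV :: (nat \<Rightarrow> ('n, 'k) mpoly) set) (Suc p) t 0"
    if t: "t \<ge> int (M + CARD('n))" for t p
    unfolding koszul_hdim_def has_qdim_0_iff
  proof
    fix w :: "('n, 'k) chain" assume "w \<in> rel_cycles 1 (\<lambda>_. 0) JV (Suc p) t"
    then have w: "w \<in> kchains 1 (\<lambda>_. 0) (Suc p) t" by (simp add: rel_cycles_def)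
    have "w T \<in> JV" for T
      unfolding JV_iff[OF w]
    proof (rule mon_idealI)
      fix m assume m: "lookup (w T 0) m \<noteq> 0"
      then have "card T = Suc p" using kchainsD(1)[OF w, of T] by (cases "card T = Suc p") auto
      then have "Suc p \<le> CARD('n)" by (metis card_mono finite top_greatest)
      moreover have "int (mdeg m) = t - int (Suc p)" using free_partD(2)[OF kchainsD(2)[OF w] m] by simp
      ultimately show "m \<in> S" using t by (intro M) linarith
    qed
    then have "w \<in> kchains_in 1 (\<lambda>_. 0) JV (Suc p) t" using w by (simp add: kchains_in_def)
    moreover have "w = w + koszul_d 0" "(0 :: ('n, 'k) chain) \<in> kchains 1 (\<lambda>_. 0) (Suc (Suc p)) t"
      by (auto intro: kchainsI)
    ultimately show "w \<in> rel_boundaries 1 (\<lambda>_. 0) JV (Suc p) t" unfolding rel_boundaries_def by blast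
  qed
  then show ?thesis by blast
qed

text \<open>By stability a monomial killed by x_n modulo \<open>J\<close> is killed by all
  variables, so these are the socle monomials of degree d - 1. Writing
  \<open>Suc (mdeg v) = d\<close> makes the set empty for d = 0.\<close>

definition socle :: "nat \<Rightarrow> ('n \<Rightarrow>\<^sub>0 nat) set" where
  "socle d = {v. Suc (mdeg v) = d \<and> v \<notin> S \<and> single x\<^sub>n 1 + v \<in> S}"

lemma finite_socle: "finite (socle d)"
  by (rule finite_subset[OF _ finite_mdeg[of d]]) (auto simp: socle_def)

lemma sign_insert_last: "x\<^sub>n \<notin> T \<Longrightarrow> koszul_sign j (insert x\<^sub>n T) = koszul_sign j T"
  using Max_ge[of UNIV j] by (auto simp: koszul_sign_insert not_less)

lemma sign_last: "x\<^sub>n \<notin> T \<Longrightarrow> koszul_sign x\<^sub>n T = (- 1) ^ card T"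
proof -
  assume "x\<^sub>n \<notin> T"
  then have "{l \<in> T. l < x\<^sub>n} = T" by (auto simp: less_le)
  then show ?thesis by (simp add: koszul_sign_def)
qed

lemma koszul_d_split_last:
  assumes "x\<^sub>n \<notin> T"
  shows "koszul_d w T l = pscale (koszul_sign x\<^sub>n T) (Var x\<^sub>n * w (insert x\<^sub>n T) l) +
    (\<Sum>j\<in>-insert x\<^sub>n T. pscale (koszul_sign j T) (Var j * w (insert j T) l))"
proof -
  have "- T = insert x\<^sub>n (- insert x\<^sub>n T)" using assms by auto
  then show ?thesis unfolding koszul_d_def by (simp add: assms)
qed

lemma stable_Var: "Var x\<^sub>n * p \<in> J \<Longrightarrow> Var j * p \<in> J" for p :: "('n, 'k::field) mpoly"
proof (rule mon_idealI)
  fix m assume p: "Var x\<^sub>n * p \<in> J" and "lookup (Var j * p) m \<noteq> 0"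
  then have m: "lookup m j > 0" "lookup p (m - single j 1) \<noteq> 0"
    by (auto simp: lookup_Var_times split: if_splits)
  then have "lookup (Var x\<^sub>n * p) (single x\<^sub>n 1 + (m - single j 1)) \<noteq> 0" by (simp only: lookup_Var_times_add) simp
  from stable[OF mon_idealD[OF p this], of j] show "m \<in> S" by (simp only: single_add_minus[OF m(1)])
qed

lemma Var_vshift: "Var x\<^sub>n * vshift x\<^sub>n p \<in> J" if "p \<in> J" for p :: "('n, 'k::field) mpoly"
proof (rule mon_idealI)
  fix m assume "lookup (Var x\<^sub>n * vshift x\<^sub>n p) m \<noteq> 0"
  then have m: "lookup m x\<^sub>n > 0" "lookup p (m - single x\<^sub>n 1 + single x\<^sub>n 1) \<noteq> 0"
    by (auto simp: lookup_Var_times split: if_splits)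
  then show "m \<in> S" using single_add_minus[OF m(1)] mon_idealD[OF that m(2)] by (simp add: add.commute)
qed

text \<open>
  Dividing the components of a boundary without \<open>e\<^sub>n\<close> by \<open>x\<^sub>n\<close> expresses the components with \<open>e\<^sub>n\<close> of
  the bounding chain, up to \<open>J\<close>, as a boundary in the other variables.
\<close>

lemma boundary_last_component:
  fixes w :: "('n, 'k::field) chain"
  assumes w: "w \<in> rel_boundaries 1 a JV (Suc i) t" and w0: "\<And>T. x\<^sub>n \<notin> T \<Longrightarrow> w T = 0"
    and T: "x\<^sub>n \<notin> T" "card T = i"
  shows "w (insert x\<^sub>n T) 0 \<in> J"
proof -
  obtain z e where z: "z \<in> kchains_in 1 a JV (Suc i) t" and we: "w = z + koszul_d e"
    using w by (auto simp: rel_boundaries_def)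
  have zJ: "z T' 0 \<in> J" for T' using z by (auto simp: kchains_in_def ideal_vecs_def)
  \<comment> \<open>The components of the bounding chain without e_n, divided by x_n.\<close>
  define th :: "('n, 'k) chain" where "th = (\<lambda>U l. if x\<^sub>n \<in> U then 0 else vshift x\<^sub>n (e U l))"
  have th: "koszul_d th T' l = (\<Sum>j\<in>-insert x\<^sub>n T'. pscale (koszul_sign j T') (Var j * vshift x\<^sub>n (e (insert j T') l)))"
    if "x\<^sub>n \<notin> T'" for T' l
    unfolding koszul_d_split_last[OF that] using that by (auto simp: th_def pscale_def intro!: sum.cong split: if_splits)
  \<comment> \<open>The component of \<open>w\<close> at \<open>T'\<close> vanishes. Dividing this
    equation by x_n isolates the component of \<open>e\<close> at
    \<open>insert x\<^sub>n T'\<close>.\<close>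
  have e_last: "e (insert x\<^sub>n T') 0 = pscale (- ((- 1) ^ card T')) (vshift x\<^sub>n (z T' 0) + koszul_d th T' 0)"
    if T': "x\<^sub>n \<notin> T'" for T'
  proof -
    let ?s = "(- 1) ^ card T' :: 'k"
    have "0 = vshift x\<^sub>n (w T' 0)" by (simp add: w0[OF T'])
    also have "\<dots> = vshift x\<^sub>n (z T' 0) + vshift x\<^sub>n (koszul_d e T' 0)" by (simp add: we vshift_add)
    also have "vshift x\<^sub>n (koszul_d e T' 0) = pscale ?s (e (insert x\<^sub>n T') 0) + koszul_d th T' 0"
      unfolding koszul_d_split_last[OF T', of e] th[OF T'] vshift_add vshift_sum vshift_pscale vshift_Var_same
        sign_last[OF T'] by (auto intro!: arg_cong2[where f = "(+)"] sum.cong simp: vshift_Var_other)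
    finally have "pscale ?s (e (insert x\<^sub>n T') 0) = - (vshift x\<^sub>n (z T' 0) + koszul_d th T' 0)"
      by (simp add: eq_neg_iff_add_eq_0 algebra_simps)
    moreover have "pscale ?s (- q) = pscale (- ?s) q" for q :: "('n, 'k) mpoly"
      by (simp add: pscale_def Const_def single_uminus)
    ultimately have "pscale ?s (pscale ?s (e (insert x\<^sub>n T') 0)) = pscale (- ?s) (vshift x\<^sub>n (z T' 0) + koszul_d th T' 0)"
      by (simp only:)
    moreover have "?s * ?s = 1" by (simp flip: power_mult_distrib)
    ultimately show ?thesis by (simp add: pscale_def flip: Const_mult mult.assoc)
  qed
  have jT: "x\<^sub>n \<notin> insert j T" "card (insert j T) = Suc i" if "j \<in> -insert x\<^sub>n T" for j
    using that T by auto
  let ?c = "- ((- 1) ^ Suc i) :: 'k"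
  have "w (insert x\<^sub>n T) 0 = z (insert x\<^sub>n T) 0 + (\<Sum>j\<in>-insert x\<^sub>n T. pscale (koszul_sign j T) (Var j * e (insert x\<^sub>n (insert j T)) 0))"
    by (simp add: we koszul_d_def sign_insert_last[OF T(1)] insert_commute)
  also have "(\<Sum>j\<in>-insert x\<^sub>n T. pscale (koszul_sign j T) (Var j * e (insert x\<^sub>n (insert j T)) 0)) =
      (\<Sum>j\<in>-insert x\<^sub>n T. pscale ?c (pscale (koszul_sign j T) (Var j * vshift x\<^sub>n (z (insert j T) 0))) +
        pscale ?c (pscale (koszul_sign j T) (Var j * koszul_d th (insert j T) 0)))"
  proof (rule sum.cong)
    fix j assume "j \<in> -insert x\<^sub>n T"
    show "pscale (koszul_sign j T) (Var j * e (insert x\<^sub>n (insert j T)) 0) =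
      pscale ?c (pscale (koszul_sign j T) (Var j * vshift x\<^sub>n (z (insert j T) 0))) +
      pscale ?c (pscale (koszul_sign j T) (Var j * koszul_d th (insert j T) 0))"
      unfolding e_last[OF jT(1)[OF \<open>j \<in> _\<close>]] jT(2)[OF \<open>j \<in> _\<close>]
      by (simp add: pscale_def algebra_simps)
  qed simp
  also have "\<dots> = (\<Sum>j\<in>-insert x\<^sub>n T. pscale ?c (pscale (koszul_sign j T) (Var j * vshift x\<^sub>n (z (insert j T) 0)))) +
      pscale ?c (\<Sum>j\<in>-insert x\<^sub>n T. pscale (koszul_sign j T) (Var j * koszul_d th (insert j T) 0))"
    by (simp add: sum.distrib pscale_def sum_distrib_left)
  \<comment> \<open>The terms from \<open>th\<close> form the differential applied twice; the
    component containing e_n contributes nothing, because \<open>th\<close> vanishes on sets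
    containing the last index.\<close>
  also have "(\<Sum>j\<in>-insert x\<^sub>n T. pscale (koszul_sign j T) (Var j * koszul_d th (insert j T) 0)) = 0"
  proof -
    have "koszul_d th (insert x\<^sub>n T) 0 = 0"
      unfolding koszul_d_def by (rule sum.neutral) (simp add: th_def pscale_def)
    moreover have "koszul_d (koszul_d th) T 0 = 0" by simp
    ultimately show ?thesis unfolding koszul_d_split_last[OF T(1), of "koszul_d th"] by (simp add: pscale_def)
  qed
  finally have "w (insert x\<^sub>n T) 0 = z (insert x\<^sub>n T) 0 +
      (\<Sum>j\<in>-insert x\<^sub>n T. pscale ?c (pscale (koszul_sign j T) (Var j * vshift x\<^sub>n (z (insert j T) 0))))"
    by (simp add: pscale_def)
  \<comment> \<open>What remains are multiples of x_j times a quotient of an element of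
    \<open>J\<close> by x_n. The quotient times x_n lies in \<open>J\<close>, hence by stability so
    does the quotient times x_j.\<close>
  then show ?thesis
    using zJ by (auto intro!: J_closed J_sum stable_Var Var_vshift simp del: power_Suc)
qed

text \<open>A cycle modulo \<open>J\<close> whenever \<open>v\<close> is a socle monomial, since all
  variables kill \<open>v\<close>.\<close>

definition socle_cycle :: "'n set \<times> ('n \<Rightarrow>\<^sub>0 nat) \<Rightarrow> ('n, 'k::field) chain" where
  "socle_cycle = (\<lambda>(T, v) U l. if U = insert x\<^sub>n T \<and> l = 0 then single v 1 else 0)"

text \<open>Both alternatives serve the same step: once multiples of x_n have been removed from the
  components without e_n, the remaining monomials have degree d - 1 and no factor x_n. Either they
  belong to S, or there are no such components because all n indices are used.\<close>

lemma koszul_hdim_stable: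
  assumes "Suc i = CARD('n) \<or> (\<forall>m. Suc (mdeg m) = d \<longrightarrow> lookup m x\<^sub>n = 0 \<longrightarrow> m \<in> S)"
  shows "koszul_hdim 1 (\<lambda>_. 0) (JV :: (nat \<Rightarrow> ('n, 'k::field) mpoly) set) (Suc i) (int (i + d))
    ((CARD('n) - 1 choose i) * card (socle d))"
proof -
  let ?t = "int (i + d)" and ?a = "\<lambda>_. 0 :: nat"
  let ?V = "rel_cycles 1 ?a (JV :: (nat \<Rightarrow> ('n, 'k) mpoly) set) (Suc i) ?t"
  let ?W = "rel_boundaries 1 ?a (JV :: (nat \<Rightarrow> ('n, 'k) mpoly) set) (Suc i) ?t"
  define A where "A = {T. T \<subseteq> - {x\<^sub>n} \<and> card T = i} \<times> socle d"
  have cardA: "card A = (CARD('n) - 1 choose i) * card (socle d)"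
    by (simp add: A_def card_cartesian_product n_subsets Compl_eq_Diff_UNIV)
  have finA: "finite A" by (simp add: A_def finite_socle)
  have A_cases: thesis
    if "x \<in> A" "\<And>T v. x = (T, v) \<Longrightarrow> x\<^sub>n \<notin> T \<Longrightarrow> card T = i \<Longrightarrow> v \<in> socle d \<Longrightarrow> thesis" for x thesis
    using that by (cases x) (auto simp: A_def)
  let ?e = "socle_cycle :: _ \<Rightarrow> ('n, 'k) chain"
  interpret vs: vector_space "cscale :: 'k \<Rightarrow> ('n, 'k) chain \<Rightarrow> _" by (rule vector_space_cscale)
  have e_kchains: "?e x \<in> kchains 1 ?a (Suc i) ?t" if xA: "x \<in> A" for x
  proof -
    obtain T v where x: "x = (T, v)" "x\<^sub>n \<notin> T" "card T = i" "v \<in> socle d"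
      using A_cases[OF xA] .
    have c: "card (insert x\<^sub>n T) = Suc i" using x by simp
    show ?thesis
    proof (rule kchainsI)
      show "?e x U = 0" if "card U \<noteq> Suc i" for U using that c by (auto simp: socle_cycle_def x fun_eq_iff)
      show "?e x U \<in> free_part 1 ?a (?t - int (Suc i))" for U
        using x by (intro free_partI)
          (auto simp: socle_cycle_def socle_def lookup_single when_def split: if_splits)
    qed
  qed
  have lookup_sum_e: "lookup ((\<Sum>x\<in>A. cscale (c x) (?e x)) U l) v =
      (if x\<^sub>n \<in> U \<and> l = 0 \<and> (U - {x\<^sub>n}, v) \<in> A then c (U - {x\<^sub>n}, v) else 0)" for c U l v
  proof -
    have "lookup ((\<Sum>x\<in>A. cscale (c x) (?e x)) U l) v =
        (\<Sum>x\<in>A. if x = (U - {x\<^sub>n}, v) then (if x\<^sub>n \<in> U \<and> l = 0 then c x else 0) else 0)"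
      unfolding sum_fun_apply lookup_sum
    proof (rule sum.cong)
      fix x assume "x \<in> A"
      then obtain T u where x: "x = (T, u)" "x\<^sub>n \<notin> T" by (auto simp: A_def)
      then have "U = insert x\<^sub>n T \<longleftrightarrow> x\<^sub>n \<in> U \<and> T = U - {x\<^sub>n}" by auto
      then show "lookup (cscale (c x) (?e x) U l) v = (if x = (U - {x\<^sub>n}, v) then (if x\<^sub>n \<in> U \<and> l = 0 then c x else 0) else 0)"
        by (auto simp: cscale_def socle_cycle_def x lookup_single when_def)
    qed simp
    then show ?thesis using finA by simp
  qed
  have "quotient_family cscale ?V ?W A ?e"
    unfolding quotient_family_def
  proof (intro conjI ballI allI impI)
    fix x assume xA: "x \<in> A"
    obtain T v where x: "x = (T, v)" "x\<^sub>n \<notin> T" "card T = i" "v \<in> socle d"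
      using A_cases[OF xA] .
    have "koszul_d (?e x) U \<in> JV" for U
      unfolding JV_iff[OF koszul_d_kchains[OF e_kchains[OF xA]]]
    proof (rule mon_idealI)
      fix m assume "lookup (koszul_d (?e x) U 0) m \<noteq> 0"
      then obtain j where "koszul_sign j U *
          (if lookup m j > 0 then lookup (?e x (insert j U) 0) (m - single j 1) else 0) \<noteq> 0"
        unfolding lookup_koszul_d by (rule sum.not_neutral_contains_not_neutral)
      then have m: "lookup m j > 0" "lookup (?e x (insert j U) 0) (m - single j 1) \<noteq> 0"
        by (auto split: if_splits)
      then have "m - single j 1 = v"
        by (auto simp: x socle_cycle_def lookup_single when_def split: if_splits)
      then have "m = single j 1 + v" using single_add_minus[OF m(1)] by simp
      then show "m \<in> S" using stable x(4) by (simp add: socle_def)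
    qed
    then show "?e x \<in> ?V" using e_kchains[OF xA] by (simp add: rel_cycles_def)
  next
    fix c x assume W: "(\<Sum>x\<in>A. cscale (c x) (?e x)) \<in> ?W" and xA: "x \<in> A"
    obtain T v where x: "x = (T, v)" "x\<^sub>n \<notin> T" "card T = i" "v \<in> socle d"
      using A_cases[OF xA] .
    \<comment> \<open>Independence: a boundary supported on sets containing the last index has its
      coefficients in \<open>J\<close>, whereas the monomials \<open>v\<close> are not in
      \<open>S\<close>.\<close>
    have "(\<Sum>x\<in>A. cscale (c x) (?e x)) U = 0" if "x\<^sub>n \<notin> U" for U
      using that by (intro ext poly_mapping_eqI) (simp add: lookup_sum_e)
    from boundary_last_component[OF W this x(2,3)]
    have J: "(\<Sum>x\<in>A. cscale (c x) (?e x)) (insert x\<^sub>n T) 0 \<in> J" .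
    have "lookup ((\<Sum>x\<in>A. cscale (c x) (?e x)) (insert x\<^sub>n T) 0) v = c x"
      using x xA by (simp add: lookup_sum_e)
    then show "c x = 0" using mon_idealD[OF J, of v] x(4) by (auto simp: socle_def)
  next
    fix w assume wV: "w \<in> ?V"
    then have w: "w \<in> kchains 1 ?a (Suc i) ?t" and dw: "\<And>T. koszul_d w T 0 \<in> J"
      by (auto simp: rel_cycles_def ideal_vecs_def)
    \<comment> \<open>Its boundary cancels, in every component of \<open>w\<close> without e_n, the
      monomials divisible by x_n.\<close>
    define e where "e = (\<lambda>U l. if x\<^sub>n \<in> U then
        pscale (koszul_sign x\<^sub>n (U - {x\<^sub>n})) (vshift x\<^sub>n (w (U - {x\<^sub>n}) l)) else 0)"
    have e: "e \<in> kchains 1 ?a (Suc (Suc i)) ?t"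
    proof (rule kchainsI)
      show "e U = 0" if "card U \<noteq> Suc (Suc i)" for U
      proof (cases "x\<^sub>n \<in> U")
        case True
        then have "w (U - {x\<^sub>n}) = 0" using that card_Suc_Diff1[of U x\<^sub>n] by (intro kchainsD(1)[OF w]) auto
        then show ?thesis by (simp add: e_def fun_eq_iff pscale_def)
      qed (simp add: e_def fun_eq_iff)
      show "e U \<in> free_part 1 ?a (?t - int (Suc (Suc i)))" for U
      proof (rule free_partI)
        show "e U l = 0" if "1 \<le> l" for l
        proof -
          have "w (U - {x\<^sub>n}) l = 0" by (rule free_partD(1)[OF kchainsD(2)[OF w] that])
          then show ?thesis by (simp add: e_def pscale_def)
        qed
        fix l m assume "lookup (e U l) m \<noteq> 0"
        then have "lookup (w (U - {x\<^sub>n}) l) (m + single x\<^sub>n 1) \<noteq> 0" by (auto simp: e_def split: if_splits)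
        from free_partD(2)[OF kchainsD(2)[OF w] this]
        show "int (mdeg m) + int (?a l) = ?t - int (Suc (Suc i))" by simp
      qed
    qed
    define w' where "w' = w - koszul_d e"
    have w': "w' \<in> kchains 1 ?a (Suc i) ?t"
      unfolding w'_def by (rule vs.subspace_diff[OF subspace_kchains w koszul_d_kchains[OF e]])
    have dw': "koszul_d w' T 0 \<in> J" for T using dw by (simp add: w'_def koszul_d_diff)
    have w'_J: "w' T 0 \<in> J" if T: "x\<^sub>n \<notin> T" for T
    proof (rule mon_idealI)
      fix m assume m: "lookup (w' T 0) m \<noteq> 0"
      have "koszul_d e T 0 = Var x\<^sub>n * vshift x\<^sub>n (w T 0)"
      proof -
        have "(\<Sum>j\<in>-insert x\<^sub>n T. pscale (koszul_sign j T) (Var j * e (insert j T) 0)) = 0"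
          using T by (intro sum.neutral) (auto simp: e_def pscale_def)
        moreover have "pscale (koszul_sign x\<^sub>n T) (Var x\<^sub>n * e (insert x\<^sub>n T) 0) =
            Const (koszul_sign x\<^sub>n T * koszul_sign x\<^sub>n T) * (Var x\<^sub>n * vshift x\<^sub>n (w T 0))"
          using T unfolding Const_mult by (simp add: e_def pscale_def mult_ac)
        ultimately show ?thesis unfolding koszul_d_split_last[OF T] by simp
      qed
      then have lk: "lookup (w' T 0) m = (if lookup m x\<^sub>n > 0 then 0 else lookup (w T 0) m)"
        using single_add_minus[of m x\<^sub>n]
        by (auto simp: w'_def lookup_minus lookup_Var_times add.commute)
      with m have m': "lookup m x\<^sub>n = 0" "lookup (w T 0) m \<noteq> 0" by (auto split: if_splits)
      have "card T = Suc i" using m'(2) kchainsD(1)[OF w, of T] by (cases "card T = Suc i") auto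
      moreover have "card T < CARD('n)" using T by (intro psubset_card_mono) auto
      moreover have "Suc (mdeg m) = d" using free_partD(2)[OF kchainsD(2)[OF w] m'(2)] by simp
      ultimately show "m \<in> S" using assms m'(1) by auto
    qed
    \<comment> \<open>The components without e_n now lie in \<open>J\<close>, so the cycle condition
      at \<open>T\<close> leaves only the term with x_n.\<close>
    have w'_last: "Var x\<^sub>n * w' (insert x\<^sub>n T) 0 \<in> J" if T: "x\<^sub>n \<notin> T" for T
    proof -
      let ?s = "koszul_sign x\<^sub>n T :: 'k"
      have "(\<Sum>j\<in>-insert x\<^sub>n T. pscale (koszul_sign j T) (Var j * w' (insert j T) 0)) \<in> J"
        using T by (intro J_sum J_closed w'_J) auto
      from J_closed(3)[OF dw'[of T] this]
      have "pscale ?s (Var x\<^sub>n * w' (insert x\<^sub>n T) 0) \<in> J" unfolding koszul_d_split_last[OF T] by simp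
      from J_closed(4)[OF this, of ?s] have "Const (?s * ?s) * (Var x\<^sub>n * w' (insert x\<^sub>n T) 0) \<in> J"
        unfolding Const_mult by (simp add: pscale_def mult.assoc)
      then show ?thesis by simp
    qed
    \<comment> \<open>The coefficients are read off at the socle monomials. Any other monomial of a
      component with e_n lies in \<open>S\<close>, by the previous fact.\<close>
    define c where "c = (\<lambda>(T, v). lookup (w' (insert x\<^sub>n T) 0) v)"
    define z where "z = w' - (\<Sum>x\<in>A. cscale (c x) (?e x))"
    have z: "z \<in> kchains 1 ?a (Suc i) ?t"
      unfolding z_def using e_kchains
      by (intro vs.subspace_diff[OF subspace_kchains w'] vs.subspace_sum[OF subspace_kchains]
          vs.subspace_scale[OF subspace_kchains])
    have "z U \<in> JV" for U
      unfolding JV_iff[OF z]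
    proof (rule mon_idealI)
      fix m assume m: "lookup (z U 0) m \<noteq> 0"
      show "m \<in> S"
      proof (cases "x\<^sub>n \<in> U")
        case False
        then have "lookup (w' U 0) m \<noteq> 0" using m by (simp add: z_def lookup_minus lookup_sum_e)
        then show ?thesis using mon_idealD[OF w'_J[OF False]] by blast
      next
        case True
        show ?thesis
        proof (rule ccontr)
          assume mS: "m \<notin> S"
          have U: "insert x\<^sub>n (U - {x\<^sub>n}) = U" using True by auto
          have lz: "lookup (z U 0) m = (if (U - {x\<^sub>n}, m) \<in> A then 0 else lookup (w' U 0) m)"
            using True by (auto simp: z_def lookup_minus lookup_sum_e c_def insert_absorb)
          with m have nA: "(U - {x\<^sub>n}, m) \<notin> A" and wm: "lookup (w' U 0) m \<noteq> 0" by (auto split: if_splits)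
          have "card U = Suc i" using wm kchainsD(1)[OF w', of U] by (cases "card U = Suc i") auto
          moreover have "Suc (mdeg m) = d" using free_partD(2)[OF kchainsD(2)[OF w'] wm] by simp
          moreover have "single x\<^sub>n 1 + m \<in> S"
            using mon_idealD[OF w'_last[of "U - {x\<^sub>n}"], of "single x\<^sub>n 1 + m"] wm
            by (simp only: U lookup_Var_times_add) simp
          ultimately have "(U - {x\<^sub>n}, m) \<in> A" using mS True by (auto simp: A_def socle_def)
          with nA show False by simp
        qed
      qed
    qed
    then have "z \<in> kchains_in 1 ?a JV (Suc i) ?t" using z by (simp add: kchains_in_def)
    moreover have "w - (\<Sum>x\<in>A. cscale (c x) (?e x)) = z + koszul_d e" by (simp add: z_def w'_def)
    ultimately show "\<exists>c. w - (\<Sum>x\<in>A. cscale (c x) (?e x)) \<in> ?W"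
      unfolding rel_boundaries_def using e by blast
  qed (rule finA)
  from has_qdim_card[OF this] show ?thesis by (simp add: koszul_hdim_def cardA)
qed

text \<open>Tor_i of \<open>J\<close> is Tor_(i+1) of R/\<open>J\<close>, whence the exterior degree
  \<open>Suc i\<close> in the Koszul computation.\<close>

theorem betti_stable:
  assumes "Suc i = CARD('n) \<or> (\<forall>m. Suc (mdeg m) = d \<longrightarrow> lookup m x\<^sub>n = 0 \<longrightarrow> m \<in> S)"
  shows "betti (J :: ('n, 'k::field) mpoly set) i (i + d) = (CARD('n) - 1 choose i) * card (socle d)"
proof -
  obtain B where B: "\<And>t p. t \<ge> B \<Longrightarrow>
      koszul_hdim 1 (\<lambda>_. 0) (JV :: (nat \<Rightarrow> ('n, 'k) mpoly) set) (Suc p) t 0"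
    using koszul_hdim_bounded by blast
  show ?thesis
  proof (rule betti_eqI[OF is_ideal_J _ _ B koszul_hdim_stable[OF assms]])
    show "const_coeff p = 0" if "p \<in> J" for p :: "('n, 'k) mpoly"
      using mon_idealD[OF that] not_unit by (auto simp: const_coeff_def)
    show "hpart d p \<in> J" if "p \<in> J" for p :: "('n, 'k) mpoly" and d
      using that by (auto simp: mon_ideal_def keys_part)
  qed
qed

end

section \<open>Leading monomials\<close>

lemma revlex_irrefl: "\<not> revlex_less m m"
  by (auto simp: revlex_less_def)

lemma revlex_trans:
  assumes "revlex_less m m'" "revlex_less m' m''"
  shows "revlex_less m m''"
proof (cases "mdeg m = mdeg m' \<and> mdeg m' = mdeg m''")
  case True
  then obtain i i' where i: "lookup m i > lookup m' i" "\<And>j. j > i \<Longrightarrow> lookup m j = lookup m' j"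
    and i': "lookup m' i' > lookup m'' i'" "\<And>j. j > i' \<Longrightarrow> lookup m' j = lookup m'' j"
    using assms unfolding revlex_less_def by auto
  have "lookup m (max i i') > lookup m'' (max i i')"
  proof (cases i i' rule: linorder_cases)
    case less
    then show ?thesis using i(2)[OF less] i'(1) less_imp_le[OF less] by (simp add: max_def)
  next
    case greater
    then show ?thesis using i'(2)[OF greater] i(1) greater by (simp add: max_def not_le[symmetric])
  qed (use i i' in auto)
  moreover have "lookup m j = lookup m'' j" if "j > max i i'" for j
    using that i(2)[of j] i'(2)[of j] by simp
  ultimately show ?thesis using True unfolding revlex_less_def by auto
next
  case False
  then show ?thesis using assms unfolding revlex_less_def by auto
qed

lemma revlex_total:
  assumes "m \<noteq> m'"
  shows "revlex_less m m' \<or> revlex_less m' m"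
proof (cases "mdeg m = mdeg m'")
  case True
  define i where "i = Max {i. lookup m i \<noteq> lookup m' i}"
  have ne: "{i. lookup m i \<noteq> lookup m' i} \<noteq> {}" using assms by (auto intro: poly_mapping_eqI)
  have "lookup m i \<noteq> lookup m' i" using Max_in[OF _ ne] by (simp add: i_def)
  moreover have "lookup m j = lookup m' j" if "j > i" for j
  proof (rule ccontr)
    assume "lookup m j \<noteq> lookup m' j"
    then have "j \<le> i" unfolding i_def by (intro Max_ge) auto
    then show False using that by simp
  qed
  ultimately have "lookup m i > lookup m' i \<and> (\<forall>j>i. lookup m j = lookup m' j) \<or>
      lookup m' i > lookup m i \<and> (\<forall>j>i. lookup m' j = lookup m j)" by auto
  then show ?thesis using True unfolding revlex_less_def by metis
qed (auto simp: revlex_less_def)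

lemma revlex_asym: "revlex_less m m' \<Longrightarrow> \<not> revlex_less m' m"
  using revlex_trans revlex_irrefl by blast

lemma revlex_add_left: "revlex_less (u + m) (u + m') \<longleftrightarrow> revlex_less m m'"
  by (simp add: revlex_less_def lookup_add)

text \<open>The feature of the reverse lexicographic order that ties leading monomials to
  multiplication by x_n.\<close>

lemma revlex_last_var:
  fixes m m' :: "'n::{finite,linorder} \<Rightarrow>\<^sub>0 nat"
  assumes "mdeg m = mdeg m'" "lookup m (Max UNIV) > lookup m' (Max UNIV)"
  shows "revlex_less m m'"
  using assms unfolding revlex_less_def by (intro disjI2 conjI exI[of _ "Max UNIV"]) (auto simp: not_less[symmetric])

text \<open>Stated for a general strict total order because it is used for
  \<open>revlex_less\<close> and for its converse.\<close>

lemma finite_strict_max: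
  fixes R :: "'a \<Rightarrow> 'a \<Rightarrow> bool"
  assumes "finite A" "A \<noteq> {}"
    and "\<And>x. \<not> R x x" "\<And>x y z. R x y \<Longrightarrow> R y z \<Longrightarrow> R x z"
      "\<And>x y. x \<noteq> y \<Longrightarrow> R x y \<or> R y x"
  shows "\<exists>x\<in>A. \<forall>y\<in>A. y \<noteq> x \<longrightarrow> R y x"
  using assms(1,2)
proof (induction A rule: finite_ne_induct)
  case (insert a A)
  then obtain x where x: "x \<in> A" "\<forall>y\<in>A. y \<noteq> x \<longrightarrow> R y x" by blast
  show ?case
  proof (cases "R x a")
    case True
    then have "R y a" if "y \<in> A" for y using x that assms(4) by (cases "y = x") auto
    then show ?thesis by blast
  next
    case False
    then have "R a x" using x(1) insert.hyps assms(5)[of a x] by (cases "a = x") auto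
    then show ?thesis using x by blast
  qed
qed auto

lemma revlex_max:
  assumes "finite A" "A \<noteq> {}"
  shows "\<exists>x\<in>A. \<forall>y\<in>A. y \<noteq> x \<longrightarrow> revlex_less y x"
  using assms by (rule finite_strict_max) (fact revlex_irrefl, erule (1) revlex_trans, erule revlex_total)

definition lead :: "('n::{finite,linorder}, 'k::field) mpoly \<Rightarrow> ('n \<Rightarrow>\<^sub>0 nat) \<Rightarrow> bool" where
  "lead p m \<longleftrightarrow> m \<in> keys p \<and> (\<forall>m'\<in>keys p. m' \<noteq> m \<longrightarrow> revlex_less m' m)"

lemma lead_unique: "lead p m \<Longrightarrow> lead p m' \<Longrightarrow> m = m'"
  using revlex_asym[of m m'] unfolding lead_def by metis

lemma lead_exists: "p \<noteq> 0 \<Longrightarrow> \<exists>m. lead p m"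
  using revlex_max[of "keys p"] by (auto simp: lead_def)

lemma init_monom_eq: "lead p m \<Longrightarrow> init_monom p = m"
  unfolding init_monom_def lead_def[symmetric] by (rule the_equality) (auto intro: lead_unique)

lemma lead_coeff_nonzero: "lead p m \<Longrightarrow> lookup p m \<noteq> 0"
  by (simp add: lead_def in_keys_iff)

lemma lead_le: "lead p m \<Longrightarrow> lookup p m' \<noteq> 0 \<Longrightarrow> m' = m \<or> revlex_less m' m"
  by (auto simp: lead_def in_keys_iff)

definition lead_monoms :: "('n::{finite,linorder}, 'k::field) mpoly set \<Rightarrow> ('n \<Rightarrow>\<^sub>0 nat) set" where
  "lead_monoms P = {m. \<exists>p\<in>P. lead p m}"

lemma lead_shift: "lead p m \<Longrightarrow> lead (single u 1 * p) (u + m)"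
proof -
  assume p: "lead p m"
  have "\<exists>v. w = u + v \<and> v \<in> keys p" if w: "w \<in> keys (single u 1 * p)" for w
  proof -
    obtain v where "w = u + v"
      using w lookup_single_times_nonmult[of w u 1 p] by (auto simp: in_keys_iff)
    then show ?thesis using w by (auto simp: in_keys_iff lookup_single_times_add)
  qed
  moreover have "u + m \<in> keys (single u 1 * p)"
    using p by (simp add: lead_def in_keys_iff lookup_single_times_add)
  ultimately show ?thesis using p unfolding lead_def by (metis revlex_add_left)
qed

lemma lead_monoms_add:
  assumes "is_ideal P" "m \<in> lead_monoms P"
  shows "u + m \<in> lead_monoms P"
  using assms lead_shift pol_mod.subspace_scale unfolding lead_monoms_def by blast

lemma init_ideal_eq:
  assumes P: "is_ideal P"
  shows "init_ideal P = mon_ideal (lead_monoms P)"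
proof
  have gens: "{single (init_monom p) 1 | p. p \<in> P \<and> p \<noteq> 0} = (\<lambda>m. single m 1) ` lead_monoms P"
  proof -
    have "init_monom p \<in> lead_monoms P" if "p \<in> P" "p \<noteq> 0" for p
      using lead_exists[OF that(2)] init_monom_eq that(1) by (auto simp: lead_monoms_def)
    moreover have "\<exists>p. m = init_monom p \<and> p \<in> P \<and> p \<noteq> 0" if "m \<in> lead_monoms P" for m
      using that init_monom_eq by (fastforce simp: lead_monoms_def lead_def)
    ultimately show ?thesis by (auto simp: image_iff)
  qed
  have id: "is_ideal (mon_ideal (lead_monoms P))"
    by (intro is_ideal_mon_ideal lead_monoms_add[OF P])
  show "init_ideal P \<subseteq> mon_ideal (lead_monoms P)"
    unfolding init_ideal_def gens by (rule pol_mod.span_minimal[OF _ id]) (auto simp: mon_ideal_def)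
  show "mon_ideal (lead_monoms P) \<subseteq> init_ideal P"
  proof
    fix p :: "('a, 'b) mpoly" assume p: "p \<in> mon_ideal (lead_monoms P)"
    have "p = (\<Sum>m\<in>keys p. Const (lookup p m) * single m 1)"
      by (simp add: Const_def mult_single sum_single_keys)
    also have "\<dots> \<in> init_ideal P"
      unfolding init_ideal_def gens using p
      by (intro pol_mod.span_sum pol_mod.span_scale pol_mod.span_base) (auto simp: mon_ideal_def)
    finally show "p \<in> init_ideal P" .
  qed
qed

text \<open>Among the indices with nonzero coefficient take the one with the largest
  \<open>\<phi> i\<close>; at this position no other row of the combination has an entry.\<close>

lemma triangular_independent:
  fixes M :: "'i \<Rightarrow> 'b \<Rightarrow> 'k::field" and R :: "'b \<Rightarrow> 'b \<Rightarrow> bool"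
  assumes "finite A" "inj_on \<phi> A" "\<And>i. i \<in> A \<Longrightarrow> \<phi> i \<in> E" "\<And>i. i \<in> A \<Longrightarrow> M i (\<phi> i) \<noteq> 0"
    and tri: "\<And>i b. i \<in> A \<Longrightarrow> b \<in> E \<Longrightarrow> M i b \<noteq> 0 \<Longrightarrow> b = \<phi> i \<or> R b (\<phi> i)"
    and ord: "\<And>x. \<not> R x x" "\<And>x y z. R x y \<Longrightarrow> R y z \<Longrightarrow> R x z"
      "\<And>x y. x \<noteq> y \<Longrightarrow> R x y \<or> R y x"
    and c: "\<And>b. b \<in> E \<Longrightarrow> (\<Sum>i\<in>A. c i * M i b) = 0"
  shows "\<forall>i\<in>A. c i = 0"
proof (rule ccontr)
  let ?A = "{i \<in> A. c i \<noteq> 0}"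
  assume "\<not> ?thesis"
  then have "\<phi> ` ?A \<noteq> {}" by blast
  then have "\<exists>x\<in>\<phi> ` ?A. \<forall>y\<in>\<phi> ` ?A. y \<noteq> x \<longrightarrow> R y x"
    using assms(1) by (intro finite_strict_max ord(1,3)) (auto intro: ord(2))
  then obtain i where i: "i \<in> A" "c i \<noteq> 0" "\<And>j. j \<in> ?A \<Longrightarrow> \<phi> j \<noteq> \<phi> i \<Longrightarrow> R (\<phi> j) (\<phi> i)"
    by auto
  have "c j * M j (\<phi> i) = (if j = i then c i * M i (\<phi> i) else 0)" if j: "j \<in> A" for j
  proof (cases "j = i \<or> c j = 0")
    case False
    then have "\<phi> j \<noteq> \<phi> i" using assms(2) i(1) j by (auto dest: inj_onD)
    then have "R (\<phi> j) (\<phi> i)" using i(3)[of j] False j by simp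
    then have "M j (\<phi> i) = 0" using tri[OF j assms(3)[OF i(1)]] \<open>\<phi> j \<noteq> \<phi> i\<close> ord by metis
    then show ?thesis using False by simp
  qed auto
  then have "(\<Sum>j\<in>A. c j * M j (\<phi> i)) = (\<Sum>j\<in>A. if j = i then c i * M i (\<phi> i) else 0)"
    by (intro sum.cong) auto
  also have "\<dots> = c i * M i (\<phi> i)" using assms(1) i(1) by simp
  finally show False using c[OF assms(3)[OF i(1)]] i assms(4) by simp
qed

section \<open>Leading monomials in upper sets, and standard monomials\<close>

definition upset :: "nat \<Rightarrow> ('n::{finite,linorder} \<Rightarrow>\<^sub>0 nat) set \<Rightarrow> bool" where
  "upset d E \<longleftrightarrow> (\<forall>m\<in>E. mdeg m = d \<and> (\<forall>m'. mdeg m' = d \<longrightarrow> revlex_less m m' \<longrightarrow> m' \<in> E))"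

lemma upset_finite: "upset d E \<Longrightarrow> finite E"
  by (rule finite_subset[OF _ finite_mdeg_eq[of d]]) (auto simp: upset_def)

locale graded_ideal =
  fixes P :: "('n::{finite,linorder}, 'k::field) mpoly set"
  assumes ideal: "is_ideal P" and hpart_closed: "p \<in> P \<Longrightarrow> hpart d p \<in> P"
begin

lemma lead_homogeneous:
  assumes "m \<in> lead_monoms P"
  shows "\<exists>p\<in>P. homogeneous (mdeg m) p \<and> lead p m \<and> lookup p m = 1"
proof -
  obtain p where p: "p \<in> P" "lead p m" using assms by (auto simp: lead_monoms_def)
  define q where "q = pscale (inverse (lookup p m)) (hpart (mdeg m) p)"
  have nz: "lookup p m \<noteq> 0" using lead_coeff_nonzero[OF p(2)] .
  have "q \<in> P" unfolding q_def by (rule pscale_ideal[OF ideal hpart_closed[OF p(1)]])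
  moreover have "homogeneous (mdeg m) q"
    unfolding q_def by (intro homogeneous_pscale homogeneous_hpart)
  moreover have "keys q = {v \<in> keys p. mdeg v = mdeg m}"
    using nz by (auto simp: q_def in_keys_iff split: if_splits)
  then have "lead q m" using p(2) by (auto simp: lead_def)
  moreover have "lookup q m = 1" using nz by (simp add: q_def)
  ultimately show ?thesis by blast
qed

text \<open>Otherwise some nontrivial combination vanishes at all leading monomials in
  \<open>E\<close>. If it had any monomial in \<open>E\<close>, its own leading monomial would lie
  in \<open>E\<close> as well, being at least as large: a contradiction. So it vanishes on
  \<open>E\<close>, against independence.\<close>

lemma card_lead_ge:
  assumes E: "upset d E" and "finite A"
    and f: "\<And>i. i \<in> A \<Longrightarrow> f i \<in> P" "\<And>i. i \<in> A \<Longrightarrow> homogeneous d (f i)"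
    and indep: "\<And>c. (\<And>b. b \<in> E \<Longrightarrow> (\<Sum>i\<in>A. c i * lookup (f i) b) = 0) \<Longrightarrow> \<forall>i\<in>A. c i = 0"
  shows "card A \<le> card (lead_monoms P \<inter> E)"
proof (rule ccontr)
  assume "\<not> ?thesis"
  then have "card (lead_monoms P \<inter> E) < card A" by simp
  from homogeneous_system[OF _ \<open>finite A\<close> this, of "\<lambda>i. lookup (f i)"] obtain c
    where c: "\<exists>i\<in>A. c i \<noteq> 0" "\<And>b. b \<in> lead_monoms P \<inter> E \<Longrightarrow> (\<Sum>i\<in>A. c i * lookup (f i) b) = 0"
    using upset_finite[OF E] by auto
  define F where "F = (\<Sum>i\<in>A. pscale (c i) (f i))"
  have lF: "lookup F b = (\<Sum>i\<in>A. c i * lookup (f i) b)" for b by (simp add: F_def lookup_sum)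
  have F: "F \<in> P" unfolding F_def using f ideal by (intro pol_mod.subspace_sum pscale_ideal) auto
  have Fh: "homogeneous d F" unfolding F_def using f by (intro homogeneous_sum homogeneous_pscale) auto
  have "lookup F b = 0" if b: "b \<in> E" for b
  proof (rule ccontr)
    assume nz: "lookup F b \<noteq> 0"
    then have "F \<noteq> 0" by auto
    then obtain m where m: "lead F m" using lead_exists by blast
    have "mdeg m = d" using homogeneousD[OF Fh lead_coeff_nonzero[OF m]] .
    then have "m \<in> E"
      using lead_le[OF m nz] b E unfolding upset_def by blast
    moreover have "m \<in> lead_monoms P" using F m by (auto simp: lead_monoms_def)
    ultimately have "lookup F m = 0" using c(2)[of m] by (simp add: lF)
    with lead_coeff_nonzero[OF m] show False by simp
  qed
  with indep[of c] c(1) show False by (auto simp: lF)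
qed

text \<open>Division algorithm: the largest reducible monomial of \<open>f\<close> is cancelled by a
  form of the ideal. This may create new reducible monomials, but only smaller ones, so the number
  of degree d monomials not exceeding some reducible one drops.\<close>

lemma normal_form:
  assumes "homogeneous d f"
  shows "\<exists>g. homogeneous d g \<and> keys g \<inter> lead_monoms P = {} \<and> f - g \<in> P"
  using assms
proof (induction "card {m. mdeg m = d \<and> (\<exists>k\<in>keys f \<inter> lead_monoms P. m = k \<or> revlex_less m k)}"
    arbitrary: f rule: less_induct)
  case less
  show ?case
  proof (cases "keys f \<inter> lead_monoms P = {}")
    case True
    then show ?thesis using less.prems pol_mod.subspace_0[OF ideal] by (intro exI[of _ f]) auto
  next
    case False
    from revlex_max[OF _ False] obtain k where k: "k \<in> keys f" "k \<in> lead_monoms P"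
      "\<And>y. y \<in> keys f \<inter> lead_monoms P \<Longrightarrow> y \<noteq> k \<Longrightarrow> revlex_less y k" by auto
    obtain p where p: "p \<in> P" "homogeneous (mdeg k) p" "lead p k" "lookup p k = 1"
      using lead_homogeneous[OF k(2)] by blast
    have dk: "mdeg k = d" using k(1) less.prems by (simp add: homogeneous_def)
    define f' where "f' = f - pscale (lookup f k) p"
    have f': "homogeneous d f'"
      unfolding f'_def using less.prems p(2) dk by (intro homogeneous_diff homogeneous_pscale) auto
    have keys_f': "revlex_less y k" if "y \<in> keys f' \<inter> lead_monoms P" for y
    proof -
      have "y \<noteq> k" using that p(4) by (auto simp: f'_def in_keys_iff lookup_minus)
      moreover have "y \<in> keys f \<or> lookup p y \<noteq> 0"
        using that by (auto simp: f'_def in_keys_iff lookup_minus)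
      ultimately show ?thesis using k(3)[of y] lead_le[OF p(3), of y] that by auto
    qed
    have "card {m. mdeg m = d \<and> (\<exists>k\<in>keys f' \<inter> lead_monoms P. m = k \<or> revlex_less m k)} <
        card {m. mdeg m = d \<and> (\<exists>k\<in>keys f \<inter> lead_monoms P. m = k \<or> revlex_less m k)}"
    proof (rule psubset_card_mono)
      show "finite {m. mdeg m = d \<and> (\<exists>k\<in>keys f \<inter> lead_monoms P. m = k \<or> revlex_less m k)}"
        by (rule finite_subset[OF _ finite_mdeg_eq[of d]]) auto
      have "\<not> (\<exists>y\<in>keys f' \<inter> lead_monoms P. k = y \<or> revlex_less k y)"
        using keys_f' revlex_irrefl revlex_asym by blast
      moreover have "revlex_less m k"
        if "y \<in> keys f' \<inter> lead_monoms P" "m = y \<or> revlex_less m y" for m y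
        using keys_f'[OF that(1)] that(2) revlex_trans by blast
      ultimately show "{m. mdeg m = d \<and> (\<exists>k\<in>keys f' \<inter> lead_monoms P. m = k \<or> revlex_less m k)} \<subset>
          {m. mdeg m = d \<and> (\<exists>k\<in>keys f \<inter> lead_monoms P. m = k \<or> revlex_less m k)}"
        using k(1,2) dk by blast
    qed
    from less.hyps[OF this f'] obtain g where g: "homogeneous d g" "keys g \<inter> lead_monoms P = {}" "f' - g \<in> P"
      by blast
    have "f' - g + pscale (lookup f k) p \<in> P"
      using g(3) p(1) ideal by (intro pol_mod.subspace_add pscale_ideal)
    then have "f - g \<in> P" by (simp add: f'_def algebra_simps)
    with g show ?thesis by blast
  qed
qed

text \<open>Macaulay's theorem: the monomials that are not leading monomials form a basis of the
  quotient.\<close>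

lemma has_qdim_lead:
  "has_qdim pscale (hom_comp d) (P \<inter> hom_comp d) (card {m. mdeg m = d \<and> m \<notin> lead_monoms P})"
proof -
  let ?A = "{m. mdeg m = d \<and> m \<notin> lead_monoms P}"
  have fin: "finite ?A" by (rule finite_subset[OF _ finite_mdeg_eq[of d]]) auto
  have sm: "(\<Sum>m\<in>?A. pscale (c m) (single m 1)) = (\<Sum>m\<in>?A. single m (c m))" for c :: "_ \<Rightarrow> 'k"
    by (simp add: pscale_def Const_def mult_single)
  have lsm: "lookup (\<Sum>m\<in>?A. single m (c m)) v = (if v \<in> ?A then c v else 0)" for c :: "_ \<Rightarrow> 'k" and v
  proof -
    have "lookup (\<Sum>m\<in>?A. single m (c m)) v = (\<Sum>m\<in>?A. if m = v then c m else 0)"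
      by (simp add: lookup_sum lookup_single when_def)
    then show ?thesis using fin by simp
  qed
  have "quotient_family pscale (hom_comp d) (P \<inter> hom_comp d) ?A (\<lambda>m. single m (1::'k))"
    unfolding quotient_family_def sm
  proof (intro conjI ballI allI impI)
    show "single m (1::'k) \<in> hom_comp d" if "m \<in> ?A" for m
      using that homogeneous_single[of m "1::'k"] by (simp add: hom_comp_def)
    fix c :: "_ \<Rightarrow> 'k" and m assume c: "(\<Sum>m\<in>?A. single m (c m)) \<in> P \<inter> hom_comp d" and m: "m \<in> ?A"
    show "c m = 0"
    proof (rule ccontr)
      assume "c m \<noteq> 0"
      then have "(\<Sum>m\<in>?A. single m (c m)) \<noteq> 0" using lsm[of c m] m by auto
      then obtain k where k: "lead (\<Sum>m\<in>?A. single m (c m)) k" using lead_exists by blast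
      then have "k \<in> lead_monoms P" using c by (auto simp: lead_monoms_def)
      then show False using lead_coeff_nonzero[OF k] lsm[of c k] by simp
    qed
  next
    fix f :: "('n, 'k) mpoly" assume "f \<in> hom_comp d"
    then obtain g where g: "homogeneous d g" "keys g \<inter> lead_monoms P = {}" "f - g \<in> P"
      using normal_form[of d f] unfolding hom_comp_def by blast
    have "keys g \<subseteq> ?A" using g by (auto simp: homogeneous_def)
    then have eq: "(\<Sum>m\<in>?A. single m (lookup g m)) = g" by (rule sum_single_keys[OF fin])
    have "f - g \<in> P \<inter> hom_comp d"
      using g \<open>f \<in> hom_comp d\<close> by (auto simp: hom_comp_def homogeneous_diff)
    then show "\<exists>c. f - (\<Sum>m\<in>?A. single m (c m)) \<in> P \<inter> hom_comp d"
      by (intro exI[of _ "lookup g"]) (simp only: eq)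
  qed (rule fin)
  from has_qdim_card[OF this] show ?thesis .
qed

lemma hilb_lead: "hilb P d = card {m. mdeg m = d \<and> m \<notin> lead_monoms P}"
  unfolding hilb_def
  by (intro has_qdim_quotient_dim vector_space_pscale subspace_hom_comp subspace_ideal_hom_comp ideal has_qdim_lead)

end

section \<open>Polynomial functions and Zariski open sets\<close>

text \<open>Functions instead of polynomials: only values matter for open sets, and the closure
  properties become pointwise identities.\<close>

definition poly_funs :: "(('i \<Rightarrow> 'k::field) \<Rightarrow> 'k) set" where
  "poly_funs = {f. \<exists>p :: ('i, 'k) mpoly. \<forall>a. f a = mp_eval (\<lambda>c. c) a p}"

lemma poly_funs_const: "(\<lambda>_. c) \<in> poly_funs"
  unfolding poly_funs_def by (intro CollectI exI[of _ "Const c"]) simp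

lemma poly_funs_coord: "(\<lambda>a. a i) \<in> poly_funs"
  unfolding poly_funs_def by (intro CollectI exI[of _ "Var i"]) simp

lemma poly_funs_add:
  assumes "f \<in> poly_funs" "g \<in> poly_funs"
  shows "(\<lambda>a. f a + g a) \<in> poly_funs"
proof -
  obtain p q where "\<And>a. f a = mp_eval (\<lambda>c. c) a p" "\<And>a. g a = mp_eval (\<lambda>c. c) a q"
    using assms by (auto simp: poly_funs_def)
  then show ?thesis
    unfolding poly_funs_def by (intro CollectI exI[of _ "p + q"]) (simp add: eval_id.eval_add)
qed

lemma poly_funs_mult:
  assumes "f \<in> poly_funs" "g \<in> poly_funs"
  shows "(\<lambda>a. f a * g a) \<in> poly_funs"
proof -
  obtain p q where "\<And>a. f a = mp_eval (\<lambda>c. c) a p" "\<And>a. g a = mp_eval (\<lambda>c. c) a q"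
    using assms by (auto simp: poly_funs_def)
  then show ?thesis
    unfolding poly_funs_def by (intro CollectI exI[of _ "p * q"]) (simp add: eval_id.eval_mult)
qed

lemma poly_funs_diff:
  assumes "f \<in> poly_funs" "g \<in> poly_funs"
  shows "(\<lambda>a. f a - g a) \<in> poly_funs"
  using poly_funs_add[OF assms(1) poly_funs_mult[OF poly_funs_const[of "- 1"] assms(2)]] by simp

lemma poly_funs_sum:
  assumes "\<And>i. i \<in> A \<Longrightarrow> f i \<in> poly_funs"
  shows "(\<lambda>a. \<Sum>i\<in>A. f i a) \<in> poly_funs"
  using assms
proof (induction A rule: infinite_finite_induct)
  case (insert x A)
  then have "f x \<in> poly_funs" "(\<lambda>a. \<Sum>i\<in>A. f i a) \<in> poly_funs" by simp_all
  from poly_funs_add[OF this] show ?case using insert.hyps by simp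
qed (simp_all add: poly_funs_const)

lemma poly_funs_prod:
  assumes "\<And>i. i \<in> A \<Longrightarrow> f i \<in> poly_funs"
  shows "(\<lambda>a. \<Prod>i\<in>A. f i a) \<in> poly_funs"
  using assms
proof (induction A rule: infinite_finite_induct)
  case (insert x A)
  then have "f x \<in> poly_funs" "(\<lambda>a. \<Prod>i\<in>A. f i a) \<in> poly_funs" by simp_all
  from poly_funs_mult[OF this] show ?case using insert.hyps by simp
qed (simp_all add: poly_funs_const)

lemma poly_funs_line:
  fixes f :: "('i \<Rightarrow> 'k::field) \<Rightarrow> 'k"
  assumes "f \<in> poly_funs"
  shows "\<exists>q. \<forall>s. poly q s = f (\<lambda>i. a i + s * (b i - a i))"
proof -
  obtain p :: "('i, 'k) mpoly" where p: "\<And>a. f a = mp_eval (\<lambda>c. c) a p" using assms by (auto simp: poly_funs_def)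
  have "\<exists>q. \<forall>s. poly q s = mp_eval (\<lambda>c. c) (\<lambda>i. a i + s * (b i - a i)) p"
  proof (induction p rule: mpoly_induct)
    case (single m c)
    show ?case
      by (rule exI[of _ "smult c (\<Prod>i\<in>keys m. [:a i, b i - a i:] ^ lookup m i)"])
        (simp add: poly_prod mon_eval_def)
  next
    case (add p q)
    then obtain u v where "\<And>s. poly u s = mp_eval (\<lambda>c. c) (\<lambda>i. a i + s * (b i - a i)) p"
      "\<And>s. poly v s = mp_eval (\<lambda>c. c) (\<lambda>i. a i + s * (b i - a i)) q" by blast
    then show ?case by (intro exI[of _ "u + v"]) (simp add: eval_id.eval_add)
  qed
  then show ?thesis using p by simp
qed

lemma poly_nonzero_ex:
  fixes q :: "'k::field_char_0 poly"
  assumes "q \<noteq> 0"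
  shows "\<exists>s. poly q s \<noteq> 0"
  using poly_roots_finite[OF assms] infinite_UNIV_char_0[where 'a = 'k] by (metis (mono_tags) UNIV_eq_I mem_Collect_eq)

text \<open>Irreducibility of affine space: on the line joining \<open>a\<close> and
  \<open>b\<close> both functions become nonzero polynomials in one variable, and their product has
  a nonzero value because k is infinite.\<close>

lemma poly_funs_common_nonzero:
  fixes f g :: "('i \<Rightarrow> 'k::field_char_0) \<Rightarrow> 'k"
  assumes "f \<in> poly_funs" "g \<in> poly_funs" "f a \<noteq> 0" "g b \<noteq> 0"
  shows "\<exists>c. f c \<noteq> 0 \<and> g c \<noteq> 0"
proof -
  obtain q where q: "\<And>s. poly q s = f (\<lambda>i. a i + s * (b i - a i))" using poly_funs_line[OF assms(1)] by blast
  obtain u where u: "\<And>s. poly u s = g (\<lambda>i. a i + s * (b i - a i))" using poly_funs_line[OF assms(2)] by blast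
  have "poly q 0 \<noteq> 0" "poly u 1 \<noteq> 0" using q[of 0] u[of 1] assms by auto
  then have "q * u \<noteq> 0" by auto
  then obtain s where "poly (q * u) s \<noteq> 0" using poly_nonzero_ex by blast
  then show ?thesis using q u by auto
qed

lemma poly_funs_finite_common_nonzero:
  fixes f :: "'j \<Rightarrow> ('i \<Rightarrow> 'k::field_char_0) \<Rightarrow> 'k"
  assumes "finite X" "\<And>x. x \<in> X \<Longrightarrow> f x \<in> poly_funs" "\<And>x. x \<in> X \<Longrightarrow> \<exists>a. f x a \<noteq> 0"
  shows "\<exists>a. (\<Prod>x\<in>X. f x a) \<noteq> 0"
  using assms
proof (induction X)
  case (insert x X)
  obtain b where b: "f x b \<noteq> 0" using insert.prems(2) by blast
  obtain a where a: "(\<Prod>x\<in>X. f x a) \<noteq> 0" using insert.IH insert.prems by blast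
  have "f x \<in> poly_funs" "(\<lambda>a. \<Prod>x\<in>X. f x a) \<in> poly_funs"
    using insert.prems(1) poly_funs_prod[of X f] by simp_all
  from poly_funs_common_nonzero[of "f x" "\<lambda>a. \<Prod>x\<in>X. f x a" b a, OF this b a] obtain c
    where "(\<Prod>x\<in>X. f x c) \<noteq> 0" "f x c \<noteq> 0" by blast
  then show ?case using insert.hyps by (intro exI[of _ c]) simp
qed simp

lemma zariski_open_poly_fun:
  "f \<in> poly_funs \<Longrightarrow> zariski_open {a. f a \<noteq> 0}"
proof -
  assume "f \<in> poly_funs"
  then obtain p where "\<And>a. f a = mp_eval (\<lambda>c. c) a p" by (auto simp: poly_funs_def)
  then show ?thesis unfolding zariski_open_def by (intro exI[of _ "{p}"]) simp
qed

lemma zariski_open_contains: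
  assumes "zariski_open U" "a \<in> U"
  shows "\<exists>f\<in>poly_funs. f a \<noteq> 0 \<and> (\<forall>b. f b \<noteq> 0 \<longrightarrow> b \<in> U)"
proof -
  obtain S where S: "U = {a. \<exists>p\<in>S. mp_eval (\<lambda>c. c) a p \<noteq> 0}" using assms(1) by (auto simp: zariski_open_def)
  then obtain p where "p \<in> S" "mp_eval (\<lambda>c. c) a p \<noteq> 0" using assms(2) by auto
  then show ?thesis using S by (intro bexI[of _ "\<lambda>a. mp_eval (\<lambda>c. c) a p"]) (auto simp: poly_funs_def)
qed

section \<open>Open subsets of the general linear group\<close>

definition mat_of :: "('n \<times> 'n \<Rightarrow> 'k) \<Rightarrow> 'k^'n^'n" where
  "mat_of a = (\<chi> i j. a (i, j))"

definition entries :: "'k^'n^'n \<Rightarrow> 'n \<times> 'n \<Rightarrow> 'k" where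
  "entries g = (\<lambda>(i, j). g $ i $ j)"

lemma mat_of_entries [simp]: "mat_of (entries g) = g"
  by (simp add: mat_of_def entries_def vec_eq_iff)

lemma entries_mat_of [simp]: "entries (mat_of a) = a"
  by (simp add: mat_of_def entries_def fun_eq_iff)

lemma det_poly_fun: "(\<lambda>a. det (mat_of a) :: 'k::field) \<in> poly_funs"
  unfolding det_def mat_of_def
  by (intro poly_funs_sum poly_funs_mult poly_funs_const poly_funs_prod) (simp add: poly_funs_coord)

lemma GL_open_poly_fun: "f \<in> poly_funs \<Longrightarrow> GL_open {g. invertible g \<and> f (entries g) \<noteq> 0}"
  unfolding GL_open_def entries_def using zariski_open_poly_fun by fastforce

text \<open>Multiplication by the determinant turns a piece of an open subset of the general linear
  group into a principal open set of affine space, where irreducibility can be used.\<close>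

lemma GL_open_contains:
  fixes U :: "('k::field_char_0^'n^'n) set"
  assumes "GL_open U" "U \<noteq> {}"
  shows "\<exists>f\<in>poly_funs. \<exists>a. f a \<noteq> 0 \<and> (\<forall>g. f (entries g) \<noteq> 0 \<longrightarrow> g \<in> U)"
proof -
  obtain V where V: "zariski_open V" "U = {g. invertible g \<and> entries g \<in> V}"
    using assms(1) by (auto simp: GL_open_def entries_def)
  then obtain g where g: "invertible g" "entries g \<in> V" using assms(2) by blast
  obtain f where f: "f \<in> poly_funs" "f (entries g) \<noteq> 0" "\<And>b. f b \<noteq> 0 \<Longrightarrow> b \<in> V"
    using zariski_open_contains[OF V(1) g(2)] by blast
  let ?f = "\<lambda>a. f a * det (mat_of a)"
  have nz: "?f (entries g) \<noteq> 0" using f g by (simp add: invertible_det_nz)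
  have U: "h \<in> U" if "?f (entries h) \<noteq> 0" for h
    using that f(3) by (auto simp: V invertible_det_nz)
  show ?thesis
    using nz U by (intro bexI[of _ ?f] exI[of _ "entries g"] poly_funs_mult[OF f(1) det_poly_fun]) auto
qed

lemma coord_change_poly_fun:
  fixes p :: "('n::finite, 'k::field) mpoly"
  shows "(\<lambda>a. lookup (coord_change (mat_of a) p) b) \<in> poly_funs"
proof -
  define ok where "ok = (\<lambda>F :: ('n \<times> 'n \<Rightarrow> 'k) \<Rightarrow> ('n, 'k) mpoly. \<forall>b. (\<lambda>a. lookup (F a) b) \<in> poly_funs)"
  have lin: "ok (\<lambda>a. coord_change (mat_of a) (Var j) * F a)" if F: "ok F" for F j
    unfolding ok_def
  proof
    fix b
    have "lookup (coord_change (mat_of a) (Var j) * F a) b =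
        (\<Sum>i\<in>UNIV. a (i, j) * (if lookup b i > 0 then lookup (F a) (b - single i 1) else 0))" for a
      by (simp add: coord_change_Var sum_distrib_right lookup_sum mult.assoc lookup_Var_times mat_of_def)
    moreover have "(\<lambda>a. \<Sum>i\<in>UNIV. a (i, j) * (if lookup b i > 0 then lookup (F a) (b - single i 1) else 0)) \<in> poly_funs"
    proof (rule poly_funs_sum, rule poly_funs_mult[OF poly_funs_coord])
      show "(\<lambda>a. if lookup b i > 0 then lookup (F a) (b - single i 1) else 0) \<in> poly_funs" for i
        using F poly_funs_const[of 0] by (cases "lookup b i > 0") (simp_all add: ok_def)
    qed
    ultimately show "(\<lambda>a. lookup (coord_change (mat_of a) (Var j) * F a) b) \<in> poly_funs" by simp
  qed
  have pow: "ok (\<lambda>a. coord_change (mat_of a) (Var j) ^ k * F a)" if "ok F" for F j k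
    using that lin by (induction k) (simp_all add: mult.assoc)
  have one: "ok (\<lambda>a. 1)" by (simp add: ok_def poly_funs_const)
  have prods: "ok (\<lambda>a. \<Prod>j\<in>A. coord_change (mat_of a) (Var j) ^ lookup m j)" for A m
    by (induction A rule: infinite_finite_induct) (simp_all add: one pow)
  have mon: "(\<lambda>a :: 'n \<times> 'n \<Rightarrow> 'k. lookup (\<Prod>j\<in>UNIV. coord_change (mat_of a) (Var j) ^ lookup m j) b) \<in> poly_funs" for m
    using prods[of m UNIV] unfolding ok_def by blast
  show ?thesis
  proof (induction p rule: mpoly_induct)
    case (single m c)
    show ?case
      unfolding single_eq_prod[of m c] using poly_funs_mult[OF poly_funs_const[of c] mon[of m]]
      by (simp add: coord_change_mult coord_change_prod coord_change_power)
  qed (simp add: coord_change_add lookup_add poly_funs_add)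
qed

section \<open>Generic coordinates\<close>

lemma graded_ideal_coord_change:
  assumes "homogeneous_ideal I" "invertible g"
  shows "graded_ideal (coord_change g ` I)"
proof
  show "is_ideal (coord_change g ` I)"
    using assms by (intro is_ideal_coord_change is_ideal_of_homogeneous)
  show "hpart d p \<in> coord_change g ` I" if "p \<in> coord_change g ` I" for p d
    using that homogeneous_ideal_hpart[OF assms(1)] by (auto simp: coord_change_hpart)
qed

lemma inj_imp_invertible:
  fixes A :: "'k::field^'n^'n"
  assumes "inj ((*v) A)"
  shows "invertible A"
  using assms by (simp add: invertible_left_inverse matrix_left_invertible_injective)

text \<open>Unlike the infix notation for vectors, this synonym puts no sort constraint on \<open>'n\<close>.\<close>

type_synonym ('k, 'n) sqmat = "'k^'n^'n"

locale artinian_graded =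
  fixes I :: "('n::{finite,linorder}, 'k::field_char_0) mpoly set"
  assumes homog: "homogeneous_ideal I"
    and fin_length: "\<exists>N. \<forall>d\<ge>N. hom_comp d \<subseteq> I"
begin

abbreviation "x\<^sub>n \<equiv> Max UNIV :: 'n"

definition lead_of :: "('k, 'n) sqmat \<Rightarrow> ('n \<Rightarrow>\<^sub>0 nat) set" where
  "lead_of g = lead_monoms (coord_change g ` I)"

text \<open>Maximality is demanded for all upper sets simultaneously and against all of GL_n; that
  some matrix achieves this is part of \<open>generic_open\<close>.\<close>

definition generic :: "('k, 'n) sqmat \<Rightarrow> bool" where
  "generic g \<longleftrightarrow> invertible g \<and>
    (\<forall>d E h. upset d E \<longrightarrow> invertible h \<longrightarrow> card (lead_of h \<inter> E) \<le> card (lead_of g \<inter> E))"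

lemma is_ideal_I: "is_ideal I"
  using homog by (rule is_ideal_of_homogeneous)

lemma lead_of_full:
  assumes g: "invertible g" and "hom_comp (mdeg m) \<subseteq> I"
  shows "m \<in> lead_of g"
proof -
  obtain g' where g': "g' ** g = mat 1" "g ** g' = mat 1" using g invertible_inverse_ex by blast
  have "homogeneous (mdeg m) (coord_change g' (single m (1::'k)))"
    by (intro coord_change_homogeneous homogeneous_single)
  then have "coord_change g' (single m 1) \<in> I" using assms(2) by (auto simp: hom_comp_def)
  then have "coord_change g (coord_change g' (single m 1)) \<in> coord_change g ` I" by blast
  then have "single m 1 \<in> coord_change g ` I" by (simp add: coord_change_inverse[OF g'(2)])
  moreover have "lead (single m (1::'k)) m" by (simp add: lead_def)
  ultimately show ?thesis by (auto simp: lead_of_def lead_monoms_def)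
qed

lemma lead_of_large: "\<exists>N. \<forall>g m. invertible g \<longrightarrow> mdeg m \<ge> N \<longrightarrow> m \<in> lead_of g"
  using fin_length lead_of_full by meson

text \<open>Fix forms of \<open>I\<close> whose images under \<open>g\<^sub>0\<close> lead with the
  monomials counted in \<open>E\<close>, and vary the matrix. Independence of their coefficients on
  \<open>E\<close> persists on an open set, and \<open>card_lead_ge\<close> converts it into a
  count.\<close>

lemma lead_card_semicontinuous:
  assumes g\<^sub>0: "invertible g\<^sub>0" and E: "upset d E"
  shows "\<exists>f\<in>poly_funs. f (entries g\<^sub>0) \<noteq> 0 \<and>
    (\<forall>g. invertible g \<longrightarrow> f (entries g) \<noteq> 0 \<longrightarrow> card (lead_of g\<^sub>0 \<inter> E) \<le> card (lead_of g \<inter> E))"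
proof -
  interpret P: graded_ideal "coord_change g\<^sub>0 ` I" by (rule graded_ideal_coord_change[OF homog g\<^sub>0])
  let ?A = "lead_of g\<^sub>0 \<inter> E"
  have finA: "finite ?A" using upset_finite[OF E] by simp
  have "\<exists>q. q \<in> I \<and> homogeneous d q \<and> lead (coord_change g\<^sub>0 q) w" if w: "w \<in> ?A" for w
  proof -
    obtain p where p: "p \<in> coord_change g\<^sub>0 ` I" "homogeneous (mdeg w) p" "lead p w"
      using P.lead_homogeneous[of w] w by (auto simp: lead_of_def)
    then obtain q where q: "q \<in> I" "p = coord_change g\<^sub>0 q" by blast
    have "mdeg w = d" using w E by (auto simp: upset_def)
    then have "coord_change g\<^sub>0 (hpart d q) = p"
      using q p(2) by (simp add: coord_change_hpart[symmetric] hpart_id)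
    then show ?thesis
      using homogeneous_ideal_hpart[OF homog q(1), of d] homogeneous_hpart p(3) by blast
  qed
  then obtain q where q: "\<And>w. w \<in> ?A \<Longrightarrow> q w \<in> I \<and> homogeneous d (q w) \<and> lead (coord_change g\<^sub>0 (q w)) w"
    by metis
  define M where "M = (\<lambda>a w. lookup (coord_change (mat_of a) (q w)))"
  have "\<exists>f\<in>poly_funs. f (entries g\<^sub>0) \<noteq> 0 \<and> (\<forall>a. f a \<noteq> 0 \<longrightarrow>
           (\<forall>c. (\<forall>b\<in>E. (\<Sum>w\<in>?A. c w * M a w b) = 0) \<longrightarrow> (\<forall>w\<in>?A. c w = 0)))"
  proof (rule independence_is_open[OF poly_funs_const poly_funs_mult poly_funs_diff finA])
    show "(\<lambda>a. M a w b) \<in> poly_funs" for w b unfolding M_def by (rule coord_change_poly_fun)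
    fix c assume c: "\<And>b. b \<in> E \<Longrightarrow> (\<Sum>w\<in>?A. c w * M (entries g\<^sub>0) w b) = 0"
    show "\<forall>w\<in>?A. c w = 0"
    proof (rule triangular_independent[where \<phi> = "\<lambda>w. w" and R = revlex_less and E = E and M = "M (entries g\<^sub>0)"])
      show "M (entries g\<^sub>0) w w \<noteq> 0" if "w \<in> ?A" for w
        using q[OF that] lead_coeff_nonzero by (auto simp: M_def)
      show "b = w \<or> revlex_less b w" if "w \<in> ?A" "M (entries g\<^sub>0) w b \<noteq> 0" for w b
        using q[OF that(1)] that(2) lead_le by (auto simp: M_def)
      show "revlex_less x y \<or> revlex_less y x" if "x \<noteq> y" for x y :: "'n \<Rightarrow>\<^sub>0 nat"
        using that by (rule revlex_total)
    qed (use finA c revlex_irrefl in \<open>auto intro: revlex_trans\<close>)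
  qed auto
  then obtain f where f: "f \<in> poly_funs" "f (entries g\<^sub>0) \<noteq> 0"
    "\<And>a c. f a \<noteq> 0 \<Longrightarrow> (\<forall>b\<in>E. (\<Sum>w\<in>?A. c w * M a w b) = 0) \<Longrightarrow> \<forall>w\<in>?A. c w = 0" by blast
  have "card ?A \<le> card (lead_of g \<inter> E)" if g: "invertible g" "f (entries g) \<noteq> 0" for g
  proof -
    interpret Q: graded_ideal "coord_change g ` I" by (rule graded_ideal_coord_change[OF homog g(1)])
    show ?thesis unfolding lead_of_def[of g]
      by (rule Q.card_lead_ge[OF E finA, of "\<lambda>w. coord_change g (q w)"])
        (use q f(3)[OF g(2)] in \<open>auto simp: M_def intro: coord_change_homogeneous\<close>)
  qed
  with f show ?thesis by blast
qed

text \<open>In degrees from N on every monomial is a leading monomial in all coordinates, so only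
  finitely many upper sets impose a condition, and their polynomials can be multiplied.\<close>

lemma generic_open:
  "\<exists>f\<in>poly_funs. \<exists>g. invertible g \<and> f (entries g) \<noteq> 0 \<and> (\<forall>g. invertible g \<longrightarrow> f (entries g) \<noteq> 0 \<longrightarrow> generic g)"
proof -
  obtain N where N: "\<And>g m. invertible g \<Longrightarrow> mdeg m \<ge> N \<Longrightarrow> m \<in> lead_of g" using lead_of_large by blast
  define X where "X = {E :: ('n \<Rightarrow>\<^sub>0 nat) set. \<exists>d<N. upset d E}"
  have "X \<subseteq> Pow {m. mdeg m \<le> N}" by (auto simp: X_def upset_def)
  then have finX: "finite X" by (rule finite_subset) (simp add: finite_mdeg)
  have inv1: "invertible (mat 1 :: ('k, 'n) sqmat)" by (auto simp: invertible_def)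
  have "\<exists>f\<in>poly_funs. (\<exists>a. f a \<noteq> 0) \<and> (\<forall>g h. invertible g \<longrightarrow> f (entries g) \<noteq> 0 \<longrightarrow> invertible h \<longrightarrow>
      card (lead_of h \<inter> E) \<le> card (lead_of g \<inter> E))" if "E \<in> X" for E
  proof -
    obtain d where d: "upset d E" using \<open>E \<in> X\<close> by (auto simp: X_def)
    have "\<exists>g. invertible g \<and> (\<forall>h. invertible h \<longrightarrow> card (lead_of h \<inter> E) \<le> card (lead_of g \<inter> E))"
    proof (rule ex_has_greatest_nat[where k = "mat 1" and b = "Suc (card E)"])
      show "\<forall>h. invertible h \<longrightarrow> card (lead_of h \<inter> E) < Suc (card E)"
        using upset_finite[OF d] by (auto simp: less_Suc_eq_le intro: card_mono)
    qed (rule inv1)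
    then obtain g\<^sub>0 where g\<^sub>0: "invertible g\<^sub>0" "\<And>h. invertible h \<Longrightarrow> card (lead_of h \<inter> E) \<le> card (lead_of g\<^sub>0 \<inter> E)" by blast
    from lead_card_semicontinuous[OF g\<^sub>0(1) d] obtain f where f: "f \<in> poly_funs" "f (entries g\<^sub>0) \<noteq> 0"
      "\<And>g. invertible g \<Longrightarrow> f (entries g) \<noteq> 0 \<Longrightarrow> card (lead_of g\<^sub>0 \<inter> E) \<le> card (lead_of g \<inter> E)" by blast
    then show ?thesis using g\<^sub>0(2) by (meson order_trans)
  qed
  then obtain f where f: "\<And>E. E \<in> X \<Longrightarrow> f E \<in> poly_funs" "\<And>E. E \<in> X \<Longrightarrow> \<exists>a. f E a \<noteq> 0"
    "\<And>E g h. E \<in> X \<Longrightarrow> invertible g \<Longrightarrow> f E (entries g) \<noteq> 0 \<Longrightarrow> invertible h \<Longrightarrow>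
      card (lead_of h \<inter> E) \<le> card (lead_of g \<inter> E)"
    by metis
  define F where "F = (\<lambda>a. \<Prod>E\<in>X. f E a)"
  have F: "F \<in> poly_funs" unfolding F_def using f(1) by (rule poly_funs_prod)
  have "\<exists>a. F a \<noteq> 0"
    unfolding F_def by (rule poly_funs_finite_common_nonzero[OF finX]) (fact f(1), fact f(2))
  then obtain a where "F a \<noteq> 0" by blast
  moreover have "det (mat_of (entries (mat 1 :: ('k, 'n) sqmat))) \<noteq> 0"
    using inv1 by (simp add: invertible_det_nz)
  ultimately obtain b where b: "F b \<noteq> 0" "det (mat_of b) \<noteq> 0"
    using poly_funs_common_nonzero[OF F det_poly_fun] by blast
  have "generic g" if g: "invertible g" "F (entries g) \<noteq> 0" for g
    unfolding generic_def
  proof (intro conjI allI impI)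
    fix d h and E :: "('n \<Rightarrow>\<^sub>0 nat) set" assume E: "upset d E" and h: "invertible (h :: ('k, 'n) sqmat)"
    show "card (lead_of h \<inter> E) \<le> card (lead_of g \<inter> E)"
    proof (cases "d < N")
      case True
      then have "E \<in> X" using E by (auto simp: X_def)
      then show ?thesis using f(3)[OF _ g(1) _ h] g(2) finX by (auto simp: F_def)
    next
      case False
      then have "E \<subseteq> lead_of g" using N[OF g(1)] E by (auto simp: upset_def)
      then show ?thesis using upset_finite[OF E] by (intro card_mono) auto
    qed
  qed (rule g)
  then show ?thesis using F b by (intro bexI[of _ F] exI[of _ "mat_of b"]) (auto simp: invertible_det_nz)
qed

text \<open>The counts determine the set: m is a leading monomial exactly if the count increases
  from the upper set strictly above m to the one starting at m.\<close>

lemma generic_lead_of_unique: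
  assumes "generic g" "generic h"
  shows "lead_of g = lead_of h"
proof -
  have eq: "card (lead_of g \<inter> E) = card (lead_of h \<inter> E)" if "upset d E" for d E
    using assms that unfolding generic_def by (meson order_antisym)
  have mem: "m \<in> lead_of g \<longleftrightarrow> card (lead_of g \<inter> {m'. mdeg m' = mdeg m \<and> revlex_less m m'}) <
      card (lead_of g \<inter> {m'. mdeg m' = mdeg m \<and> (m' = m \<or> revlex_less m m')})" for g :: "('k, 'n) sqmat" and m
  proof -
    let ?E = "lead_of g \<inter> {m'. mdeg m' = mdeg m \<and> revlex_less m m'}"
    have fin: "finite ?E" by (rule finite_subset[OF _ finite_mdeg_eq[of "mdeg m"]]) auto
    show ?thesis
    proof (cases "m \<in> lead_of g")
      case True
      then have "lead_of g \<inter> {m'. mdeg m' = mdeg m \<and> (m' = m \<or> revlex_less m m')} = insert m ?E" by auto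
      moreover have "m \<notin> ?E" using revlex_irrefl by blast
      ultimately show ?thesis using True fin by (simp only: card_insert_disjoint) simp
    next
      case False
      then have "lead_of g \<inter> {m'. mdeg m' = mdeg m \<and> (m' = m \<or> revlex_less m m')} = ?E" by auto
      then show ?thesis using False by simp
    qed
  qed
  have u1: "upset (mdeg m) {m'. mdeg m' = mdeg m \<and> revlex_less m m'}"
    and u2: "upset (mdeg m) {m'. mdeg m' = mdeg m \<and> (m' = m \<or> revlex_less m m')}" for m :: "'n \<Rightarrow>\<^sub>0 nat"
    unfolding upset_def using revlex_trans by blast+
  show ?thesis
    using mem[of _ g] mem[of _ h] eq[OF u1] eq[OF u2] by (intro set_eqI) simp
qed

text \<open>Any other open set with a constant initial ideal contains a generic matrix, since its
  polynomial, that of the generic set and the determinant have a common nonzero.\<close>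

lemma gin_eq:
  assumes "generic g"
  shows "gin I = mon_ideal (lead_of g)"
proof -
  have init: "init_ideal (coord_change h ` I) = mon_ideal (lead_of g)" if "generic h" for h
    using that generic_lead_of_unique[OF assms that] init_ideal_eq is_ideal_coord_change is_ideal_I
    by (auto simp: generic_def lead_of_def)
  obtain f g\<^sub>1 where f: "f \<in> poly_funs" "invertible g\<^sub>1" "f (entries g\<^sub>1) \<noteq> 0"
    "\<And>g. invertible g \<Longrightarrow> f (entries g) \<noteq> 0 \<Longrightarrow> generic g" using generic_open by blast
  let ?U = "{g. invertible g \<and> f (entries g) \<noteq> 0}"
  show ?thesis unfolding gin_def
  proof (rule the_equality)
    show "\<exists>U. GL_open U \<and> U \<noteq> {} \<and> (\<forall>h\<in>U. init_ideal (coord_change h ` I) = mon_ideal (lead_of g))"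
      using GL_open_poly_fun[OF f(1)] f(2,3) init f(4) by (intro exI[of _ ?U]) auto
    fix J assume "\<exists>U. GL_open U \<and> U \<noteq> {} \<and> (\<forall>h\<in>U. init_ideal (coord_change h ` I) = J)"
    then obtain U where U: "GL_open U" "U \<noteq> {}" "\<And>h. h \<in> U \<Longrightarrow> init_ideal (coord_change h ` I) = J" by blast
    obtain f' a where f': "f' \<in> poly_funs" "f' a \<noteq> 0" "\<And>g. f' (entries g) \<noteq> 0 \<Longrightarrow> g \<in> U"
      using GL_open_contains[OF U(1,2)] by blast
    have "det (mat_of (entries g\<^sub>1)) \<noteq> 0" using f(2) by (simp add: invertible_det_nz)
    then have "f (entries g\<^sub>1) * det (mat_of (entries g\<^sub>1)) \<noteq> 0" using f(3) by simp
    then obtain c where c: "f c * det (mat_of c) \<noteq> 0" "f' c \<noteq> 0"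
      using poly_funs_common_nonzero[OF poly_funs_mult[OF f(1) det_poly_fun] f'(1)] f'(2) by blast
    have "mat_of c \<in> U" using f'(3)[of "mat_of c"] c by simp
    moreover have "generic (mat_of c)" using f(4)[of "mat_of c"] c by (simp add: invertible_det_nz)
    ultimately show "J = mon_ideal (lead_of g)" using U(3) init by metis
  qed
qed

end

section \<open>Stability of the generic initial ideal\<close>

text \<open>Reads the exponents as digits in base d + 1, the last variable being the most
  significant. On monomials of degree d this integer weight reverses the reverse lexicographic
  order, so a one-parameter torus can degenerate to leading terms.\<close>

definition weight :: "nat \<Rightarrow> ('n::{finite,linorder} \<Rightarrow>\<^sub>0 nat) \<Rightarrow> nat" where
  "weight d m = (\<Sum>i\<in>UNIV. lookup m i * Suc d ^ card {..<i})"

text \<open>At the last index where they differ, \<open>v\<close> exceeds \<open>w\<close> by at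
  least one unit, and the lower digits of \<open>w\<close> together are worth less than this
  unit.\<close>

lemma weight_revlex:
  fixes v w :: "'n::{finite,linorder} \<Rightarrow>\<^sub>0 nat"
  assumes "mdeg v = d" "mdeg w = d" "revlex_less v w"
  shows "weight d w < weight d v"
proof -
  obtain i where i: "lookup v i > lookup w i" "\<And>j. j > i \<Longrightarrow> lookup v j = lookup w j"
    using assms unfolding revlex_less_def by auto
  let ?o = "\<lambda>i. Suc d ^ card {..<i :: 'n}"
  have split: "weight d m = (\<Sum>l\<in>{..<i}. lookup m l * ?o l) + lookup m i * ?o i + (\<Sum>l\<in>{i<..}. lookup m l * ?o l)" for m
  proof -
    have U: "UNIV = insert i ({..<i} \<union> {i<..})" by auto
    have "weight d m = (\<Sum>l\<in>insert i ({..<i} \<union> {i<..}). lookup m l * ?o l)" by (simp only: weight_def flip: U)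
    moreover have "{..<i} \<inter> {i<..} = {}" by auto
    ultimately show ?thesis by (simp add: sum.union_disjoint)
  qed
  have "Suc d * (\<Sum>l\<in>{..<i}. lookup w l * ?o l) = (\<Sum>l\<in>{..<i}. lookup w l * Suc d ^ Suc (card {..<l}))"
    by (simp add: sum_distrib_left algebra_simps del: mult_Suc)
  also have "\<dots> \<le> (\<Sum>l\<in>{..<i}. lookup w l * ?o i)"
  proof (rule sum_mono)
    fix l assume "l \<in> {..<i}"
    then have "card {..<l} < card {..<i}" by (intro psubset_card_mono) auto
    then show "lookup w l * Suc d ^ Suc (card {..<l}) \<le> lookup w l * ?o i"
      by (intro mult_left_mono power_increasing) auto
  qed
  also have "\<dots> = (\<Sum>l\<in>{..<i}. lookup w l) * ?o i" by (simp add: sum_distrib_right)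
  also have "\<dots> \<le> mdeg w * ?o i" unfolding mdeg_def by (intro mult_right_mono sum_mono2) auto
  also have "\<dots> < Suc d * ?o i" using assms(2) by simp
  finally have "(\<Sum>l\<in>{..<i}. lookup w l * ?o l) < ?o i" by (simp only: mult_less_cancel1)
  moreover have "(\<Sum>l\<in>{i<..}. lookup w l * ?o l) = (\<Sum>l\<in>{i<..}. lookup v l * ?o l)"
    using i(2) by (intro sum.cong) auto
  moreover have "lookup w i * ?o i + ?o i \<le> lookup v i * ?o i"
  proof -
    have "Suc (lookup w i) * ?o i \<le> lookup v i * ?o i" using i(1) by (intro mult_right_mono) auto
    then show ?thesis by simp
  qed
  ultimately show ?thesis unfolding split[of w] split[of v] by linarith
qed

lemma coord_change_single:
  "coord_change g (single m c) = Const c * (\<Prod>i\<in>UNIV. coord_change g (Var i) ^ lookup m i)"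
  by (subst single_eq_prod) (simp add: coord_change_mult coord_change_prod coord_change_power)

definition diag :: "('n \<Rightarrow> 'k::zero) \<Rightarrow> 'k^'n^'n" where
  "diag t = (\<chi> i l. if i = l then t i else 0)"

lemma coord_change_diag_single:
  "coord_change (diag t) (single m c) = Const (\<Prod>i\<in>UNIV. t i ^ lookup m i) * single m (c :: 'k::field)"
proof -
  have Const_pow: "Const (a ^ k) = Const a ^ k" for a :: 'k and k by (induction k) (simp_all add: Const_mult)
  have Const_prod: "Const (\<Prod>i\<in>A. f i) = (\<Prod>i\<in>A. Const (f i))" for A and f :: "'a \<Rightarrow> 'k"
    by (induction A rule: infinite_finite_induct) (simp_all add: Const_mult)
  have "coord_change (diag t) (Var j) = Const (t j) * Var j" for j
  proof -
    have "coord_change (diag t) (Var j) = (\<Sum>i\<in>UNIV. if i = j then Const (t j) * Var j else 0)"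
      unfolding coord_change_Var diag_def by (rule sum.cong) auto
    then show ?thesis by simp
  qed
  then have "coord_change (diag t) (single m c) =
      Const c * ((\<Prod>i\<in>UNIV. Const (t i) ^ lookup m i) * (\<Prod>i\<in>UNIV. Var i ^ lookup m i))"
    by (simp add: coord_change_single power_mult_distrib prod.distrib)
  also have "\<dots> = Const (\<Prod>i\<in>UNIV. t i ^ lookup m i) * single m c"
    by (simp add: single_eq_prod[of m c] Const_prod Const_pow mult_ac)
  finally show ?thesis .
qed

lemma invertible_diag:
  fixes t :: "'n::finite \<Rightarrow> 'k::field"
  assumes "\<And>i. t i \<noteq> 0"
  shows "invertible (diag t)"
proof (rule inj_imp_invertible, rule injI)
  fix x y assume "diag t *v x = diag t *v y"
  moreover have "(diag t *v z) $ i = t i * z $ i" for z i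
  proof -
    have "(diag t *v z) $ i = (\<Sum>l\<in>UNIV. if l = i then t i * z $ i else 0)"
      unfolding matrix_vector_mult_def diag_def vec_lambda_beta by (rule sum.cong) auto
    then show ?thesis by simp
  qed
  ultimately have "t i * x $ i = t i * y $ i" for i by metis
  then show "x = y" using assms by (simp add: vec_eq_iff)
qed

text \<open>In the column convention this substitutes x_l + x_j for x_l and fixes the other
  variables.\<close>

definition shear :: "'n \<Rightarrow> 'n \<Rightarrow> ('k::zero_neq_one)^'n^'n" where
  "shear j l = (\<chi> i i'. if i = i' \<or> i = j \<and> i' = l then 1 else 0)"

lemma invertible_shear:
  fixes j l :: "'n::finite"
  assumes "j \<noteq> l"
  shows "invertible (shear j l :: 'k::field^'n^'n)"
proof (rule inj_imp_invertible, rule injI)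
  fix x y :: "'k^'n" assume eq: "shear j l *v x = shear j l *v y"
  have comp: "(shear j l *v z) $ i = z $ i + (if i = j then z $ l else 0)" for z :: "'k^'n" and i
  proof -
    have "(shear j l *v z) $ i = (\<Sum>i'\<in>UNIV. (if i' = i then z $ i else 0) + (if i' = l then if i = j then z $ l else 0 else 0))"
      unfolding matrix_vector_mult_def shear_def vec_lambda_beta by (rule sum.cong) (use assms in auto)
    then show ?thesis by (simp add: sum.distrib)
  qed
  have "x $ l = y $ l" using comp[of x l] comp[of y l] eq assms by simp
  then have "x $ i = y $ i" for i using comp[of x i] comp[of y i] eq by (simp split: if_splits)
  then show "x = y" by (simp add: vec_eq_iff)
qed

lemma coord_change_shear_single:
  assumes "j \<noteq> l"
  shows "coord_change (shear j l) (single w (1 :: 'k::field)) =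
    (\<Sum>k\<le>lookup w l. single (w - single l (lookup w l) + single j k + single l (lookup w l - k)) (of_nat (lookup w l choose k)))"
proof -
  let ?a = "lookup w l" let ?w = "w - single l (lookup w l)"
  have other: "coord_change (shear j l) (Var i) = (Var i :: ('a, 'k) mpoly)" if "i \<noteq> l" for i
  proof -
    have "coord_change (shear j l) (Var i) = (\<Sum>i'\<in>UNIV. if i' = i then Var i else (0 :: ('a, 'k) mpoly))"
      unfolding coord_change_Var shear_def using that by (intro sum.cong) auto
    then show ?thesis by simp
  qed
  have l: "coord_change (shear j l) (Var l) = (Var j + Var l :: ('a, 'k) mpoly)"
  proof -
    have "coord_change (shear j l) (Var l) =
        (\<Sum>i'\<in>UNIV. (if i' = j then Var j else 0) + (if i' = l then Var l else (0 :: ('a, 'k) mpoly)))"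
      unfolding coord_change_Var shear_def using assms by (intro sum.cong) auto
    then show ?thesis by (simp add: sum.distrib)
  qed
  have w: "?w + single l ?a = w"
    by (rule poly_mapping_eqI) (auto simp: lookup_add lookup_minus lookup_single when_def)
  have "single w (1::'k) = single ?w 1 * Var l ^ ?a"
    by (simp add: Var_power mult_single w)
  moreover have "coord_change (shear j l) (single ?w (1::'k)) = single ?w 1"
  proof -
    have "(\<Prod>i\<in>UNIV. coord_change (shear j l) (Var i) ^ lookup ?w i) = (\<Prod>i\<in>UNIV. (Var i :: ('a, 'k) mpoly) ^ lookup ?w i)"
    proof (rule prod.cong)
      show "coord_change (shear j l) (Var i) ^ lookup ?w i = (Var i :: ('a, 'k) mpoly) ^ lookup ?w i" for i
        by (cases "i = l") (simp_all add: other lookup_minus)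
    qed simp
    then show ?thesis by (simp only: coord_change_single single_eq_prod[of ?w "1::'k", symmetric])
  qed
  ultimately have "coord_change (shear j l) (single w (1::'k)) = single ?w 1 * (Var j + Var l) ^ ?a"
    by (simp add: coord_change_mult coord_change_power l)
  also have "\<dots> = (\<Sum>k\<le>?a. single ?w 1 * (of_nat (?a choose k) * Var j ^ k * Var l ^ (?a - k)))"
    by (simp add: binomial_ring sum_distrib_left)
  also have "\<dots> = (\<Sum>k\<le>?a. single (?w + single j k + single l (?a - k)) (of_nat (?a choose k)))"
    by (intro sum.cong refl) (simp add: Var_power mult_single algebra_simps flip: single_of_nat)
  finally show ?thesis .
qed

text \<open>Expanding the power of x_n + x_j replaces k factors x_n by x_j, which gives larger
  monomials for larger k. So \<open>w\<close> is the smallest monomial, and the next one has the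
  exponent of x_n as its coefficient.\<close>

lemma shear_coeffs:
  fixes w :: "'n::{finite,linorder} \<Rightarrow>\<^sub>0 nat" and j :: 'n
  assumes j: "j \<noteq> Max UNIV"
  defines "B \<equiv> coord_change (shear j (Max UNIV)) (single w (1 :: 'k::field))"
  shows "lookup B w = 1"
    and "lookup B b \<noteq> 0 \<Longrightarrow> b = w \<or> revlex_less w b"
    and "w = single (Max UNIV) 1 + m \<Longrightarrow> lookup B (single j 1 + m) = of_nat (lookup w (Max UNIV))"
    and "w = single (Max UNIV) 1 + m \<Longrightarrow> lookup B b \<noteq> 0 \<Longrightarrow>
      b = w \<or> b = single j 1 + m \<or> revlex_less (single j 1 + m) b"
proof -
  let ?l = "Max UNIV :: 'n" and ?a = "lookup w (Max UNIV)"
  define u where "u = (\<lambda>k. w - single ?l ?a + single j k + single ?l (?a - k))"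
  have look: "lookup B b = (\<Sum>k\<le>?a. if u k = b then of_nat (?a choose k) else 0)" for b
    unfolding B_def coord_change_shear_single[OF j] u_def by (simp add: lookup_sum lookup_single when_def)
  have u_last: "lookup (u k) ?l = ?a - k" for k
    using j by (simp add: u_def lookup_add lookup_minus lookup_single)
  have u_0: "u 0 = w"
    by (rule poly_mapping_eqI) (auto simp: u_def lookup_add lookup_minus lookup_single when_def)
  have u_k: "u k + single ?l k = w + single j k" if "k \<le> ?a" for k
    using that j by (intro poly_mapping_eqI) (auto simp: u_def lookup_add lookup_minus lookup_single when_def)
  have deg: "mdeg (u k) = mdeg w" if "k \<le> ?a" for k
    using arg_cong[OF u_k[OF that], of mdeg] by simp
  have inj: "u k = u k' \<longleftrightarrow> k = k'" if "k \<le> ?a" "k' \<le> ?a" for k k'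
    using u_last[of k] u_last[of k'] that by (metis diff_diff_cancel)
  have look_u: "lookup B (u k) = of_nat (?a choose k)" if "k \<le> ?a" for k
  proof -
    have "lookup B (u k) = (\<Sum>k'\<le>?a. if k' = k then of_nat (?a choose k') else 0)"
      unfolding look using inj that by (intro sum.cong) auto
    then show ?thesis using that by simp
  qed
  show "lookup B w = 1" using look_u[of 0] by (simp add: u_0)
  have supp: "\<exists>k\<le>?a. b = u k" if "lookup B b \<noteq> 0" for b
  proof (rule ccontr)
    assume "\<not> ?thesis"
    then have "lookup B b = 0" unfolding look by (intro sum.neutral) auto
    with that show False by simp
  qed
  have less: "revlex_less (u k') (u k)" if "k' < k" "k \<le> ?a" for k k'
    using that by (intro revlex_last_var) (simp_all add: deg u_last)
  show "b = w \<or> revlex_less w b" if b: "lookup B b \<noteq> 0"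
  proof -
    obtain k where k: "k \<le> ?a" "b = u k" using supp[OF b] by blast
    then show ?thesis using less[of 0 k] u_0 by (cases "k = 0") auto
  qed
  assume w: "w = single ?l 1 + m"
  then have a1: "1 \<le> ?a" by (simp add: lookup_add)
  have u_1: "u 1 = single j 1 + m"
  proof -
    have "single ?l 1 + u 1 = single ?l 1 + (single j 1 + m)"
      using u_k[OF a1] by (simp only: w ac_simps)
    then show ?thesis by (rule add_left_imp_eq)
  qed
  show "lookup B (single j 1 + m) = of_nat ?a" using look_u[OF a1] unfolding u_1 by simp
  show "b = w \<or> b = single j 1 + m \<or> revlex_less (single j 1 + m) b" if b: "lookup B b \<noteq> 0"
  proof -
    obtain k where k: "k \<le> ?a" "b = u k" using supp[OF b] by blast
    consider "k = 0" | "k = 1" | "1 < k" by linarith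
    then show ?thesis using less[of 1 k] k u_0 u_1 by cases auto
  qed
qed

context artinian_graded
begin

text \<open>
  If \<open>x\<^sub>n m\<close> were a leading monomial but \<open>x\<^sub>j m\<close> not, then substituting \<open>x\<^sub>n + x\<^sub>j\<close> for \<open>x\<^sub>n\<close> in the
  initial ideal would raise the number of leading monomials that are at least \<open>x\<^sub>j m\<close>. Since the initial
  ideal is a limit of torus translates \<open>s \<rightarrow> 0\<close> of the ideal itself, some translate would contradict
  genericity.
\<close>

lemma generic_stable:
  assumes g: "generic g" and xm: "single x\<^sub>n 1 + m \<in> lead_of g"
  shows "single j 1 + m \<in> lead_of g"
proof (cases "j = x\<^sub>n")
  case True
  then show ?thesis using xm by simp
next
  case j: False
  show ?thesis
  proof (rule ccontr)
    assume not: "single j 1 + m \<notin> lead_of g"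
    have inv_g: "invertible g" using g by (simp add: generic_def)
    interpret P: graded_ideal "coord_change g ` I" by (rule graded_ideal_coord_change[OF homog inv_g])
    define u where "u = single x\<^sub>n 1 + m"
    define u' where "u' = single j 1 + m"
    define d where "d = mdeg u"
    have du': "mdeg u' = d" by (simp add: u_def u'_def d_def)
    have uu': "revlex_less u u'"
      using j by (intro revlex_last_var) (simp_all add: u_def u'_def lookup_add lookup_single)
    \<comment> \<open>All monomials of degree d from \<open>u'\<close> upwards. The monomial
      \<open>u\<close> lies below, so \<open>E\<close> misses it.\<close>
    define E where "E = {b. mdeg b = d \<and> (b = u' \<or> revlex_less u' b)}"
    have E: "upset d E" unfolding upset_def E_def using revlex_trans by blast
    have uE: "u \<notin> E" using uu' revlex_asym revlex_irrefl by (auto simp: E_def)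
    \<comment> \<open>One index more than there are leading monomials in \<open>E\<close>: an
      independent family of forms on \<open>E\<close> indexed by \<open>A\<close> refutes
      genericity.\<close>
    define A where "A = insert u (lead_of g \<inter> E)"
    have finA: "finite A" using upset_finite[OF E] by (simp add: A_def)
    have cardA: "card A = Suc (card (lead_of g \<inter> E))" using upset_finite[OF E] uE by (simp add: A_def)
    have "\<forall>w\<in>A. \<exists>p\<in>coord_change g ` I. homogeneous d p \<and> lead p w \<and> lookup p w = 1"
    proof
      fix w assume "w \<in> A"
      then have "w \<in> lead_of g" "mdeg w = d" using xm by (auto simp: A_def u_def d_def E_def)
      then show "\<exists>p\<in>coord_change g ` I. homogeneous d p \<and> lead p w \<and> lookup p w = 1"
        using P.lead_homogeneous[of w] by (simp add: lead_of_def)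
    qed
    then obtain f where f: "\<And>w. w \<in> A \<Longrightarrow> f w \<in> coord_change g ` I" "\<And>w. w \<in> A \<Longrightarrow> homogeneous d (f w)"
      "\<And>w. w \<in> A \<Longrightarrow> lead (f w) w" "\<And>w. w \<in> A \<Longrightarrow> lookup (f w) w = 1" by metis
    define B :: "('n \<Rightarrow>\<^sub>0 nat) \<Rightarrow> ('n, 'k) mpoly" where "B = (\<lambda>v. coord_change (shear j x\<^sub>n) (single v 1))"
    have B_1: "lookup (B w) w = 1" for w
      unfolding B_def by (rule shear_coeffs(1)[OF j])
    have B_2: "b = w \<or> revlex_less w b" if "lookup (B w) b \<noteq> 0" for w b
      using that unfolding B_def by (rule shear_coeffs(2)[OF j])
    have B_3: "lookup (B u) u' = of_nat (lookup u x\<^sub>n)"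
      unfolding B_def u'_def by (rule shear_coeffs(3)[OF j u_def])
    have B_4: "b = u \<or> b = u' \<or> revlex_less u' b" if "lookup (B u) b \<noteq> 0" for b
      using that unfolding B_def u'_def by (rule shear_coeffs(4)[OF j u_def])
    have u_last: "lookup u x\<^sub>n > 0" by (simp add: u_def lookup_add)
    \<comment> \<open>Coefficients of the sheared torus translate of \<open>f w\<close>, divided by
      \<open>s ^ weight d w\<close>. The other monomials of \<open>f w\<close> have larger weight,
      so no subtraction is truncated, and at s = 0 only the sheared monomial \<open>w\<close>
      survives.\<close>
    define M where "M = (\<lambda>s w b. \<Sum>v\<in>keys (f w). lookup (f w) v * s ^ (weight d v - weight d w) * lookup (B v) b)"
    have wt: "weight d w < weight d v" if "w \<in> A" "v \<in> keys (f w)" "v \<noteq> w" for v w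
    proof (rule weight_revlex)
      show "mdeg v = d" "mdeg w = d" using f(2,3)[OF that(1)] that(2) by (auto simp: homogeneous_def lead_def)
      show "revlex_less v w" using f(3)[OF that(1)] that(2,3) by (simp add: lead_def)
    qed
    have M0: "M 0 w b = lookup (B w) b" if w: "w \<in> A" for w b
    proof -
      have "M 0 w b = (\<Sum>v\<in>keys (f w). if v = w then lookup (B w) b else 0)"
        unfolding M_def
      proof (rule sum.cong)
        fix v assume v: "v \<in> keys (f w)"
        show "lookup (f w) v * 0 ^ (weight d v - weight d w) * lookup (B v) b = (if v = w then lookup (B w) b else 0)"
          using wt[OF w v] f(4)[OF w] by (cases "v = w") (auto simp: power_0_left)
      qed simp
      also have "\<dots> = lookup (B w) b" using f(3)[OF w] by (simp add: lead_def)
      finally show ?thesis .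
    qed
    define F where "F = range (poly :: 'k poly \<Rightarrow> 'k \<Rightarrow> 'k)"
    have "\<exists>P\<in>F. P 0 \<noteq> 0 \<and> (\<forall>s. P s \<noteq> 0 \<longrightarrow>
           (\<forall>c. (\<forall>b\<in>E. (\<Sum>w\<in>A. c w * M s w b) = 0) \<longrightarrow> (\<forall>w\<in>A. c w = 0)))"
    proof (rule independence_is_open[OF _ _ _ finA])
      show "(\<lambda>_. 1) \<in> F" unfolding F_def by (rule range_eqI[of _ _ 1]) auto
      fix p q assume "p \<in> F" "q \<in> F"
      then obtain p' q' where pq: "p = poly p'" "q = poly q'" by (auto simp: F_def)
      show "(\<lambda>s. p s * q s) \<in> F" unfolding F_def pq by (rule range_eqI[of _ _ "p' * q'"]) auto
      show "(\<lambda>s. p s - q s) \<in> F" unfolding F_def pq by (rule range_eqI[of _ _ "p' - q'"]) auto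
    next
      show "(\<lambda>s. M s w b) \<in> F" for w b
        unfolding F_def M_def
        by (rule range_eqI[of _ _ "\<Sum>v\<in>keys (f w). smult (lookup (f w) v * lookup (B v) b) ([:0, 1:] ^ (weight d v - weight d w))"])
          (auto simp: poly_sum mult_ac)
      fix c assume c: "\<And>b. b \<in> E \<Longrightarrow> (\<Sum>w\<in>A. c w * M 0 w b) = 0"
      \<comment> \<open>At s = 0 the smallest monomial of row \<open>w\<close> inside
        \<open>E\<close> is \<open>w\<close>, except that it is \<open>u'\<close> for
        \<open>w = u\<close>, where the coefficient is a positive integer. Injectivity holds because
        \<open>u'\<close> is not a leading monomial and so is not in \<open>A\<close>.\<close>
      define \<phi> where "\<phi> = (\<lambda>w. if w = u then u' else w)"
      have Ew: "w \<in> lead_of g \<inter> E" if "w \<in> A" "w \<noteq> u" for w using that by (auto simp: A_def)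
      have u'E: "u' \<in> E" using du' by (simp add: E_def)
      have "u' \<notin> lead_of g" using not unfolding u'_def .
      then have u'A: "u' \<notin> A" using uu' revlex_irrefl by (auto simp: A_def)
      show "\<forall>w\<in>A. c w = 0"
      proof (rule triangular_independent[where \<phi> = \<phi> and R = "\<lambda>x y. revlex_less y x" and E = E and M = "M 0"])
        show "inj_on \<phi> A" using u'A by (auto simp: inj_on_def \<phi>_def)
        show "\<phi> w \<in> E" if "w \<in> A" for w using Ew[OF that] u'E by (auto simp: \<phi>_def)
        show "M 0 w (\<phi> w) \<noteq> 0" if "w \<in> A" for w
          unfolding M0[OF that] using B_1[of w] B_3 u_last by (cases "w = u") (simp_all add: \<phi>_def)
        show "b = \<phi> w \<or> revlex_less (\<phi> w) b" if "w \<in> A" "b \<in> E" "M 0 w b \<noteq> 0" for w b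
          using that(3) uE that(2) B_2[of w b] B_4[of b]
          unfolding M0[OF that(1)] by (cases "w = u") (auto simp: \<phi>_def)
        show "revlex_less y x \<or> revlex_less x y" if "x \<noteq> y" for x y :: "'n \<Rightarrow>\<^sub>0 nat"
          using revlex_total[OF that] by blast
        show "revlex_less z x" if "revlex_less y x" "revlex_less z y" for x y z :: "'n \<Rightarrow>\<^sub>0 nat"
          using revlex_trans[OF that(2,1)] .
      qed (use finA c revlex_irrefl in auto)
    qed
    then obtain q where q: "poly q 0 \<noteq> 0" "\<And>s c. poly q s \<noteq> 0 \<Longrightarrow>
        (\<forall>b\<in>E. (\<Sum>w\<in>A. c w * M s w b) = 0) \<Longrightarrow> \<forall>w\<in>A. c w = 0"
      unfolding F_def by auto
    \<comment> \<open>The extra factor excludes s = 0, where the diagonal matrix would be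
      singular.\<close>
    have "q * [:0, 1:] \<noteq> 0" using q(1) by auto
    then obtain s where "poly (q * [:0, 1:]) s \<noteq> 0" using poly_nonzero_ex by blast
    then have s: "poly q s \<noteq> 0" "s \<noteq> 0" by auto
    define T :: "('k, 'n) sqmat" where "T = diag (\<lambda>i. s ^ (Suc d ^ card {..<i}))"
    define h where "h = shear j x\<^sub>n ** (T ** g)"
    have inv_h: "invertible h"
      unfolding h_def T_def using s(2) j inv_g
      by (intro invertible_mult invertible_shear invertible_diag) auto
    interpret H: graded_ideal "coord_change h ` I" by (rule graded_ideal_coord_change[OF homog inv_h])
    have T_single: "coord_change T (single v c) = Const (s ^ weight d v) * single v c" for v c
      unfolding T_def coord_change_diag_single weight_def
      by (simp add: power_sum power_mult mult.commute[of "lookup v _"])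
    define f' where "f' = (\<lambda>w. pscale (inverse (s ^ weight d w)) (coord_change (shear j x\<^sub>n) (coord_change T (f w))))"
    have f'_M: "lookup (f' w) b = M s w b" if w: "w \<in> A" for w b
    proof -
      have "f w = (\<Sum>v\<in>keys (f w). single v (lookup (f w) v))" by (simp add: sum_single_keys)
      then have "coord_change T (f w) = (\<Sum>v\<in>keys (f w). Const (s ^ weight d v) * single v (lookup (f w) v))"
        using coord_change_sum[of T] T_single by (metis (no_types, lifting) sum.cong)
      also have "\<dots> = (\<Sum>v\<in>keys (f w). Const (s ^ weight d v * lookup (f w) v) * single v 1)"
        by (simp add: Const_def mult_single)
      finally have "coord_change (shear j x\<^sub>n) (coord_change T (f w)) =
          (\<Sum>v\<in>keys (f w). Const (s ^ weight d v * lookup (f w) v) * B v)"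
        by (simp add: coord_change_sum coord_change_mult B_def)
      then have "lookup (f' w) b = (\<Sum>v\<in>keys (f w). inverse (s ^ weight d w) * (s ^ weight d v * lookup (f w) v * lookup (B v) b))"
        by (simp add: f'_def lookup_sum sum_distrib_left)
      also have "\<dots> = M s w b"
        unfolding M_def
      proof (rule sum.cong)
        fix v assume v: "v \<in> keys (f w)"
        have "weight d w \<le> weight d v" using wt[OF w v] by (cases "v = w") auto
        then have "s ^ weight d v = s ^ (weight d v - weight d w) * s ^ weight d w"
          by (simp flip: power_add)
        then show "inverse (s ^ weight d w) * (s ^ weight d v * lookup (f w) v * lookup (B v) b) =
            lookup (f w) v * s ^ (weight d v - weight d w) * lookup (B v) b"
          using s(2) by (simp add: field_simps)
      qed simp
      finally show ?thesis .
    qed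
    have "card A \<le> card (lead_monoms (coord_change h ` I) \<inter> E)"
    proof (rule H.card_lead_ge[OF E finA, of f'])
      show "homogeneous d (f' w)" if "w \<in> A" for w
        unfolding f'_def by (intro homogeneous_pscale coord_change_homogeneous f(2)[OF that])
      show "f' w \<in> coord_change h ` I" if "w \<in> A" for w
      proof -
        obtain p where "p \<in> I" "f w = coord_change g p" using f(1)[OF \<open>w \<in> A\<close>] by blast
        then have "coord_change (shear j x\<^sub>n) (coord_change T (f w)) \<in> coord_change h ` I"
          by (auto simp: coord_change_compose h_def matrix_mul_assoc)
        then show ?thesis unfolding f'_def by (rule pscale_ideal[OF H.ideal])
      qed
      fix c assume c: "\<And>b. b \<in> E \<Longrightarrow> (\<Sum>w\<in>A. c w * lookup (f' w) b) = 0"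
      have "(\<Sum>w\<in>A. c w * M s w b) = 0" if "b \<in> E" for b
        using c[OF that] f'_M by simp
      then show "\<forall>w\<in>A. c w = 0" using q(2)[OF s(1)] by blast
    qed
    also have "\<dots> \<le> card (lead_of g \<inter> E)"
      using g E inv_h unfolding generic_def lead_of_def[of h, symmetric] by blast
    finally show False using cardA by simp
  qed
qed

end

section \<open>The last variable and the weak Lefschetz property\<close>

definition last_free :: "nat \<Rightarrow> ('n::{finite,linorder} \<Rightarrow>\<^sub>0 nat) set" where
  "last_free d = {m. mdeg m = d \<and> lookup m (Max UNIV) = 0}"

text \<open>Among monomials of equal degree those without x_n are the largest. Genericity therefore
  bounds the cokernel of x_n, as \<open>generic_last_free\<close> exploits.\<close>

lemma upset_last_free: "upset d (last_free d :: ('n::{finite,linorder} \<Rightarrow>\<^sub>0 nat) set)"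
proof -
  have "lookup m' (Max UNIV) = 0" if m: "lookup m (Max UNIV) = 0" "mdeg m = mdeg m'" "revlex_less m m'"
    for m m' :: "'n \<Rightarrow>\<^sub>0 nat"
  proof -
    obtain i where i: "lookup m i > lookup m' i" "\<And>j. j > i \<Longrightarrow> lookup m j = lookup m' j"
      using m(2,3) unfolding revlex_less_def by auto
    then have "i < Max UNIV" using m(1) by (metis Max_ge UNIV_I finite le_neq_trans less_zeroE)
    then show ?thesis using i(2) m(1) by metis
  qed
  then show ?thesis unfolding upset_def last_free_def by auto
qed

lemma last_free_step:
  fixes P :: "('n::{finite,linorder}, 'k::field) mpoly set"
  assumes P: "is_ideal P" and d: "last_free d \<subseteq> lead_monoms P"
  shows "last_free (Suc d) \<subseteq> lead_monoms P"
proof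
  fix m :: "'n \<Rightarrow>\<^sub>0 nat" assume m: "m \<in> last_free (Suc d)"
  then have "m \<noteq> 0" by (auto simp: last_free_def)
  then obtain i where i: "lookup m i > 0" by (metis gr0I lookup_zero poly_mapping_eqI)
  have e: "single i 1 + (m - single i 1) = m" by (rule single_add_minus[OF i])
  have "Suc (mdeg (m - single i 1)) = Suc d" using arg_cong[OF e, of mdeg] m by (simp add: last_free_def)
  moreover have "lookup (m - single i 1) (Max UNIV) = 0" using m by (simp add: last_free_def lookup_minus)
  ultimately have "m - single i 1 \<in> lead_monoms P" using d by (auto simp: last_free_def)
  from lead_monoms_add[OF P this, of "single i 1"] show "m \<in> lead_monoms P" by (simp only: e)
qed

lemma last_free_mono:
  assumes "is_ideal P" "last_free d \<subseteq> lead_monoms P" "d \<le> e"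
  shows "last_free e \<subseteq> lead_monoms P"
  using assms(3,2) by (induction rule: dec_induct) (auto dest: last_free_step[OF assms(1)])

lemma ideal_gen_insert:
  fixes P :: "('n, 'k::field) mpoly set"
  assumes "is_ideal P"
  shows "f \<in> ideal_gen (P \<union> {L}) \<longleftrightarrow> (\<exists>q. f - q * L \<in> P)"
proof -
  have "f \<in> ideal_gen (insert L P) \<longleftrightarrow> (\<exists>q. f - q * L \<in> ideal_gen P)" by (rule pol_mod.span_breakdown_eq)
  moreover have "ideal_gen P = P" using assms by simp
  ultimately show ?thesis by (simp only: Un_insert_right sup_bot_right)
qed

context graded_ideal
begin

lemma Var_last_vshift:
  assumes "\<And>v. v \<in> keys p \<Longrightarrow> lookup v (Max UNIV) > 0"
  shows "Var (Max UNIV) * vshift (Max UNIV) p = p"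
proof (rule poly_mapping_eqI)
  fix m
  show "lookup (Var (Max UNIV) * vshift (Max UNIV) p) m = lookup p m"
    using assms[of m] single_add_minus[of m "Max UNIV"]
    by (cases "lookup m (Max UNIV) > 0") (auto simp: lookup_Var_times in_keys_iff add.commute)
qed

text \<open>A monomial of the same degree without x_n would be larger than the leading one, so all
  monomials of the form are divisible by x_n.\<close>

lemma lead_last_divisible:
  assumes "homogeneous d p" "lead p m" "lookup m (Max UNIV) > 0"
  shows "Var (Max UNIV) * vshift (Max UNIV) p = p"
proof (rule Var_last_vshift)
  fix v assume v: "v \<in> keys p"
  show "lookup v (Max UNIV) > 0"
  proof (rule ccontr)
    assume "\<not> ?thesis"
    moreover have "mdeg m = mdeg v" using assms(1,2) v by (simp add: homogeneous_def lead_def)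
    ultimately have "revlex_less m v" using assms(3) by (intro revlex_last_var) auto
    moreover have "v = m \<or> revlex_less v m" using assms(2) v by (auto simp: lead_def)
    ultimately show False using revlex_asym revlex_irrefl by blast
  qed
qed

text \<open>The reverse lexicographic identity in(P + (x_n)) = in(P) + (x_n), restricted to the
  question whether everything in degree d is reached.\<close>

lemma hom_comp_subset_iff:
  "hom_comp d \<subseteq> ideal_gen (P \<union> {Var (Max UNIV)}) \<longleftrightarrow> last_free d \<subseteq> lead_monoms P"
proof
  let ?x = "Var (Max UNIV) :: ('n, 'k) mpoly"
  assume L: "hom_comp d \<subseteq> ideal_gen (P \<union> {?x})"
  show "last_free d \<subseteq> lead_monoms P"
  proof
    fix w :: "'n \<Rightarrow>\<^sub>0 nat" assume w: "w \<in> last_free d"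
    then have wd: "mdeg w = d" "lookup w (Max UNIV) = 0" by (auto simp: last_free_def)
    have "single w (1::'k) \<in> hom_comp d" using homogeneous_single[of w "1::'k"] wd by (simp add: hom_comp_def)
    with L obtain q where q: "single w 1 - q * ?x \<in> P" using ideal_gen_insert[OF ideal] by blast
    \<comment> \<open>Apart from \<open>w\<close> all monomials of this form are divisible by x_n
      and hence smaller, so \<open>w\<close> leads.\<close>
    define p where "p = hpart d (single w 1 - q * ?x)"
    have p: "p \<in> P" unfolding p_def by (rule hpart_closed[OF q])
    have lp: "lookup p v = (if mdeg v = d then (if w = v then 1 else 0) - (if lookup v (Max UNIV) > 0 then lookup q (v - single (Max UNIV) 1) else 0) else 0)" for v
      by (simp add: p_def lookup_minus lookup_single when_def mult.commute[of q] lookup_Var_times)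
    have "lead p w" unfolding lead_def
    proof (intro conjI ballI impI)
      show "w \<in> keys p" using wd by (simp add: in_keys_iff lp)
      fix v assume v: "v \<in> keys p" "v \<noteq> w"
      then have "mdeg v = mdeg w" "lookup v (Max UNIV) > 0" using wd by (auto simp: in_keys_iff lp split: if_splits)
      then show "revlex_less v w" using wd by (intro revlex_last_var) auto
    qed
    then show "w \<in> lead_monoms P" using p by (auto simp: lead_monoms_def)
  qed
next
  assume R: "last_free d \<subseteq> lead_monoms P"
  show "hom_comp d \<subseteq> ideal_gen (P \<union> {Var (Max UNIV)})"
  proof
    fix f :: "('n, 'k) mpoly" assume "f \<in> hom_comp d"
    then obtain g where g: "homogeneous d g" "keys g \<inter> lead_monoms P = {}" "f - g \<in> P"
      using normal_form[of d f] unfolding hom_comp_def by blast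
    have "lookup v (Max UNIV) > 0" if v: "v \<in> keys g" for v
    proof (rule ccontr)
      assume "\<not> ?thesis"
      then have "v \<in> last_free d" using g(1) v by (simp add: last_free_def homogeneous_def)
      then show False using R g(2) v by blast
    qed
    then have "Var (Max UNIV) * vshift (Max UNIV) g = g" by (rule Var_last_vshift)
    then have "f - vshift (Max UNIV) g * Var (Max UNIV) \<in> P" using g(3) by (simp add: mult.commute)
    then show "f \<in> ideal_gen (P \<union> {Var (Max UNIV)})" unfolding ideal_gen_insert[OF ideal] by blast
  qed
qed

section \<open>Kernel and cokernel of multiplication by the last variable\<close>

definition last_kernel :: "nat \<Rightarrow> ('n \<Rightarrow>\<^sub>0 nat) set" where
  "last_kernel d = {v. Suc (mdeg v) = d \<and> v \<notin> lead_monoms P \<and> single (Max UNIV) 1 + v \<in> lead_monoms P}"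

text \<open>Rank and nullity of x_n on R/in(P) from degree e to e + 1, counted on monomials: the
  cokernel consists of the standard monomials without x_n. Integers are used because the Hilbert
  function may increase.\<close>

lemma card_last_kernel:
  "int (card (last_kernel (Suc e))) =
    int (hilb P e) - int (hilb P (Suc e)) + int (card (last_free (Suc e) - lead_monoms P))"
proof -
  let ?S = "lead_monoms P" and ?n = "Max UNIV :: 'n"
  define K where "K = {v. mdeg v = e \<and> single ?n 1 + v \<notin> ?S}"
  have fin: "finite {v :: 'n \<Rightarrow>\<^sub>0 nat. mdeg v = d \<and> Q v}" for d Q
    by (rule finite_subset[OF _ finite_mdeg_eq[of d]]) auto
  have "{v. mdeg v = e \<and> v \<notin> ?S} = K \<union> last_kernel (Suc e)"
    using lead_monoms_add[OF ideal, of _ "single ?n 1"] by (auto simp: K_def last_kernel_def)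
  moreover have "K \<inter> last_kernel (Suc e) = {}" by (auto simp: K_def last_kernel_def)
  moreover have "finite K" "finite (last_kernel (Suc e))" using fin by (auto simp: K_def last_kernel_def)
  ultimately have h1: "hilb P e = card K + card (last_kernel (Suc e))"
    by (simp add: hilb_lead card_Un_disjoint)
  let ?K' = "(\<lambda>v. single ?n 1 + v) ` K"
  have "{v. mdeg v = Suc e \<and> v \<notin> ?S} = ?K' \<union> (last_free (Suc e) - ?S)"
  proof (intro set_eqI iffI)
    fix w assume w: "w \<in> {v. mdeg v = Suc e \<and> v \<notin> ?S}"
    show "w \<in> ?K' \<union> (last_free (Suc e) - ?S)"
    proof (cases "lookup w ?n > 0")
      case True
      have e: "single ?n 1 + (w - single ?n 1) = w" by (rule single_add_minus[OF True])
      have "mdeg (w - single ?n 1) = e" using w arg_cong[OF e, of mdeg] by simp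
      moreover have "single ?n 1 + (w - single ?n 1) \<notin> ?S" unfolding e using w by simp
      ultimately have "w - single ?n 1 \<in> K" by (simp only: K_def mem_Collect_eq simp_thms)
      then show ?thesis using e by (metis UnI1 image_eqI)
    qed (use w in \<open>simp add: last_free_def\<close>)
  qed (auto simp: K_def last_free_def)
  moreover have "?K' \<inter> (last_free (Suc e) - ?S) = {}" by (auto simp: last_free_def lookup_add)
  moreover have "card ?K' = card K" by (rule card_image) (simp add: inj_on_def)
  moreover have "finite ?K'" "finite (last_free (Suc e) - ?S)"
    using \<open>finite K\<close> fin by (auto simp: last_free_def)
  ultimately have h2: "hilb P (Suc e) = card K + card (last_free (Suc e) - ?S)"
    by (simp add: hilb_lead card_Un_disjoint)
  show ?thesis using h1 h2 by simp
qed

text \<open>If x_n v leads a form p of the ideal, then p = x_n q and q has leading monomial v.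
  Injectivity puts q into the ideal, so v was not standard.\<close>

lemma last_kernel_empty:
  assumes inj: "\<And>p. homogeneous e p \<Longrightarrow> Var (Max UNIV) * p \<in> P \<Longrightarrow> p \<in> P"
  shows "last_kernel (Suc e) = {}"
proof -
  have False if v: "v \<in> last_kernel (Suc e)" for v
  proof -
    let ?m = "single (Max UNIV) 1 + v"
    have v': "mdeg v = e" "v \<notin> lead_monoms P" "?m \<in> lead_monoms P" using v by (auto simp: last_kernel_def)
    obtain p where p: "p \<in> P" "homogeneous (mdeg ?m) p" "lead p ?m" using lead_homogeneous[OF v'(3)] by blast
    define q where "q = vshift (Max UNIV) p"
    have pq: "Var (Max UNIV) * q = p"
      unfolding q_def by (rule lead_last_divisible[OF p(2,3)]) (simp add: lookup_add)
    have "homogeneous e q"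
    proof (rule homogeneousI)
      fix m assume "lookup q m \<noteq> 0"
      then have "lookup p (m + single (Max UNIV) 1) \<noteq> 0" by (simp add: q_def)
      from homogeneousD[OF p(2) this] show "mdeg m = e" using v'(1) by simp
    qed
    then have "q \<in> P" using inj pq p(1) by simp
    moreover have "lead q v" unfolding lead_def
    proof (intro conjI ballI impI)
      have lq: "lookup q w = lookup p (single (Max UNIV) 1 + w)" for w by (simp add: q_def add.commute)
      show "v \<in> keys q" using p(3) unfolding lead_def in_keys_iff lq by simp
      fix w assume "w \<in> keys q" "w \<noteq> v"
      then have "single (Max UNIV) 1 + w \<in> keys p" "single (Max UNIV) 1 + w \<noteq> ?m"
        unfolding in_keys_iff lq by simp_all
      then have "revlex_less (single (Max UNIV) 1 + w) ?m" using p(3) unfolding lead_def by blast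
      then show "revlex_less w v" unfolding revlex_add_left .
    qed
    ultimately show False using v'(2) by (auto simp: lead_monoms_def)
  qed
  then show ?thesis by blast
qed

end

section \<open>Moving an arbitrary linear form to a variable\<close>

lemma coord_change_linear_form:
  "coord_change h (linear_form c) = linear_form (\<lambda>i. (h *v (\<chi> j. c j)) $ i)"
proof -
  have "coord_change h (linear_form c) = (\<Sum>j\<in>UNIV. \<Sum>i\<in>UNIV. Const (h $ i $ j * c j) * Var i)"
    by (simp add: linear_form_def coord_change_sum coord_change_mult coord_change_Var sum_distrib_left
        Const_mult mult_ac)
  also have "\<dots> = (\<Sum>i\<in>UNIV. (\<Sum>j\<in>UNIV. Const (h $ i $ j * c j)) * Var i)"
    by (subst sum.swap) (simp add: sum_distrib_right)
  finally show ?thesis by (simp add: linear_form_def matrix_vector_mult_def Const_sum)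
qed

lemma linear_form_unit: "linear_form (\<lambda>i. if i = k then 1 else 0) = Var k"
proof -
  have "linear_form (\<lambda>i. if i = k then 1 else 0) = (\<Sum>i\<in>UNIV. if i = k then Var k else 0)"
    unfolding linear_form_def by (rule sum.cong) auto
  then show ?thesis by simp
qed

lemma move_linear_form:
  fixes c :: "'n::finite \<Rightarrow> 'k::field"
  assumes "c k \<noteq> 0"
  shows "\<exists>h :: 'k^'n^'n. invertible h \<and> coord_change h (linear_form c) = Var l"
proof -
  \<comment> \<open>Swapping k and l lets the rows other than l run through the coordinates other
    than k. Row l normalises the k-th coefficient to 1, and the others subtract the multiple that
    kills theirs.\<close>
  define \<sigma> where "\<sigma> = (\<lambda>i. if i = k then l else if i = l then k else i)"
  define h :: "'k^'n^'n" where "h = (\<chi> i j. if i = l then (if j = k then 1 / c k else 0)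
      else (if j = \<sigma> i then 1 else 0) - (if j = k then c (\<sigma> i) / c k else 0))"
  have hv: "(h *v z) $ i = (if i = l then z $ k / c k else z $ (\<sigma> i) - c (\<sigma> i) / c k * z $ k)" for z i
  proof -
    have "(h *v z) $ i = (\<Sum>j\<in>UNIV. if i = l then (if j = k then z $ k / c k else 0)
        else (if j = \<sigma> i then z $ (\<sigma> i) else 0) - (if j = k then c (\<sigma> i) / c k * z $ k else 0))"
      unfolding matrix_vector_mult_def h_def vec_lambda_beta by (rule sum.cong) (auto simp: algebra_simps)
    then show ?thesis by (simp add: sum_subtractf)
  qed
  have "invertible h"
  proof (rule inj_imp_invertible, rule injI)
    fix x y assume eq: "h *v x = h *v y"
    then have "(h *v x) $ l = (h *v y) $ l" by simp
    then have k: "x $ k = y $ k" using assms by (simp add: hv)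
    have "x $ i = y $ i" for i
    proof (cases "i = k")
      case False
      have \<sigma>: "\<sigma> (\<sigma> i) = i" "\<sigma> i \<noteq> l" using False by (auto simp: \<sigma>_def)
      have "(h *v x) $ (\<sigma> i) = (h *v y) $ (\<sigma> i)" using eq by simp
      then show ?thesis using \<sigma> k by (simp add: hv)
    qed (rule k[folded k] | simp add: k)+
    then show "x = y" by (simp add: vec_eq_iff)
  qed
  moreover have "(\<lambda>i. (h *v (\<chi> j. c j)) $ i) = (\<lambda>i. if i = l then 1 else 0)"
    using assms by (auto simp: hv fun_eq_iff)
  then have "coord_change h (linear_form c) = Var l"
    by (simp add: coord_change_linear_form linear_form_unit)
  ultimately show ?thesis by blast
qed

lemma hom_comp_1_linear_form:
  assumes "L \<in> hom_comp 1"
  shows "L = linear_form (\<lambda>i. lookup L (single i 1))"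
proof (rule poly_mapping_eqI)
  fix m
  have lf: "lookup (linear_form c) m = (\<Sum>i\<in>UNIV. if single i 1 = m then c i else 0)" for c :: "_ \<Rightarrow> 'b" and m
    by (simp add: linear_form_def lookup_sum) (simp add: Var_def lookup_single when_def if_distrib cong: if_cong)
  show "lookup L m = lookup (linear_form (\<lambda>i. lookup L (single i 1))) m"
  proof (cases "mdeg m = 1")
    case True
    then have "m \<noteq> 0" by auto
    then obtain i where i: "lookup m i > 0" by (metis gr0I lookup_zero poly_mapping_eqI)
    have e: "single i 1 + (m - single i 1) = m" by (rule single_add_minus[OF i])
    have "mdeg (m - single i 1) = 0" using arg_cong[OF e, of mdeg] True by simp
    then have m: "m = single i 1" using e by simp
    have "single i' (1::nat) = m \<longleftrightarrow> i' = i" for i'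
      unfolding m by (metis lookup_single_eq lookup_single_not_eq zero_neq_one)
    then show ?thesis unfolding lf by (simp add: m)
  next
    case False
    then have "lookup L m = 0" using assms homogeneousD[of 1 L m] by (auto simp: hom_comp_def)
    moreover have "single i 1 \<noteq> m" for i using False by auto
    ultimately show ?thesis unfolding lf by simp
  qed
qed

lemma coord_change_image_iff:
  assumes "g' ** g = mat 1"
  shows "coord_change g p \<in> coord_change g ` I \<longleftrightarrow> p \<in> I"
proof -
  have "inj (coord_change g)" by (rule injI) (metis coord_change_inverse[OF assms])
  then show ?thesis by (rule inj_image_mem_iff)
qed

lemma hilb_coord_change:
  fixes I :: "('n::{finite,linorder}, 'k::field) mpoly set"
  assumes I: "homogeneous_ideal I" and g: "invertible g"
  shows "hilb (coord_change g ` I) d = hilb I d"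
proof -
  obtain g' where g': "g' ** g = mat 1" "g ** g' = mat 1" using g invertible_inverse_ex by blast
  interpret P: graded_ideal "coord_change g ` I" by (rule graded_ideal_coord_change[OF I g])
  have inj: "coord_change g p \<in> coord_change g ` I \<longleftrightarrow> p \<in> I" for p
    by (rule coord_change_image_iff[OF g'(1)])
  have lin: "Vector_Spaces.linear pscale pscale (coord_change g)"
    by (simp add: Vector_Spaces.linear_iff vector_space_pscale coord_change_add coord_change_pscale)
  have "has_qdim pscale (hom_comp d) (I \<inter> hom_comp d) k \<longleftrightarrow>
      has_qdim pscale (hom_comp d) (coord_change g ` I \<inter> hom_comp d) k" for k
  proof (rule has_qdim_linear_iff[OF lin subspace_hom_comp subspace_ideal_hom_comp[OF P.ideal]])
    fix q :: "('n, 'k) mpoly" assume q: "q \<in> hom_comp d"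
    have "coord_change g' q \<in> hom_comp d" using q by (simp add: hom_comp_def coord_change_homogeneous)
    moreover have "q - coord_change g (coord_change g' q) \<in> coord_change g ` I \<inter> hom_comp d"
      using pol_mod.subspace_0[OF P.ideal] by (simp add: coord_change_inverse[OF g'(2)] hom_comp_def)
    ultimately show "\<exists>p\<in>hom_comp d. q - coord_change g p \<in> coord_change g ` I \<inter> hom_comp d" by blast
  qed (auto simp: hom_comp_def coord_change_homogeneous inj)
  moreover have "\<exists>k. has_qdim pscale (hom_comp d) (coord_change g ` I \<inter> hom_comp d) k"
    using P.has_qdim_lead by blast
  ultimately obtain k where k: "has_qdim pscale (hom_comp d) (I \<inter> hom_comp d) k"
    "has_qdim pscale (hom_comp d) (coord_change g ` I \<inter> hom_comp d) k" by blast
  show ?thesis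
    unfolding hilb_def
    using has_qdim_quotient_dim[OF vector_space_pscale subspace_hom_comp subspace_ideal_hom_comp[OF is_ideal_of_homogeneous[OF I]] k(1)]
      has_qdim_quotient_dim[OF vector_space_pscale subspace_hom_comp subspace_ideal_hom_comp[OF P.ideal] k(2)]
    by simp
qed

context artinian_graded
begin

lemma ideal_gen_coord_change:
  assumes h: "invertible h"
  shows "hom_comp d \<subseteq> ideal_gen (I \<union> {L}) \<longleftrightarrow>
    hom_comp d \<subseteq> ideal_gen (coord_change h ` I \<union> {coord_change h L})"
proof -
  obtain h' where h': "h' ** h = mat 1" "h ** h' = mat 1" using h invertible_inverse_ex by blast
  interpret P: graded_ideal "coord_change h ` I" by (rule graded_ideal_coord_change[OF homog h])
  have mem: "coord_change h f \<in> ideal_gen (coord_change h ` I \<union> {coord_change h L}) \<longleftrightarrow> f \<in> ideal_gen (I \<union> {L})" for f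
  proof -
    have "coord_change h f - q * coord_change h L \<in> coord_change h ` I \<longleftrightarrow> f - coord_change h' q * L \<in> I" for q
    proof -
      have "coord_change h f - q * coord_change h L = coord_change h (f - coord_change h' q * L)"
        by (simp add: coord_change_diff coord_change_mult coord_change_inverse[OF h'(2)])
      then show ?thesis by (simp only: coord_change_image_iff[OF h'(1)])
    qed
    moreover have "\<exists>q. f - p * L = f - coord_change h' q * L" for p
      by (rule exI[of _ "coord_change h p"]) (simp add: coord_change_inverse[OF h'(1)])
    ultimately show ?thesis
      unfolding ideal_gen_insert[OF P.ideal] ideal_gen_insert[OF is_ideal_I] by metis
  qed
  have hc: "coord_change h f \<in> hom_comp d \<longleftrightarrow> f \<in> hom_comp d" for f
    using coord_change_homogeneous[of d f h] coord_change_homogeneous[of d "coord_change h f" h']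
    by (auto simp: hom_comp_def coord_change_inverse[OF h'(1)])
  have surj: "coord_change h (coord_change h' f) = f" for f by (simp add: coord_change_inverse[OF h'(2)])
  show ?thesis
  proof
    assume L: "hom_comp d \<subseteq> ideal_gen (I \<union> {L})"
    show "hom_comp d \<subseteq> ideal_gen (coord_change h ` I \<union> {coord_change h L})"
    proof
      fix f :: "('n, 'k) mpoly" assume "f \<in> hom_comp d"
      then have "coord_change h' f \<in> hom_comp d" using hc[of "coord_change h' f"] surj[of f] by simp
      then have "coord_change h' f \<in> ideal_gen (I \<union> {L})" using L by blast
      then show "f \<in> ideal_gen (coord_change h ` I \<union> {coord_change h L})"
        using mem[of "coord_change h' f"] surj[of f] by simp
    qed
  next
    assume R: "hom_comp d \<subseteq> ideal_gen (coord_change h ` I \<union> {coord_change h L})"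
    show "hom_comp d \<subseteq> ideal_gen (I \<union> {L})"
      using R hc mem by blast
  qed
qed

lemma generic_last_free:
  assumes "generic g" "invertible h"
  shows "card (last_free d - lead_of g) \<le> card (last_free d - lead_of h)"
    and "last_free d \<subseteq> lead_of h \<Longrightarrow> last_free d \<subseteq> lead_of g"
proof -
  have fin: "finite (last_free d :: ('n \<Rightarrow>\<^sub>0 nat) set)" using upset_finite[OF upset_last_free] .
  have le: "card (lead_of h \<inter> last_free d) \<le> card (lead_of g \<inter> last_free d)"
    using assms upset_last_free unfolding generic_def by blast
  have card: "card (last_free d - lead_of k) = card (last_free d :: ('n \<Rightarrow>\<^sub>0 nat) set) - card (lead_of k \<inter> last_free d)" for k
    using fin by (simp add: card_Diff_subset_Int Int_commute)
  show "card (last_free d - lead_of g) \<le> card (last_free d - lead_of h)" using le by (simp add: card)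
  then show "last_free d \<subseteq> lead_of g" if "last_free d \<subseteq> lead_of h"
    using that fin by (metis Diff_eq_empty_iff card_0_eq card.empty finite_Diff le_zero_eq)
qed

lemma hom_comp_subset_linear_form:
  assumes "invertible h" "coord_change h L = Var x\<^sub>n"
  shows "hom_comp d \<subseteq> ideal_gen (I \<union> {L}) \<longleftrightarrow> last_free d \<subseteq> lead_of h"
  unfolding ideal_gen_coord_change[OF assms(1)] assms(2) lead_of_def
  by (rule graded_ideal.hom_comp_subset_iff[OF graded_ideal_coord_change[OF homog assms(1)]])

section \<open>The reduction number in generic coordinates\<close>

definition red :: "('k, 'n) sqmat \<Rightarrow> nat" where
  "red g = (LEAST t. last_free (t + 1) \<subseteq> lead_of g)"

lemma last_free_ex: "invertible g \<Longrightarrow> \<exists>t. last_free (t + 1) \<subseteq> lead_of g"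
  using lead_of_large unfolding last_free_def by (metis (mono_tags, lifting) le_add1 mem_Collect_eq subsetI)

lemma last_free_iff:
  assumes g: "invertible g"
  shows "last_free (t + 1) \<subseteq> lead_of g \<longleftrightarrow> red g \<le> t"
proof
  show "red g \<le> t" if "last_free (t + 1) \<subseteq> lead_of g" unfolding red_def using that by (rule Least_le)
  assume le: "red g \<le> t"
  have "last_free (red g + 1) \<subseteq> lead_of g" unfolding red_def by (rule LeastI_ex[OF last_free_ex[OF g]])
  then show "last_free (t + 1) \<subseteq> lead_of g"
    using le last_free_mono[OF is_ideal_coord_change[OF g is_ideal_I], of "red g + 1" "t + 1"]
    unfolding lead_of_def by simp
qed

lemma reduction_number_wrt_eq:
  assumes "invertible h" "coord_change h L = Var x\<^sub>n"
  shows "reduction_number_wrt I L = red h"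
  unfolding reduction_number_wrt_def red_def hom_comp_subset_linear_form[OF assms] ..

lemma red_generic_le:
  assumes "generic g" "invertible h"
  shows "red g \<le> red h"
proof -
  have "invertible g" using assms by (simp add: generic_def)
  then show ?thesis
    using generic_last_free(2)[OF assms] last_free_iff[OF assms(2), of "red h"] last_free_iff[of g "red h"] by simp
qed

text \<open>Write each monomial as an element of I + (L) for the given form and perturb the form:
  the resulting elements still span the degree d component on an open set.\<close>

lemma hom_comp_subset_open:
  assumes "hom_comp d \<subseteq> ideal_gen (I \<union> {linear_form c\<^sub>0})"
  shows "\<exists>f\<in>poly_funs. f c\<^sub>0 \<noteq> 0 \<and> (\<forall>c. f c \<noteq> 0 \<longrightarrow> hom_comp d \<subseteq> ideal_gen (I \<union> {linear_form c}))"
proof -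
  define E where "E = {m :: 'n \<Rightarrow>\<^sub>0 nat. mdeg m = d}"
  have finE: "finite E" unfolding E_def by (rule finite_mdeg_eq)
  have "\<exists>q. single m 1 - q * linear_form c\<^sub>0 \<in> I" if "m \<in> E" for m
  proof -
    have "single m (1::'k) \<in> hom_comp d" using homogeneous_single[of m "1::'k"] that by (simp add: hom_comp_def E_def)
    then show ?thesis using assms ideal_gen_insert[OF is_ideal_I] by blast
  qed
  then obtain q where q: "\<And>m. m \<in> E \<Longrightarrow> single m 1 - q m * linear_form c\<^sub>0 \<in> I" by metis
  \<comment> \<open>The first two terms together lie in \<open>I\<close>, so \<open>G c m\<close>
    lies in I + (\<open>linear_form c\<close>) for every c; at \<open>c\<^sub>0\<close> it is the
    monomial \<open>m\<close>.\<close>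
  define G where "G = (\<lambda>c m. single m 1 - q m * linear_form c\<^sub>0 + q m * linear_form c)"
  have "\<exists>f\<in>poly_funs. f c\<^sub>0 \<noteq> 0 \<and> (\<forall>c. f c \<noteq> 0 \<longrightarrow>
      (\<forall>u. (\<forall>b\<in>E. (\<Sum>m\<in>E. u m * lookup (G c m) b) = 0) \<longrightarrow> (\<forall>m\<in>E. u m = 0)))"
  proof (rule independence_is_open[OF poly_funs_const poly_funs_mult poly_funs_diff finE])
    show "(\<lambda>c. lookup (G c m) b) \<in> poly_funs" for m b
    proof -
      have "lookup (q m * linear_form c) b = (\<Sum>i\<in>UNIV. c i * lookup (Var i * q m) b)" for c
        by (simp add: linear_form_def sum_distrib_left lookup_sum mult.left_commute[of "q m"] mult.commute[of "q m"] mult.assoc)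
      then show ?thesis
        unfolding G_def lookup_add
        by (auto intro!: poly_funs_add poly_funs_const poly_funs_sum poly_funs_mult poly_funs_coord)
    qed
    fix u assume u: "\<And>b. b \<in> E \<Longrightarrow> (\<Sum>m\<in>E. u m * lookup (G c\<^sub>0 m) b) = 0"
    show "\<forall>m\<in>E. u m = 0"
    proof
      fix b assume b: "b \<in> E"
      have "(\<Sum>m\<in>E. u m * lookup (G c\<^sub>0 m) b) = (\<Sum>m\<in>E. if m = b then u b else 0)"
        by (rule sum.cong) (auto simp: G_def lookup_single when_def)
      then show "u b = 0" using u[OF b] b finE by simp
    qed
  qed auto
  then obtain f where f: "f \<in> poly_funs" "f c\<^sub>0 \<noteq> 0"
    "\<And>c u. f c \<noteq> 0 \<Longrightarrow> (\<And>b. b \<in> E \<Longrightarrow> (\<Sum>m\<in>E. u m * lookup (G c m) b) = 0) \<Longrightarrow> \<forall>m\<in>E. u m = 0" by blast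
  have "hom_comp d \<subseteq> ideal_gen (I \<union> {linear_form c})" if c: "f c \<noteq> 0" for c
  proof
    fix p :: "('n, 'k) mpoly" assume p: "p \<in> hom_comp d"
    let ?Id = "ideal_gen (I \<union> {linear_form c})"
    have idl: "is_ideal ?Id" by (rule pol_mod.subspace_span)
    have G_in: "G c m \<in> ?Id" if "m \<in> E" for m
      unfolding ideal_gen_insert[OF is_ideal_I] using q[OF that] by (intro exI[of _ "q m"]) (simp add: G_def)
    \<comment> \<open>Spanning by counting: adjoining \<open>p\<close> gives one vector more than
      there are monomials. In the resulting dependence \<open>p\<close> must occur, since the others
      are independent.\<close>
    define H where "H = (\<lambda>x. case x of None \<Rightarrow> p | Some m \<Rightarrow> hpart d (G c m))"
    have "card E < card (insert None (Some ` E))"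
      using finE by (simp add: card_image)
    from homogeneous_system[OF finE _ this, of "\<lambda>x. lookup (H x)"] finE obtain u
      where u: "\<exists>x\<in>insert None (Some ` E). u x \<noteq> 0"
        "\<And>b. b \<in> E \<Longrightarrow> (\<Sum>x\<in>insert None (Some ` E). u x * lookup (H x) b) = 0" by auto
    have rel: "u None * lookup p b + (\<Sum>m\<in>E. u (Some m) * lookup (G c m) b) = 0" if "b \<in> E" for b
      using u(2)[OF that] finE that by (simp add: sum.reindex H_def E_def)
    have "u None \<noteq> 0"
    proof
      assume "u None = 0"
      then have "\<forall>m\<in>E. u (Some m) = 0" using f(3)[OF c, of "\<lambda>m. u (Some m)"] rel by simp
      then show False using u(1) \<open>u None = 0\<close> by auto
    qed
    have "p = pscale (- inverse (u None)) (hpart d (\<Sum>m\<in>E. pscale (u (Some m)) (G c m)))"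
    proof (rule poly_mapping_eqI)
      fix b
      show "lookup p b = lookup (pscale (- inverse (u None)) (hpart d (\<Sum>m\<in>E. pscale (u (Some m)) (G c m)))) b"
      proof (cases "b \<in> E")
        case True
        have "(\<Sum>m\<in>E. u (Some m) * lookup (G c m) b) = - (u None * lookup p b)"
          using rel[OF True] by (simp add: eq_neg_iff_add_eq_0 add.commute)
        then show ?thesis using True \<open>u None \<noteq> 0\<close> by (simp add: E_def lookup_sum)
      next
        case False
        then show ?thesis using p homogeneousD[of d p b] by (auto simp: E_def hom_comp_def)
      qed
    qed
    also have "\<dots> \<in> ?Id"
    proof (rule pscale_ideal[OF idl])
      have "(\<Sum>m\<in>E. pscale (u (Some m)) (G c m)) \<in> ?Id"
        using G_in by (intro pol_mod.subspace_sum[OF idl] pscale_ideal[OF idl])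
      moreover have "homogeneous_ideal ?Id"
      proof -
        obtain S where S: "\<forall>p\<in>S. \<exists>d. homogeneous d p" "I = ideal_gen S"
          using homog by (auto simp: homogeneous_ideal_def)
        have "?Id = ideal_gen (S \<union> {linear_form c})"
          unfolding S(2) pol_mod.span_Un[of _ "{linear_form c}"] by (simp add: pol_mod.span_span)
        moreover have "homogeneous 1 (linear_form c)"
          unfolding linear_form_def
          using homogeneous_mult[OF homogeneous_Const homogeneous_Var] by (intro homogeneous_sum) simp
        ultimately show ?thesis
          using S(1) unfolding homogeneous_ideal_def by (intro exI[of _ "S \<union> {linear_form c}"]) auto
      qed
      ultimately show "hpart d (\<Sum>m\<in>E. pscale (u (Some m)) (G c m)) \<in> ?Id"
        by (intro homogeneous_ideal_hpart)
    qed
    finally show "p \<in> ?Id" .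
  qed
  with f(1,2) show ?thesis by blast
qed

text \<open>The upper bound is an open condition near the form that \<open>g\<close> carries to x_n.
  The lower bound holds for every nonzero form, because moving it to x_n gives coordinates that
  cannot do better than generic ones.\<close>

lemma reduction_number_eq:
  assumes g: "generic g"
  shows "reduction_number I = red g"
proof -
  have inv_g: "invertible g" using g by (simp add: generic_def)
  then obtain g' where g': "g' ** g = mat 1" "g ** g' = mat 1" using invertible_inverse_ex by blast
  define c\<^sub>0 where "c\<^sub>0 = (\<lambda>i. g' $ i $ x\<^sub>n)"
  have L0: "coord_change g (linear_form c\<^sub>0) = Var x\<^sub>n"
  proof -
    have "linear_form c\<^sub>0 = coord_change g' (Var x\<^sub>n)" by (simp add: linear_form_def coord_change_Var c\<^sub>0_def)
    then show ?thesis by (simp add: coord_change_inverse[OF g'(2)])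
  qed
  have "\<exists>k. c\<^sub>0 k \<noteq> 0"
  proof (rule ccontr)
    assume "\<not> ?thesis"
    then have "linear_form c\<^sub>0 = 0" by (simp add: linear_form_def)
    then have "(Var x\<^sub>n :: ('n, 'k) mpoly) = 0" using L0 by simp
    moreover have "lookup (Var x\<^sub>n :: ('n, 'k) mpoly) (single x\<^sub>n 1) = 1" by (simp add: Var_def)
    ultimately show False by simp
  qed
  then obtain k where k: "c\<^sub>0 k \<noteq> 0" by blast
  have "hom_comp (red g + 1) \<subseteq> ideal_gen (I \<union> {linear_form c\<^sub>0})"
    unfolding hom_comp_subset_linear_form[OF inv_g L0] last_free_iff[OF inv_g] ..
  from hom_comp_subset_open[OF this] obtain f where f: "f \<in> poly_funs" "f c\<^sub>0 \<noteq> 0"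
    "\<And>c. f c \<noteq> 0 \<Longrightarrow> hom_comp (red g + 1) \<subseteq> ideal_gen (I \<union> {linear_form c})" by blast
  \<comment> \<open>The factor \<open>c k\<close> keeps the form nonzero, so that it can be moved to
    x_n.\<close>
  define F where "F = (\<lambda>c. f c * c k)"
  have F: "F \<in> poly_funs" unfolding F_def by (rule poly_funs_mult[OF f(1) poly_funs_coord])
  have val: "reduction_number_wrt I (linear_form c) = red g" if Fc: "F c \<noteq> 0" for c
  proof (rule antisym)
    show "reduction_number_wrt I (linear_form c) \<le> red g"
      unfolding reduction_number_wrt_def using Fc f(3)[of c] by (intro Least_le) (simp add: F_def)
    obtain h :: "('k, 'n) sqmat" where h: "invertible h" "coord_change h (linear_form c) = Var x\<^sub>n"
      using move_linear_form[of c k x\<^sub>n] Fc by (auto simp: F_def)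
    then show "red g \<le> reduction_number_wrt I (linear_form c)"
      using reduction_number_wrt_eq[OF h] red_generic_le[OF g h(1)] by simp
  qed
  show ?thesis unfolding reduction_number_def
  proof (rule the_equality)
    show "\<exists>U. zariski_open U \<and> U \<noteq> {} \<and> (\<forall>c\<in>U. reduction_number_wrt I (linear_form c) = red g)"
      using zariski_open_poly_fun[OF F] val f(2) k
      by (intro exI[of _ "{c. F c \<noteq> 0}"]) (auto simp: F_def)
    fix r assume "\<exists>U. zariski_open U \<and> U \<noteq> {} \<and> (\<forall>c\<in>U. reduction_number_wrt I (linear_form c) = r)"
    then obtain U a where U: "zariski_open U" "a \<in> U" "\<And>c. c \<in> U \<Longrightarrow> reduction_number_wrt I (linear_form c) = r" by blast
    obtain f' where f': "f' \<in> poly_funs" "f' a \<noteq> 0" "\<And>c. f' c \<noteq> 0 \<Longrightarrow> c \<in> U"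
      using zariski_open_contains[OF U(1,2)] by blast
    have "F c\<^sub>0 \<noteq> 0" using f(2) k by (simp add: F_def)
    then obtain c where "F c \<noteq> 0" "f' c \<noteq> 0" using poly_funs_common_nonzero[OF F f'(1) _ f'(2)] by blast
    then show "r = red g" using val U(3) f'(3) by metis
  qed
qed

text \<open>Below the reduction number the cokernel of x_n is nonzero even in generic coordinates,
  so a Lefschetz form cannot be surjective there and must be injective. This passes to generic
  coordinates through the kernel and cokernel count.\<close>

lemma lefschetz_last_kernel:
  assumes g: "generic g" and WLP: "weak_lefschetz I" and "I \<noteq> UNIV" and e: "e < red g"
  shows "graded_ideal.last_kernel (coord_change g ` I) (Suc e) = {}"
proof -
  have inv_g: "invertible g" using g by (simp add: generic_def)
  interpret P: graded_ideal "coord_change g ` I" by (rule graded_ideal_coord_change[OF homog inv_g])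
  have not_free: "\<not> last_free (Suc e) \<subseteq> lead_of g" using last_free_iff[OF inv_g, of e] e by simp
  obtain L where L: "L \<in> hom_comp 1" "\<And>d. mult_injective I L d \<or> mult_surjective I L d"
    using WLP by (auto simp: weak_lefschetz_def)
  define c where "c = (\<lambda>i. lookup L (single i 1))"
  have Lc: "L = linear_form c" unfolding c_def by (rule hom_comp_1_linear_form[OF L(1)])
  \<comment> \<open>For L = 0 injectivity fails in degree 0 since A is nonzero, so surjectivity
    gives A_1 = 0 and \<open>red g = 0\<close>, contrary to \<open>e < red g\<close>.\<close>
  have "\<exists>k. c k \<noteq> 0"
  proof (rule ccontr)
    assume "\<not> ?thesis"
    then have L_0: "L = 0" unfolding Lc by (simp add: linear_form_def)
    have "1 \<notin> I" using \<open>I \<noteq> UNIV\<close> pol_mod.subspace_scale[OF is_ideal_I, of 1] by auto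
    moreover have "(1 :: ('n, 'k) mpoly) \<in> hom_comp 0"
      using homogeneous_Const[of "1::'k"] by (simp add: hom_comp_def)
    ultimately have "\<not> mult_injective I L 0"
      unfolding mult_injective_def L_0 using pol_mod.subspace_0[OF is_ideal_I] by auto
    then have "mult_surjective I L 0" using L(2) by blast
    then have "hom_comp (Suc 0) \<subseteq> I" unfolding mult_surjective_def L_0 by auto
    then have "last_free (0 + 1) \<subseteq> lead_of g" using lead_of_full[OF inv_g] by (auto simp: last_free_def)
    then show False using last_free_iff[OF inv_g, of 0] e by simp
  qed
  then obtain h :: "('k, 'n) sqmat" where h: "invertible h" "coord_change h L = Var x\<^sub>n"
    using move_linear_form[of c] Lc by metis
  interpret H: graded_ideal "coord_change h ` I" by (rule graded_ideal_coord_change[OF homog h(1)])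
  obtain h' where h': "h' ** h = mat 1" "h ** h' = mat 1" using h invertible_inverse_ex by blast
  have "\<not> mult_surjective I L e"
  proof
    assume s: "mult_surjective I L e"
    have "hom_comp (Suc e) \<subseteq> ideal_gen (I \<union> {L})"
    proof
      fix q :: "('n, 'k) mpoly" assume "q \<in> hom_comp (Suc e)"
      then obtain p where "q - L * p \<in> I" using s by (auto simp: mult_surjective_def)
      then show "q \<in> ideal_gen (I \<union> {L})"
        unfolding ideal_gen_insert[OF is_ideal_I] by (intro exI[of _ p]) (simp add: mult.commute)
    qed
    then show False
      using not_free generic_last_free(2)[OF g h(1)] unfolding hom_comp_subset_linear_form[OF h] by blast
  qed
  then have inj: "mult_injective I L e" using L(2) by blast
  have "H.last_kernel (Suc e) = {}"
  proof (rule H.last_kernel_empty)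
    fix p assume p: "homogeneous e p" "Var x\<^sub>n * p \<in> coord_change h ` I"
    then obtain f where f: "f \<in> I" "Var x\<^sub>n * p = coord_change h f" by blast
    have "coord_change h (L * coord_change h' p) = coord_change h f"
      by (simp add: coord_change_mult h(2) coord_change_inverse[OF h'(2)] f(2))
    then have "L * coord_change h' p = f" by (metis coord_change_inverse[OF h'(1)])
    moreover have "coord_change h' p \<in> hom_comp e" using p(1) by (simp add: hom_comp_def coord_change_homogeneous)
    ultimately have "coord_change h' p \<in> I" using inj f(1) by (auto simp: mult_injective_def)
    then show "p \<in> coord_change h ` I" by (metis coord_change_inverse[OF h'(2)] image_eqI)
  qed
  \<comment> \<open>The kernel for \<open>h\<close> is zero, so its cokernel dimension is the
    difference of the Hilbert function. The cokernel for \<open>g\<close> is no larger, which leaves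
    no room for a kernel.\<close>
  then have "int (card (last_free (Suc e) - lead_of h)) = int (hilb I (Suc e)) - int (hilb I e)"
    using H.card_last_kernel[of e]
    by (simp add: hilb_coord_change[OF homog h(1)] lead_of_def)
  moreover have "int (card (P.last_kernel (Suc e))) = int (hilb I e) - int (hilb I (Suc e)) + int (card (last_free (Suc e) - lead_of g))"
    using P.card_last_kernel[of e]
    by (simp add: hilb_coord_change[OF homog inv_g] lead_of_def)
  ultimately have "card (P.last_kernel (Suc e)) = 0"
    using generic_last_free(1)[OF g h(1), of "Suc e"] by linarith
  moreover have "finite (P.last_kernel (Suc e))"
    by (rule finite_subset[OF _ finite_mdeg_eq[of e]]) (auto simp: P.last_kernel_def)
  ultimately show ?thesis by simp
qed

lemma stable_monomials_generic:
  assumes g: "generic g" and "I \<noteq> UNIV"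
  shows "stable_monomials (lead_of g)"
proof
  have inv_g: "invertible g" using g by (simp add: generic_def)
  interpret P: graded_ideal "coord_change g ` I" by (rule graded_ideal_coord_change[OF homog inv_g])
  show "u + m \<in> lead_of g" if "m \<in> lead_of g" for m u
    using that lead_monoms_add[OF P.ideal] unfolding lead_of_def by blast
  show "single j 1 + m \<in> lead_of g" if "single x\<^sub>n 1 + m \<in> lead_of g" for m j
    using that by (rule generic_stable[OF g])
  show "\<exists>M. \<forall>m. M \<le> mdeg m \<longrightarrow> m \<in> lead_of g" using lead_of_large inv_g by blast
  show "0 \<notin> lead_of g"
  proof
    assume "0 \<in> lead_of g"
    then obtain p where p: "p \<in> coord_change g ` I" "homogeneous 0 p" "lookup p 0 = 1"
      using P.lead_homogeneous[of 0] by (auto simp: lead_of_def)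
    have "p = 1" using homogeneousD[OF p(2)] p(3)
      by (intro poly_mapping_eqI) (auto simp: lookup_one when_def)
    then obtain f where f: "f \<in> I" "coord_change g f = 1" using p(1) by force
    obtain g' where g': "g' ** g = mat 1" using inv_g invertible_inverse_ex by blast
    have "f = 1" using arg_cong[OF f(2), of "coord_change g'"] by (simp add: coord_change_inverse[OF g'])
    then have "q \<in> I" for q using pol_mod.subspace_scale[OF is_ideal_I f(1), of q] by simp
    then show False using \<open>I \<noteq> UNIV\<close> by blast
  qed
qed

end

text \<open>The chain condition is applied to the ideals I + M_i, where M_i contains the polynomials
  without terms of degree below i. Once the chain is stationary, a form of degree d is an element of
  I plus terms of higher degree, and taking degree d components removes those.\<close>

lemma artinian_quotient_large:
  fixes I :: "('n::finite, 'k::field) mpoly set"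
  assumes homog: "homogeneous_ideal I" and art: "artinian_quotient I"
  shows "\<exists>N. \<forall>d\<ge>N. hom_comp d \<subseteq> I"
proof -
  have I: "is_ideal I" using homog by (rule is_ideal_of_homogeneous)
  define M where "M = (\<lambda>i. {p :: ('n, 'k) mpoly. \<forall>m\<in>keys p. i \<le> mdeg m})"
  define J where "J = (\<lambda>i. {p + q | p q. p \<in> I \<and> q \<in> M i})"
  have M: "is_ideal (M i)" for i
    unfolding pol_mod.subspace_def
  proof (intro conjI ballI allI)
    fix p assume p: "p \<in> M i"
    show "f * p \<in> M i" for f using p keys_mult[of f p] by (fastforce simp: M_def)
    show "p + q \<in> M i" if "q \<in> M i" for q using p that keys_add[of p q] by (auto simp: M_def)
  qed (simp add: M_def)
  have "is_ideal (J i)" for i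
  proof -
    have sp: "ideal_gen I = I" "ideal_gen (M i) = M i" using I M[of i] by (simp_all only: pol_mod.span_eq_iff)
    have "ideal_gen (I \<union> M i) = J i" unfolding J_def pol_mod.span_Un sp ..
    then show ?thesis using pol_mod.subspace_span[of "I \<union> M i"] by simp
  qed
  moreover have "I \<subseteq> J i" for i unfolding J_def using pol_mod.subspace_0[OF M] by force
  moreover have "decseq J" unfolding decseq_def J_def M_def by fastforce
  ultimately obtain N where N: "\<And>i. i \<ge> N \<Longrightarrow> J i = J N" using art unfolding artinian_quotient_def by blast
  have "hom_comp d \<subseteq> I" if d: "d \<ge> N" for d
  proof
    fix f :: "('n, 'k) mpoly" assume f: "f \<in> hom_comp d"
    then have "f \<in> M d" by (simp add: M_def hom_comp_def homogeneous_def)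
    then have "f \<in> J d" unfolding J_def using pol_mod.subspace_0[OF I] by force
    then have "f \<in> J (Suc d)" using N[OF d] N[of "Suc d"] d by simp
    then obtain p q where pq: "f = p + q" "p \<in> I" "q \<in> M (Suc d)" by (auto simp: J_def)
    have "hpart d q = 0" using pq(3) by (intro part_eq_0) (auto simp: M_def)
    then have "f = hpart d p" using pq(1) f by (metis add.right_neutral hom_comp_def hpart_id mem_Collect_eq part_add)
    then show "f \<in> I" using homogeneous_ideal_hpart[OF homog pq(2)] by simp
  qed
  then show ?thesis by blast
qed

theorem corollary3p5:
  fixes I :: "('n::{finite,linorder}, 'k::field_char_0) mpoly set"
    and n :: nat
  assumes "n = CARD('n)"
    and "is_ideal I" and "homogeneous_ideal I"
    and "I \<noteq> UNIV"
    and "artinian_quotient I"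
    and "weak_lefschetz I"
  shows "(\<forall>d. (d \<le> reduction_number I \<longrightarrow> betti (gin I) (n - 1) (n - 1 + d) = 0) \<and>
              (d > reduction_number I \<longrightarrow>
                 int (betti (gin I) (n - 1) (n - 1 + d)) = int (hilb I (d - 1)) - int (hilb I d)))
       \<and> (\<forall>i d. i \<le> n - 1 \<and> d \<ge> reduction_number I + 2 \<longrightarrow>
              int (betti (gin I) i (i + d)) =
                int ((n - 1) choose i) * (int (hilb I (d - 1)) - int (hilb I d)))"
proof -
  interpret artinian_graded I
    using assms(3) artinian_quotient_large[OF assms(3,5)] by unfold_locales
  obtain g where g: "generic g" using generic_open by blast
  then have inv_g: "invertible g" by (simp add: generic_def)
  interpret P: graded_ideal "coord_change g ` I" by (rule graded_ideal_coord_change[OF assms(3) inv_g])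
  interpret S: stable_monomials "lead_of g" by (rule stable_monomials_generic[OF g assms(4)])
  have r: "reduction_number I = red g" by (rule reduction_number_eq[OF g])
  have gin: "gin I = mon_ideal (lead_of g)" by (rule gin_eq[OF g])
  have socle: "S.socle d = P.last_kernel d" for d
    unfolding S.socle_def P.last_kernel_def by (simp add: lead_of_def)
  \<comment> \<open>The kernel counted by \<open>S.socle d\<close> sits in degree d - 1, so for
    positive d the condition \<open>d \<le> red g\<close> reads \<open>e < red g\<close>.\<close>
  have low: "card (S.socle d) = 0" if "d \<le> red g" for d
  proof (cases d)
    case 0
    then show ?thesis by (simp add: S.socle_def)
  next
    case (Suc e)
    then show ?thesis using lefschetz_last_kernel[OF g assms(6,4), of e] that by (simp add: socle)
  qed
  \<comment> \<open>The cokernel of x_n in degree d is zero, as d - 1 is at least the reduction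
    number.\<close>
  have high: "int (card (S.socle d)) = int (hilb I (d - 1)) - int (hilb I d)" if d: "d > red g" for d
  proof -
    obtain e where e: "d = Suc e" using d by (cases d) auto
    have "last_free (Suc e) \<subseteq> lead_of g" using last_free_iff[OF inv_g, of e] d e by simp
    then have 0: "last_free (Suc e) - lead_monoms (coord_change g ` I) = {}" by (auto simp: lead_of_def)
    show ?thesis
      using P.card_last_kernel[of e] unfolding 0
      by (simp add: socle e hilb_coord_change[OF assms(3) inv_g])
  qed
  have n: "Suc (n - 1) = CARD('n)" using assms(1) by simp
  have top: "betti (gin I) (n - 1) (n - 1 + d) = card (S.socle d)" for d
    using S.betti_stable[where 'k = 'k, of "n - 1" d] n by (simp add: gin flip: n)
  have gen: "betti (gin I) i (i + d) = ((n - 1) choose i) * card (S.socle d)" if d: "d \<ge> red g + 2" for i d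
  proof -
    \<comment> \<open>The monomials in question have degree d - 1, one less than in the previous
      estimate; hence the bound r_1(A) + 2.\<close>
    have "last_free (d - 2 + 1) \<subseteq> lead_of g" using last_free_iff[OF inv_g, of "d - 2"] d by simp
    then have "\<forall>m. Suc (mdeg m) = d \<longrightarrow> lookup m x\<^sub>n = 0 \<longrightarrow> m \<in> lead_of g"
      using d by (auto simp: last_free_def)
    then show ?thesis using S.betti_stable[where 'k = 'k, of i d] n by (simp add: gin flip: n)
  qed
  show ?thesis unfolding r using top low high gen by simp
qed

end
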